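(* Suppose $V$ satisfies (V1), (V2) (with the constant $b>0$ and set $\mathcal{V}_b$ from (V2)) and (V3). (i) If $2<p<3$ and $|\mathcal{V}_b|<S^{3/2}$, then for all $\lambda\ge 1/b$ and all $\mu\ge 1/\big[4(1-|\mathcal{V}_b|^{2/3}S^{-1})\big]$, the equation $-\Delta u+\lambda V(x)u+\mu\phi_u u=|u|^{p-2}u$ in $\mathbb{R}^3$ has no nontrivial solution in $E_\lambda$. (ii) If $p=3$, then for all $\lambda>0$ and $\mu>1/4$, the equation $-\Delta u+\lambda V(x)u+\mu\phi_u u=|u|u$ in $\mathbb{R}^3$ has no nontrivial solution in $E_\lambda$.
   Context: $V:\mathbb{R}^3\to\mathbb{R}$ is subject to: (V1) $V\in C(\mathbb{R}^3,\mathbb{R})$ and $V\ge 0$; (V2) there exists $b>0$ such that $\mathcal{V}_b:=\{x\in\mathbb{R}^3: V(x)<b\}$ is nonempty and has finite Lebesgue measure $|\mathcal{V}_b|$; (V3) $\Omega:=\operatorname{int}V^{-1}(0)$ is a nonempty open set with locally Lipschitz boundary and $\overline{\Omega}=V^{-1}(0)$. $S$ is the best constant of the embedding $D^{1,2}(\mathbb{R}^3)\hookrightarrow L^6(\mathbb{R}^3)$, i.e. the largest $S$ with $S\big(\int|u|^6\big)^{1/3}\le\int|\nabla u|^2$. For $\lambda>0$, $E_\lambda=\{u\in H^1(\mathbb{R}^3):\int V u^2<\infty\}$ with norm $\|u\|_\lambda=(\int(|\nabla u|^2+\lambda Vu^2))^{1/2}$. $\phi_u(x)=\int_{\mathbb{R}^3}\frac{u^2(y)}{4\pi|x-y|}dy$.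 A solution in $E_\lambda$ is a weak solution: $u\in E_\lambda$ with $\int(\nabla u\nabla v+\lambda Vuv+\mu\phi_u uv)\,dx=\int|u|^{p-2}uv\,dx$ for all $v\in E_\lambda$; nontrivial means $u\not\equiv0$. *)

theory Defs
  imports "HOL-Analysis.Analysis"
begin

type_synonym R3 = "real^3"

definition partial :: "3 \<Rightarrow> (R3 \<Rightarrow> real) \<Rightarrow> R3 \<Rightarrow> real" where
  "partial i f x = frechet_derivative f (at x) (axis i 1)"

fun iter_partial :: "3 list \<Rightarrow> (R3 \<Rightarrow> real) \<Rightarrow> R3 \<Rightarrow> real" where
  "iter_partial [] f = f"
| "iter_partial (i # is) f = partial i (iter_partial is f)"

definition smooth_fun :: "(R3 \<Rightarrow> real) \<Rightarrow> bool" where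
  "smooth_fun f \<longleftrightarrow> (\<forall>is x. iter_partial is f differentiable (at x))"

definition test_fun :: "(R3 \<Rightarrow> real) \<Rightarrow> bool" where
  "test_fun \<phi> \<longleftrightarrow> smooth_fun \<phi> \<and> compact (closure {x. \<phi> x \<noteq> 0})"

definition loc_integrable :: "(R3 \<Rightarrow> real) \<Rightarrow> bool" where
  "loc_integrable f \<longleftrightarrow> (\<forall>K. compact K \<longrightarrow> set_integrable lebesgue K f)"

definition weak_gradient :: "(R3 \<Rightarrow> real) \<Rightarrow> (R3 \<Rightarrow> R3) \<Rightarrow> bool" where
  "weak_gradient u Du \<longleftrightarrow>
     u \<in> borel_measurable lebesgue \<and> Du \<in> borel_measurable lebesgue \<and>
     loc_integrable u \<and> (\<forall>i. loc_integrable (\<lambda>x. Du x $ i)) \<and>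
     (\<forall>\<phi> i. test_fun \<phi> \<longrightarrow>
        (\<integral>x. u x * partial i \<phi> x \<partial>lebesgue) = - (\<integral>x. Du x $ i * \<phi> x \<partial>lebesgue))"

definition H1 :: "(R3 \<Rightarrow> real) set" where
  "H1 = {u. \<exists>Du. weak_gradient u Du \<and> integrable lebesgue (\<lambda>x. (u x)\<^sup>2)
                 \<and> integrable lebesgue (\<lambda>x. (norm (Du x))\<^sup>2)}"

definition D12 :: "(R3 \<Rightarrow> real) set" where
  "D12 = {u. \<exists>Du. weak_gradient u Du \<and> integrable lebesgue (\<lambda>x. (u x) ^ 6)
                 \<and> integrable lebesgue (\<lambda>x. (norm (Du x))\<^sup>2)}"

definition sobolev_S :: real where
  "sobolev_S = Sup {S. \<forall>u Du. u \<in> D12 \<and> weak_gradient u Du \<longrightarrow>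
      S * (\<integral>x. (u x) ^ 6 \<partial>lebesgue) powr (1/3) \<le> (\<integral>x. (norm (Du x))\<^sup>2 \<partial>lebesgue)}"

definition E_space :: "(R3 \<Rightarrow> real) \<Rightarrow> (R3 \<Rightarrow> real) set" where
  "E_space V = {u \<in> H1. (\<integral>\<^sup>+x. ennreal (V x * (u x)\<^sup>2) \<partial>lebesgue) < \<infinity>}"

definition phi :: "(R3 \<Rightarrow> real) \<Rightarrow> R3 \<Rightarrow> real" where
  "phi u x = (\<integral>y. (u y)\<^sup>2 / (4 * pi * dist x y) \<partial>lebesgue)"

definition weak_solution ::
  "(R3 \<Rightarrow> real) \<Rightarrow> real \<Rightarrow> real \<Rightarrow> real \<Rightarrow> (R3 \<Rightarrow> real) \<Rightarrow> bool" where
  "weak_solution V lam \<mu> p u \<longleftrightarrow> u \<in> E_space V \<and>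
     (\<exists>Du. weak_gradient u Du \<and>
        (\<forall>v Dv. v \<in> E_space V \<and> weak_gradient v Dv \<longrightarrow>
          (\<integral>x. Du x \<bullet> Dv x + lam * V x * u x * v x + \<mu> * phi u x * u x * v x \<partial>lebesgue)
          = (\<integral>x. \<bar>u x\<bar> powr (p - 2) * u x * v x \<partial>lebesgue)))"

definition nontrivial :: "(R3 \<Rightarrow> real) \<Rightarrow> bool" where
  "nontrivial u \<longleftrightarrow> \<not> (AE x in lebesgue. u x = 0)"

definition locally_lipschitz_boundary :: "R3 set \<Rightarrow> bool" where
  "locally_lipschitz_boundary \<Omega> \<longleftrightarrow>
     (\<forall>x0\<in>frontier \<Omega>. \<exists>r>0. \<exists>(Q::R3 \<Rightarrow> R3) (L::real) (\<gamma>::real \<times> real \<Rightarrow> real). orthogonal_transformation Q \<and>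
        lipschitz_on L (UNIV :: (real \<times> real) set) \<gamma> \<and>
        (\<forall>y\<in>ball x0 r. y \<in> \<Omega> \<longleftrightarrow>
            Q (y - x0) $ 3 < \<gamma> (Q (y - x0) $ 1, Q (y - x0) $ 2)))"

end

theory Submission
  imports Defs
begin

text \<open>
  Testing the equation with \<open>u\<close> itself gives \<open>G + \<lambda>L + \<mu>D = \<integral>\<bar>u\<bar>\<^sup>p\<close>, where \<open>G\<close> is the Dirichlet
  integral, \<open>L = \<integral>V u\<^sup>2\<close>, and \<open>D = \<integral>\<phi>\<^sub>u u\<^sup>2\<close> is the Coulomb energy. The key inequality is
  \<open>\<integral>\<bar>u\<bar>\<^sup>3 \<le> t G + D / (4t)\<close> for all \<open>t > 0\<close>: it is the Cauchy-Schwarz inequality for the positive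
  definite Coulomb form applied to \<open>u\<^sup>2\<close> and \<open>-\<Delta>W\<close>, where \<open>W\<close> runs through smooth compactly supported
  approximations of \<open>\<bar>u\<bar>\<close>, because \<open>W\<close> is the Newtonian potential of \<open>-\<Delta>W\<close>. For \<open>p = 3\<close> take \<open>t = 1\<close>. For
  \<open>2 < p < 3\<close> interpolate \<open>\<bar>u\<bar>\<^sup>p \<le> (3 - p) u\<^sup>2 + (p - 2) \<bar>u\<bar>\<^sup>3\<close>, bound \<open>\<integral>u\<^sup>2\<close> by \<open>\<kappa>G + \<lambda>L\<close>, where
  \<open>\<kappa> = \<bar>V\<^sub>b\<bar>\<^bsup>2/3\<^esup> / S\<close>, and take \<open>t = 1 - \<kappa>\<close>. In both cases \<open>D = 0\<close>, hence \<open>u = 0\<close>.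
\<close>

section \<open>Calculus and integration by parts\<close>

text \<open>The thresholds on \<mu> reflect the factor 4 pi in \<open>phi\<close>: completing the
  square leaves D / (4t), which \<mu> D dominates for t = 1 or t = 1 - \<kappa>. When p < 3, the
  gradient terms are absorbed because (3 - p) \<kappa> + (p - 2) (1 - \<kappa>) is at most 1, and a
  surplus (3 - p) \<mu> D remains, so \<mu> may equal its threshold; at p = 3 the surplus is gone
  and the bound must be strict. Positive definiteness comes from writing 1 / |x - y| as a
  superposition of products of Gaussians instead of from the Fourier transform. Expanding the
  quadratic form requires finite energies, as a divergent Bochner integral is 0 by convention; a
  Hardy-type inequality provides them for every u in H^1. Limits are taken by Fatou's lemma, so
  approximants need only a.e. convergence and one-sided bounds. The hypotheses concern Lebesgue
  measurable functions while Fubini is applied to Borel product measures, hence the Borel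
  representatives. S is a supremum of reals, whose defining set has to be shown bounded; S > 0 is
  read off from the smallness of the sublevel set.\<close>

lemma lborel_translate:
  fixes f :: "'a::euclidean_space \<Rightarrow> real"
  assumes [measurable]: "f \<in> borel_measurable borel"
  shows integrable_lborel_translate: "integrable lborel (\<lambda>x. f (x + c)) \<longleftrightarrow> integrable lborel f"
    and integral_lborel_translate: "(LBINT x. f (x + c)) = (LBINT x. f x)"
proof -
  have d: "distr lborel borel (\<lambda>x. x + c) = (lborel :: 'a measure)"
    using lborel_distr_plus[of c] by (subst add.commute)
  show "integrable lborel (\<lambda>x. f (x + c)) \<longleftrightarrow> integrable lborel f"
    by (subst (2) d[symmetric]) (simp add: integrable_distr_eq)
  show "(LBINT x. f (x + c)) = (LBINT x. f x)"
    by (subst (2) d[symmetric]) (simp add: integral_distr)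
qed

lemma distr_lborel_reflect:
  "distr lborel borel (\<lambda>x. c - x) = (lborel :: 'a::euclidean_space measure)"
proof -
  have "(lborel :: 'a measure) = density (distr lborel borel (\<lambda>x. c + (- 1) *\<^sub>R x)) (\<lambda>_. \<bar>-1::real\<bar> ^ DIM('a))"
    by (rule lborel_affine) simp
  then show ?thesis by (simp add: density_1)
qed

lemma lborel_reflect:
  fixes f :: "'a::euclidean_space \<Rightarrow> real"
  assumes [measurable]: "f \<in> borel_measurable borel"
  shows integrable_lborel_reflect: "integrable lborel (\<lambda>x. f (c - x)) \<longleftrightarrow> integrable lborel f"
    and integral_lborel_reflect: "(LBINT x. f (c - x)) = (LBINT x. f x)"
proof -
  show "integrable lborel (\<lambda>x. f (c - x)) \<longleftrightarrow> integrable lborel f"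
    by (subst (2) distr_lborel_reflect[of c, symmetric]) (simp add: integrable_distr_eq)
  show "(LBINT x. f (c - x)) = (LBINT x. f x)"
    by (subst (2) distr_lborel_reflect[of c, symmetric]) (simp add: integral_distr)
qed

lemma nn_integral_lborel_reflect:
  fixes f :: "'a::euclidean_space \<Rightarrow> ennreal"
  assumes [measurable]: "f \<in> borel_measurable borel"
  shows "(\<integral>\<^sup>+x. f (c - x) \<partial>lborel) = (\<integral>\<^sup>+x. f x \<partial>lborel)"
  by (subst (2) distr_lborel_reflect[of c, symmetric]) (simp add: nn_integral_distr)

lemma nn_integral_lborel_translate:
  fixes f :: "'a::euclidean_space \<Rightarrow> ennreal"
  assumes [measurable]: "f \<in> borel_measurable borel"
  shows "(\<integral>\<^sup>+x. f (x + c) \<partial>lborel) = (\<integral>\<^sup>+x. f x \<partial>lborel)"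
proof -
  have d: "distr lborel borel (\<lambda>x. x + c) = (lborel :: 'a measure)"
    using lborel_distr_plus[of c] by (subst add.commute)
  show ?thesis by (subst (2) d[symmetric]) (simp add: nn_integral_distr)
qed

lemma integrable_bounded_support:
  fixes f :: "'a::euclidean_space \<Rightarrow> real"
  assumes [measurable]: "f \<in> borel_measurable borel"
    and M: "\<And>x. \<bar>f x\<bar> \<le> M" and r: "\<And>x. norm x > r \<Longrightarrow> f x = 0"
  shows "integrable lborel f"
proof (rule Bochner_Integration.integrable_bound)
  show "integrable lborel (\<lambda>x. M * indicator (cball 0 r) x :: real)"
    by (intro integrable_mult_right integrable_real_indicator) (simp_all add: emeasure_lborel_cball_finite[unfolded infinity_ennreal_def])
  show "AE x in lborel. norm (f x) \<le> norm (M * indicator (cball 0 r) x :: real)"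
  proof (rule AE_I2)
    fix x show "norm (f x) \<le> norm (M * indicator (cball 0 r) x :: real)"
      using M[of x] r[of x] by (cases "norm x > r") (auto simp: indicator_def)
  qed
qed simp

lemma continuous_bounded_support:
  fixes f :: "'a::euclidean_space \<Rightarrow> real"
  assumes c: "continuous_on UNIV f" and r: "\<And>x. norm x > r \<Longrightarrow> f x = 0"
  obtains M where "M \<ge> 0" "\<And>x. \<bar>f x\<bar> \<le> M"
proof -
  have "compact (f ` cball 0 r)"
    by (intro compact_continuous_image continuous_on_subset[OF c]) auto
  then obtain M where M: "\<And>y. y \<in> f ` cball 0 r \<Longrightarrow> \<bar>y\<bar> \<le> M"
    using compact_imp_bounded[of "f ` cball 0 r"] by (auto simp: bounded_real)
  have "\<bar>f x\<bar> \<le> max M 0" for x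
    using M[of "f x"] r[of x] by (cases "norm x > r") (auto simp: le_max_iff_disj)
  then show ?thesis using that[of "max M 0"] by auto
qed

lemma differentiable_continuous_UNIV:
  fixes f :: "'a::real_normed_vector \<Rightarrow> 'b::real_normed_vector"
  assumes "\<And>x. f differentiable (at x)"
  shows "continuous_on UNIV f"
  using assms by (intro continuous_at_imp_continuous_on ballI differentiable_imp_continuous_within) auto

lemma differentiable_borel_measurable:
  fixes f :: "'a::euclidean_space \<Rightarrow> real"
  assumes "\<And>x. f differentiable (at x)"
  shows "f \<in> borel_measurable borel"
  using differentiable_continuous_UNIV[OF assms] by (rule borel_measurable_continuous_onI)

lemma partial_eqI: "(f has_derivative f') (at x) \<Longrightarrow> partial i f x = f' (axis i 1)"
  unfolding partial_def using frechet_derivative_at by metis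

lemma has_derivative_partial:
  fixes f :: "R3 \<Rightarrow> real"
  assumes "f differentiable (at x)"
  shows "(f has_derivative (\<lambda>h. \<Sum>i\<in>UNIV. h $ i * partial i f x)) (at x)"
proof -
  have d: "(f has_derivative frechet_derivative f (at x)) (at x)"
    using assms frechet_derivative_works by blast
  then have l: "linear (frechet_derivative f (at x))"
    by (rule has_derivative_linear)
  have "frechet_derivative f (at x) h = (\<Sum>i\<in>UNIV. h $ i * partial i f x)" for h
  proof -
    have "frechet_derivative f (at x) h = frechet_derivative f (at x) (\<Sum>i\<in>UNIV. h $ i *\<^sub>R axis i 1)"
      by (subst basis_expansion[symmetric, of h]) (simp add: scalar_mult_eq_scaleR)
    also have "\<dots> = (\<Sum>i\<in>UNIV. h $ i * partial i f x)"
      by (simp add: linear_sum[OF l] linear_cmul[OF l] partial_def)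
    finally show ?thesis .
  qed
  then have "frechet_derivative f (at x) = (\<lambda>h. \<Sum>i\<in>UNIV. h $ i * partial i f x)"
    by (rule ext)
  with d show ?thesis by metis
qed

lemma partial_line_derivative:
  fixes f :: "R3 \<Rightarrow> real"
  assumes "f differentiable (at (x + s *\<^sub>R axis i 1))"
  shows "((\<lambda>s. f (x + s *\<^sub>R axis i 1)) has_real_derivative partial i f (x + s *\<^sub>R axis i 1)) (at s)"
proof -
  have d: "(f has_derivative frechet_derivative f (at (x + s *\<^sub>R axis i 1))) (at (x + s *\<^sub>R axis i 1))"
    using assms frechet_derivative_works by blast
  have "((\<lambda>s. f (x + s *\<^sub>R axis i 1)) has_derivative
      (\<lambda>h. frechet_derivative f (at (x + s *\<^sub>R axis i 1)) (h *\<^sub>R axis i 1))) (at s)"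
    by (rule has_derivative_compose[of "\<lambda>s. x + s *\<^sub>R axis i 1", OF _ d])
       (auto intro!: derivative_eq_intros)
  moreover have "frechet_derivative f (at (x + s *\<^sub>R axis i 1)) (h *\<^sub>R axis i 1)
      = partial i f (x + s *\<^sub>R axis i 1) * h" for h
    using linear_cmul[OF has_derivative_linear[OF d]] by (simp add: partial_def)
  ultimately show ?thesis by (simp add: has_field_derivative_def)
qed

text \<open>Translation invariance makes the difference quotients integrate to zero.\<close>

lemma integral_partial_eq_0:
  fixes g :: "R3 \<Rightarrow> real"
  assumes d: "\<And>x. g differentiable (at x)" and M: "\<And>x. \<bar>partial i g x\<bar> \<le> M"
    and r: "\<And>x. norm x > r \<Longrightarrow> g x = 0"
  shows "integrable lborel (partial i g)" "(LBINT x. partial i g x) = 0"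
proof -
  define e :: R3 where "e = axis i 1"
  define F where "F = (\<lambda>n x. (g (x + (1 / real (Suc n)) *\<^sub>R e) - g x) * real (Suc n))"
  have gm [measurable]: "g \<in> borel_measurable borel"
    by (rule differentiable_borel_measurable[OF d])
  obtain N where N: "\<And>x. \<bar>g x\<bar> \<le> N"
    using continuous_bounded_support[OF differentiable_continuous_UNIV[OF d] r] by metis
  have gi: "integrable lborel g"
    by (rule integrable_bounded_support[OF gm N r])
  have Fm [measurable]: "F n \<in> borel_measurable borel" for n
    unfolding F_def by measurable
  have F0: "(LBINT x. F n x) = 0" for n
    unfolding F_def
    using gi by (simp add: integrable_lborel_translate integral_lborel_translate)
  have lim: "(\<lambda>n. F n x) \<longlonglongrightarrow> partial i g x" for x
  proof -
    have "((\<lambda>s. g (x + s *\<^sub>R e)) has_real_derivative partial i g x) (at 0)"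
      using partial_line_derivative[of g x 0 i] d by (simp add: e_def)
    then have "((\<lambda>s. (g (x + s *\<^sub>R e) - g x) / s) \<longlongrightarrow> partial i g x) (at 0)"
      by (simp add: DERIV_def)
    moreover have "filterlim (\<lambda>n. 1 / real (Suc n)) (at 0) sequentially"
      unfolding filterlim_at using LIMSEQ_Suc[OF lim_1_over_n] by simp
    ultimately have "(\<lambda>n. (g (x + (1 / real (Suc n)) *\<^sub>R e) - g x) / (1 / real (Suc n))) \<longlonglongrightarrow> partial i g x"
      by (rule filterlim_compose)
    then show ?thesis by (simp add: F_def)
  qed
  \<comment> \<open>The derivative is assumed bounded but not continuous; its measurability comes
    from being a pointwise limit of the measurable quotients.\<close>
  have pm: "partial i g \<in> borel_measurable lborel"
    by (rule borel_measurable_LIMSEQ_real[OF lim]) auto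
  have M0: "M \<ge> 0" using M[of 0] by linarith
  \<comment> \<open>All shifts have length at most 1, so every quotient vanishes outside radius |r|
    + 1. Inside, the mean value theorem turns the quotient into a value of
    \<open>partial i g\<close>, which M bounds.\<close>
  have bnd: "\<bar>F n x\<bar> \<le> M * indicator (cball 0 (\<bar>r\<bar> + 1)) x" for n x
  proof (cases "norm x > \<bar>r\<bar> + 1")
    case True
    have "norm x \<le> norm (x + (1 / real (Suc n)) *\<^sub>R e) + norm ((1 / real (Suc n)) *\<^sub>R e)"
      using norm_triangle_ineq4[of "x + (1 / real (Suc n)) *\<^sub>R e" "(1 / real (Suc n)) *\<^sub>R e"] by simp
    also have "norm ((1 / real (Suc n)) *\<^sub>R e) \<le> 1" by (simp add: e_def)
    finally have "norm (x + (1 / real (Suc n)) *\<^sub>R e) > r" using True by linarith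
    moreover have "norm x > r" using True by linarith
    ultimately show ?thesis using True r by (auto simp: F_def indicator_def)
  next
    case False
    have "\<exists>z. 0 < z \<and> z < 1 / real (Suc n) \<and> g (x + (1 / real (Suc n)) *\<^sub>R e) - g (x + 0 *\<^sub>R e)
        = (1 / real (Suc n) - 0) * partial i g (x + z *\<^sub>R e)"
      by (rule MVT2) (auto simp: e_def intro!: partial_line_derivative d)
    then obtain z where "g (x + (1 / real (Suc n)) *\<^sub>R e) - g x = (1 / real (Suc n)) * partial i g (x + z *\<^sub>R e)"
      by auto
    then have "F n x = partial i g (x + z *\<^sub>R e)" by (simp add: F_def)
    then show ?thesis using False M by (auto simp: indicator_def)
  qed
  have bi: "integrable lborel (\<lambda>x. M * indicator (cball 0 (\<bar>r\<bar> + 1)) (x::R3) :: real)"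
    by (intro integrable_mult_right integrable_real_indicator) (simp_all add: emeasure_lborel_cball_finite[unfolded infinity_ennreal_def])
  show "integrable lborel (partial i g)"
    by (rule integrable_dominated_convergence[where s = F, OF pm _ bi])
       (simp_all add: lim bnd)
  have "(\<lambda>n. LBINT x. F n x) \<longlonglongrightarrow> (LBINT x. partial i g x)"
    by (rule integral_dominated_convergence[where s = F, OF pm _ bi])
       (simp_all add: lim bnd)
  then show "(LBINT x. partial i g x) = 0"
    by (simp add: F0 LIMSEQ_const_iff)
qed

lemma partial_arith:
  fixes f g :: "R3 \<Rightarrow> real"
  assumes "f differentiable (at x)" "g differentiable (at x)"
  shows partial_add: "partial i (\<lambda>x. f x + g x) x = partial i f x + partial i g x"
    and partial_diff: "partial i (\<lambda>x. f x - g x) x = partial i f x - partial i g x"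
    and partial_mult: "partial i (\<lambda>x. f x * g x) x = partial i f x * g x + f x * partial i g x"
proof -
  have f: "(f has_derivative frechet_derivative f (at x)) (at x)"
    and g: "(g has_derivative frechet_derivative g (at x)) (at x)"
    using assms frechet_derivative_works by blast+
  show "partial i (\<lambda>x. f x + g x) x = partial i f x + partial i g x"
    using partial_eqI[OF has_derivative_add[OF f g]] by (simp add: partial_def)
  show "partial i (\<lambda>x. f x - g x) x = partial i f x - partial i g x"
    using partial_eqI[OF has_derivative_diff[OF f g]] by (simp add: partial_def)
  show "partial i (\<lambda>x. f x * g x) x = partial i f x * g x + f x * partial i g x"
    using partial_eqI[OF has_derivative_mult[OF f g]] by (simp add: partial_def algebra_simps)
qed

lemma partial_chain:
  fixes f :: "R3 \<Rightarrow> real"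
  assumes "f differentiable (at x)" "(h has_real_derivative h') (at (f x))"
  shows "partial i (\<lambda>x. h (f x)) x = h' * partial i f x"
    and "(\<lambda>x. h (f x)) differentiable (at x)"
proof -
  have f: "(f has_derivative frechet_derivative f (at x)) (at x)"
    using assms frechet_derivative_works by blast
  have "((\<lambda>x. h (f x)) has_derivative (\<lambda>t. h' * frechet_derivative f (at x) t)) (at x)"
    using has_derivative_compose[OF f, of h "(*) h'"] assms(2) by (simp add: has_field_derivative_def)
  from partial_eqI[OF this] this show "partial i (\<lambda>x. h (f x)) x = h' * partial i f x"
    and "(\<lambda>x. h (f x)) differentiable (at x)"
    by (auto simp: partial_def differentiable_def)
qed

lemma partial_const [simp]: "partial i (\<lambda>x. c) x = 0"
  using partial_eqI[OF has_derivative_const[of c "at x"]] by simp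

lemma partial_coord [simp]: "partial i (\<lambda>x. x $ j) x = (if i = j then 1 else 0)"
proof -
  have "((\<lambda>x::R3. x $ j) has_derivative (\<lambda>x. x $ j)) (at x)"
    by (rule bounded_linear_imp_has_derivative) (rule bounded_linear_vec_nth)
  from partial_eqI[OF this, of i] show ?thesis by (simp add: axis_def)
qed

lemma differentiable_coord [simp]: "(\<lambda>x::R3. x $ j) differentiable (at x)"
  using bounded_linear_imp_has_derivative[OF bounded_linear_vec_nth] by (auto simp: differentiable_def)

lemma partial_reflect:
  fixes f :: "R3 \<Rightarrow> real"
  assumes "f differentiable (at (c - x))"
  shows "partial i (\<lambda>y. f (c - y)) x = - partial i f (c - x)"
    and "(\<lambda>y. f (c - y)) differentiable (at x)"
proof -
  have f: "(f has_derivative frechet_derivative f (at (c - x))) (at (c - x))"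
    using assms frechet_derivative_works by blast
  have h: "((\<lambda>y. f (c - y)) has_derivative (\<lambda>t. frechet_derivative f (at (c - x)) (- t))) (at x)"
    by (rule has_derivative_compose[of "\<lambda>y. c - y", OF _ f]) (auto intro!: derivative_eq_intros)
  show "partial i (\<lambda>y. f (c - y)) x = - partial i f (c - x)"
    using partial_eqI[OF h] linear_neg[OF has_derivative_linear[OF f]] by (simp add: partial_def)
  show "(\<lambda>y. f (c - y)) differentiable (at x)" using h by (auto simp: differentiable_def)
qed

lemma partial_zero_outside:
  fixes f :: "R3 \<Rightarrow> real"
  assumes "\<And>x. norm x > r \<Longrightarrow> f x = 0" and "norm x > r"
  shows "partial i f x = 0"
proof -
  have "((\<lambda>x. 0) has_derivative (\<lambda>x. 0 :: real)) (at x)" by simp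
  moreover have "open {x :: R3. norm x > r}" by (intro open_Collect_less continuous_intros)
  ultimately have "(f has_derivative (\<lambda>x. 0)) (at x)"
    using assms by (intro has_derivative_transform_within_open[of "\<lambda>x. 0" _ x UNIV "{x. norm x > r}" f]) auto
  from partial_eqI[OF this] show ?thesis by simp
qed

section \<open>Test functions and bumps\<close>

text \<open>The iterated partials quantified over in \<open>smooth_fun\<close> need not be computed:
  a class of differentiable functions closed under \<open>partial\<close> contains them all.\<close>

lemma smooth_fun_coinduct:
  assumes "f \<in> C" "\<And>g x. g \<in> C \<Longrightarrow> g differentiable (at x)" "\<And>g i. g \<in> C \<Longrightarrow> partial i g \<in> C"
  shows "smooth_fun f"
proof -
  have "iter_partial is f \<in> C" for "is"
    using assms(1,3) by (induction "is") auto
  then show ?thesis unfolding smooth_fun_def using assms(2) by blast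
qed

text \<open>By the Leibniz rule, sums of products of generators stay of this form under
  \<open>partial\<close> as soon as the partials of the generators do. This is the class handed to
  \<open>smooth_fun_coinduct\<close>.\<close>

inductive_set alg_hull :: "(R3 \<Rightarrow> real) set \<Rightarrow> (R3 \<Rightarrow> real) set" for B where
  base: "f \<in> B \<Longrightarrow> f \<in> alg_hull B"
| add: "f \<in> alg_hull B \<Longrightarrow> g \<in> alg_hull B \<Longrightarrow> (\<lambda>x. f x + g x) \<in> alg_hull B"
| mult: "f \<in> alg_hull B \<Longrightarrow> g \<in> alg_hull B \<Longrightarrow> (\<lambda>x. f x * g x) \<in> alg_hull B"

lemma smooth_fun_alg_hull:
  assumes f: "f \<in> alg_hull B" and d: "\<And>g x. g \<in> B \<Longrightarrow> g differentiable (at x)"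
    and p: "\<And>g i. g \<in> B \<Longrightarrow> partial i g \<in> alg_hull B"
  shows "smooth_fun f"
proof (rule smooth_fun_coinduct[OF f])
  fix g assume "g \<in> alg_hull B"
  then have *: "(\<forall>x. g differentiable (at x)) \<and> (\<forall>i. partial i g \<in> alg_hull B)"
  proof induction
    case (base f) then show ?case using d p by blast
  next
    case (add f g)
    then have "partial i (\<lambda>x. f x + g x) = (\<lambda>x. partial i f x + partial i g x)" for i
      by (intro ext partial_add) auto
    with add show ?case by (auto intro: alg_hull.add)
  next
    case (mult f g)
    then have "partial i (\<lambda>x. f x * g x) = (\<lambda>x. partial i f x * g x + f x * partial i g x)" for i
      by (intro ext partial_mult) auto
    with mult show ?case by (auto intro!: alg_hull.add alg_hull.mult)
  qed
  show "g differentiable (at x)" for x using * by blast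
  show "partial i g \<in> alg_hull B" for i using * by blast
qed

lemma iter_partial_partial: "iter_partial is (partial i f) = iter_partial (is @ [i]) f"
  by (induction "is") auto

lemma smooth_fun_differentiable: "smooth_fun f \<Longrightarrow> f differentiable (at x)"
  unfolding smooth_fun_def by (metis iter_partial.simps(1))

lemma smooth_fun_partial: "smooth_fun f \<Longrightarrow> smooth_fun (partial i f)"
  unfolding smooth_fun_def iter_partial_partial by blast

text \<open>The generators are all iterated partials of both factors, a set that
  \<open>partial\<close> maps into itself; \<open>alg_hull\<close> absorbs the product rule.\<close>

lemma smooth_fun_mult:
  assumes "smooth_fun f" "smooth_fun g"
  shows "smooth_fun (\<lambda>x. f x * g x)"
proof (rule smooth_fun_alg_hull)
  let ?B = "range (\<lambda>is. iter_partial is f) \<union> range (\<lambda>is. iter_partial is g)"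
  have "iter_partial [] f \<in> ?B" "iter_partial [] g \<in> ?B" by blast+
  then show "(\<lambda>x. f x * g x) \<in> alg_hull ?B"
    by (intro alg_hull.mult alg_hull.base) simp_all
  show "h differentiable (at x)" if "h \<in> ?B" for h x
    using that assms unfolding smooth_fun_def by blast
  show "partial i h \<in> alg_hull ?B" if "h \<in> ?B" for i h
  proof (rule alg_hull.base)
    from that consider "is" where "h = iter_partial is f" | "is" where "h = iter_partial is g" by blast
    then show "partial i h \<in> ?B"
      by cases (metis UnI1 UnI2 iter_partial.simps(2) rangeI)+
  qed
qed

lemma smooth_fun_const: "smooth_fun (\<lambda>x. c)"
proof (rule smooth_fun_coinduct[of _ "range (\<lambda>c x. c)"])
  show "partial i g \<in> range (\<lambda>c x. c)" if "g \<in> range (\<lambda>c x. c)" for g i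
  proof -
    have "partial i g = (\<lambda>x. 0)" using that by auto
    then show ?thesis by blast
  qed
qed auto

text \<open>Each differentiation contributes one sign. Reflections matter because a convolution
  kernel enters as the function y |-> \<eta> (x - y) of its second variable.\<close>

lemma smooth_fun_reflect:
  assumes "smooth_fun f"
  shows "smooth_fun (\<lambda>y. f (c - y))"
proof -
  have *: "iter_partial is (\<lambda>y. f (c - y)) = (\<lambda>y. (-1) ^ length is * iter_partial is f (c - y))" for "is"
  proof (induction "is")
    case (Cons i "is")
    have d: "iter_partial is f differentiable (at x)" for x
      using assms unfolding smooth_fun_def by blast
    show ?case
    proof
      fix y
      show "iter_partial (i # is) (\<lambda>y. f (c - y)) y = (-1) ^ length (i # is) * iter_partial (i # is) f (c - y)"
        using Cons partial_mult[of "\<lambda>y. (-1) ^ length is" y "\<lambda>y. iter_partial is f (c - y)" i]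
          partial_reflect(1)[OF d, where c=c and x=y and i=i] partial_reflect(2)[OF d, where c=c and x=y] by simp
    qed
  qed simp
  show ?thesis unfolding smooth_fun_def *
    using assms partial_reflect(2) unfolding smooth_fun_def
    by (intro allI differentiable_mult) auto
qed

lemma compact_closure_support_iff:
  "compact (closure {x::R3. \<phi> x \<noteq> (0::real)}) \<longleftrightarrow> (\<exists>r. \<forall>x. norm x > r \<longrightarrow> \<phi> x = 0)"
  unfolding compact_closure bounded_iff by (auto simp: not_le[symmetric])

lemma test_fun_iff: "test_fun \<phi> \<longleftrightarrow> smooth_fun \<phi> \<and> (\<exists>r. \<forall>x. norm x > r \<longrightarrow> \<phi> x = 0)"
  unfolding test_fun_def compact_closure_support_iff ..

lemma test_fun_smooth_mult:
  assumes "smooth_fun f" "test_fun g" shows "test_fun (\<lambda>x. f x * g x)"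
  using assms unfolding test_fun_iff by (auto intro: smooth_fun_mult)

lemma test_fun_partial: assumes "test_fun f" shows "test_fun (partial i f)"
  using assms partial_zero_outside unfolding test_fun_iff by (metis smooth_fun_partial)

lemma test_fun_reflect: assumes "test_fun f" shows "test_fun (\<lambda>y. f (c - y))"
proof -
  obtain r where r: "\<And>x. norm x > r \<Longrightarrow> f x = 0" using assms unfolding test_fun_iff by blast
  have "f (c - x) = 0" if "norm x > r + norm c" for x
    using that norm_triangle_ineq4[of c "c - x"] by (intro r) simp
  with assms show ?thesis unfolding test_fun_iff by (blast intro: smooth_fun_reflect)
qed

lemma test_fun_facts:
  assumes "test_fun f"
  shows test_fun_differentiable: "f differentiable (at x)"
    and test_fun_continuous: "continuous_on UNIV f"
    and test_fun_measurable: "f \<in> borel_measurable borel"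
    and test_fun_bounded: "\<exists>M\<ge>0. \<forall>x. \<bar>f x\<bar> \<le> M"
    and test_fun_support: "\<exists>r>0. \<forall>x. norm x > r \<longrightarrow> f x = 0"
    and test_fun_integrable: "integrable lborel f"
proof -
  have d: "f differentiable (at x)" for x
    using assms smooth_fun_differentiable unfolding test_fun_def by blast
  then show "f differentiable (at x)" .
  show c: "continuous_on UNIV f" by (rule differentiable_continuous_UNIV[OF d])
  show m: "f \<in> borel_measurable borel" by (rule differentiable_borel_measurable[OF d])
  obtain r where r: "\<And>x. norm x > r \<Longrightarrow> f x = 0" using assms unfolding test_fun_iff by blast
  show "\<exists>M\<ge>0. \<forall>x. \<bar>f x\<bar> \<le> M" using continuous_bounded_support[OF c r] by metis
  then obtain M where "\<And>x. \<bar>f x\<bar> \<le> M" by blast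
  then show "integrable lborel f" using integrable_bounded_support[OF m _ r] by blast
  show "\<exists>r>0. \<forall>x. norm x > r \<longrightarrow> f x = 0" using r by (intro exI[of _ "\<bar>r\<bar> + 1"]) auto
qed

section \<open>Smooth cut-offs built from exp(-1/t)\<close>

definition flat :: "nat \<Rightarrow> real \<Rightarrow> real" where
  "flat k t = (if t > 0 then exp (- (1 / t)) / t ^ k else 0)"

text \<open>From the right, h = 1/s turns the quotient into s^(k+1) / exp s; from the left it is 0.
  This is differentiability of \<open>flat k\<close> at its only delicate point.\<close>

lemma flat_limit_0: "((\<lambda>h. flat k h / h) \<longlongrightarrow> 0) (at 0)"
proof -
  have "((\<lambda>s::real. s ^ (k + 1) / exp s) \<longlongrightarrow> 0) at_top" by (rule tendsto_power_div_exp_0)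
  then have "((\<lambda>h. inverse h ^ (k + 1) / exp (inverse h)) \<longlongrightarrow> (0::real)) (at_right 0)"
    by (rule filterlim_compose[OF _ filterlim_inverse_at_top_right])
  then have r: "((\<lambda>h. flat k h / h) \<longlongrightarrow> 0) (at_right 0)"
    by (rule Lim_transform_eventually)
       (auto simp: eventually_at_right_field flat_def exp_minus field_simps intro!: exI[of _ 1])
  have "((\<lambda>h::real. 0 :: real) \<longlongrightarrow> 0) (at_left 0)" by simp
  then have l: "((\<lambda>h. flat k h / h) \<longlongrightarrow> 0) (at_left 0)"
    by (rule Lim_transform_eventually)
       (auto simp: eventually_at_left_field flat_def intro!: exI[of _ "-1"])
  from l r show ?thesis by (simp add: filterlim_split_at)
qed

text \<open>The index k exists for this formula: derivatives are combinations of members of the same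
  family, so its span is closed under differentiation. For k = 0 the derivative is just
  \<open>flat 2\<close>.\<close>

lemma flat_derivative:
  "(flat k has_real_derivative (flat (k + 2) t - real k * flat (k + 1) t)) (at t)"
proof -
  consider "t > 0" | "t < 0" | "t = 0" by linarith
  then show ?thesis
  proof cases
    case 1
    have i: "((\<lambda>t. 1 / t) has_real_derivative - ((1 / t)\<^sup>2)) (at t)"
      using 1 by (auto intro!: derivative_eq_intros simp: power2_eq_square field_simps)
    \<comment> \<open>In the variable s = 1/t the product rule is a polynomial identity; k = 0 is
      split off because of the truncated exponent k - Suc 0.\<close>
    have eq: "exp (- s) * - (- s\<^sup>2) * s ^ k + real k * (- s\<^sup>2 * s ^ (k - Suc 0)) * exp (- s)
        = exp (- s) * s ^ (k + 2) - real k * (exp (- s) * s ^ (k + 1))" for s :: real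
      by (cases k) (simp_all add: algebra_simps power2_eq_square)
    have "((\<lambda>t. exp (- (1 / t)) * (1 / t) ^ k) has_real_derivative
        exp (- (1 / t)) * (1 / t) ^ (k + 2) - real k * (exp (- (1 / t)) * (1 / t) ^ (k + 1))) (at t)"
      using DERIV_mult[OF DERIV_fun_exp[OF DERIV_minus[OF i]] DERIV_power[OF i, of k]]
      unfolding eq[of "1 / t"] .
    then have "((\<lambda>t. exp (- (1 / t)) / t ^ k) has_real_derivative
        flat (k + 2) t - real k * flat (k + 1) t) (at t)"
      using 1 by (simp add: flat_def divide_inverse power_inverse)
    then show ?thesis
      by (rule has_field_derivative_transform_within_open[of _ _ _ "{0<..}"]) (use 1 in \<open>auto simp: flat_def\<close>)
  next
    case 2
    have "((\<lambda>t. 0) has_real_derivative flat (k + 2) t - real k * flat (k + 1) t) (at t)"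
      using 2 by (simp add: flat_def)
    then show ?thesis
      by (rule has_field_derivative_transform_within_open[of _ _ _ "{..<0}"]) (use 2 in \<open>auto simp: flat_def\<close>)
  next
    case 3
    then show ?thesis using flat_limit_0[of k] by (simp add: DERIV_def flat_def[of _ 0])
  qed
qed

lemma flat_nonneg: "flat k t \<ge> 0" by (simp add: flat_def)

lemma flat_0_le_1: "flat 0 t \<le> 1" by (simp add: flat_def)

text \<open>The quadratic Taylor bound (1/t)^2 / 2 \<le> exp (1/t) gives it. As
  \<open>flat 2\<close> is the derivative of \<open>flat 0\<close>, this bounds the gradients of the
  cut-offs independently of R.\<close>

lemma flat_2_le_2: "flat 2 t \<le> 2"
proof (cases "t > 0")
  case True
  have "exp (1 / t) \<ge> 1 + 1 / t + (1 / t)\<^sup>2 / 2"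
    using True by (intro exp_lower_Taylor_quadratic) simp
  moreover have "1 / t > 0" using True by simp
  ultimately have "(1 / t)\<^sup>2 \<le> 2 * exp (1 / t)" by linarith
  then show ?thesis using True by (simp add: flat_def exp_minus field_simps)
qed (simp add: flat_def)

lemma smooth_flat_product:
  "smooth_fun (\<lambda>x. (flat 0 (R + x $ 1) * flat 0 (R - x $ 1)) *
     ((flat 0 (R + x $ 2) * flat 0 (R - x $ 2)) * (flat 0 (R + x $ 3) * flat 0 (R - x $ 3))))"
proof (rule smooth_fun_alg_hull)
  define B :: "(R3 \<Rightarrow> real) set" where
    "B = {\<lambda>x. flat k (R + s * x $ i) | k s i. True} \<union> {\<lambda>x. c | c. True}"
  have b: "(\<lambda>x. flat k (R + s * x $ i)) \<in> alg_hull B" for k s i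
    by (rule alg_hull.base) (auto simp: B_def)
  have c: "(\<lambda>x. c) \<in> alg_hull B" for c
    by (rule alg_hull.base) (auto simp: B_def)
  show "(\<lambda>x. (flat 0 (R + x $ 1) * flat 0 (R - x $ 1)) *
     ((flat 0 (R + x $ 2) * flat 0 (R - x $ 2)) * (flat 0 (R + x $ 3) * flat 0 (R - x $ 3)))) \<in> alg_hull B"
    using b[of 0 1] b[of 0 "-1"] by (intro alg_hull.mult) auto
  have ch: "partial j (\<lambda>x. flat k (R + s * x $ i)) x =
      (flat (k + 2) (R + s * x $ i) - real k * flat (k + 1) (R + s * x $ i)) * (if j = i then s else 0)"
    "(\<lambda>x. flat k (R + s * x $ i)) differentiable (at x)" for j k s i x
  proof -
    have d: "(\<lambda>x::R3. R + s * x $ i) differentiable (at x)"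
      by (intro differentiable_add differentiable_mult) auto
    have "partial j (\<lambda>x. R + s * x $ i) x = (if j = i then s else 0)"
      by (simp add: partial_add partial_mult)
    then show "partial j (\<lambda>x. flat k (R + s * x $ i)) x =
      (flat (k + 2) (R + s * x $ i) - real k * flat (k + 1) (R + s * x $ i)) * (if j = i then s else 0)"
      using partial_chain(1)[OF d flat_derivative[of k]] by simp
    show "(\<lambda>x. flat k (R + s * x $ i)) differentiable (at x)"
      using partial_chain(2)[OF d flat_derivative[of k]] .
  qed
  show "g differentiable (at x)" if "g \<in> B" for g x
    using that ch(2) by (auto simp: B_def)
  show "partial j g \<in> alg_hull B" if "g \<in> B" for g j
  proof -
    from that consider k s i where "g = (\<lambda>x. flat k (R + s * x $ i))" | c where "g = (\<lambda>x. c)"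
      unfolding B_def by blast
    then show ?thesis
    proof cases
      case (1 k s i)
      have "partial j g = (\<lambda>x. (flat (k + 2) (R + s * x $ i) + (- real k) * flat (k + 1) (R + s * x $ i)) * (if j = i then s else 0))"
        using ch(1) by (simp add: 1 fun_eq_iff)
      then show ?thesis by (simp only:) (intro alg_hull.mult alg_hull.add b c)
    next
      case 2
      then have "partial j g = (\<lambda>x. 0)" by auto
      then show ?thesis using c by simp
    qed
  qed
qed

text \<open>A product over coordinates instead of a radial profile, so that smoothness reduces to
  one-variable calculus. It is positive exactly on the open cube of half-side R. The same function
  serves as a mollifier profile for small R and as a cut-off for large R, since it tends to 1
  pointwise.\<close>

definition bump :: "real \<Rightarrow> R3 \<Rightarrow> real" where
  "bump R x = (flat 0 (R + x $ 1) * flat 0 (R - x $ 1)) *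
     ((flat 0 (R + x $ 2) * flat 0 (R - x $ 2)) * (flat 0 (R + x $ 3) * flat 0 (R - x $ 3)))"

lemma bump_nonneg: "bump R x \<ge> 0"
  unfolding bump_def by (intro mult_nonneg_nonneg flat_nonneg)

lemma bump_le_1: "bump R x \<le> 1"
  unfolding bump_def
  by (intro mult_le_one mult_nonneg_nonneg flat_nonneg flat_0_le_1)

lemma bump_nonzero_coord: assumes "bump R x \<noteq> 0" shows "\<bar>x $ i\<bar> < R"
proof -
  have "\<bar>x $ 1\<bar> < R \<and> \<bar>x $ 2\<bar> < R \<and> \<bar>x $ 3\<bar> < R"
    using assms by (auto simp: bump_def flat_def split: if_splits)
  then show ?thesis using exhaust_3[of i] by auto
qed

lemma bump_support: assumes "norm x > 3 * R" shows "bump R x = 0"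
proof (rule ccontr)
  assume n: "bump R x \<noteq> 0"
  have "norm x \<le> (\<Sum>i\<in>UNIV. \<bar>x $ i\<bar>)" by (rule norm_le_l1_cart)
  also have "\<dots> \<le> (\<Sum>i\<in>(UNIV::3 set). R)"
    using bump_nonzero_coord[OF n] by (intro sum_mono less_imp_le) auto
  finally show False using assms by simp
qed

lemma bump_pos: assumes "norm x < R" shows "bump R x > 0"
proof -
  have "\<bar>x $ i\<bar> < R" for i using component_le_norm_cart[of x i] assms by linarith
  then have "0 < R + x $ i \<and> 0 < R - x $ i" for i
    by (metis abs_less_iff diff_gt_0_iff_gt minus_less_iff real_0_less_add_iff)
  then show ?thesis by (auto simp: bump_def flat_def)
qed

lemma test_fun_bump: "test_fun (bump R)"
  unfolding test_fun_iff
  using smooth_flat_product[of R] bump_support[of R] by (auto simp: bump_def[abs_def])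

lemma flat_at_top:
  "(\<lambda>n. flat 0 (real n + t)) \<longlonglongrightarrow> 1" "(\<lambda>n. flat 2 (real n + t)) \<longlonglongrightarrow> 0"
proof -
  have s: "filterlim (\<lambda>n. real n + t) at_top sequentially"
    using filterlim_tendsto_add_at_top[OF tendsto_const filterlim_real_sequentially, of t]
    by (simp add: add.commute)
  then have i: "(\<lambda>n. inverse (real n + t)) \<longlonglongrightarrow> 0"
    by (rule filterlim_compose[OF tendsto_inverse_0_at_top])
       (rule filterlim_ident)
  have e: "eventually (\<lambda>n. real n + t > 0) sequentially"
    using s by (simp add: filterlim_at_top_dense)
  have "(\<lambda>n. exp (- inverse (real n + t))) \<longlonglongrightarrow> exp (- 0)" by (intro tendsto_intros i)
  then show "(\<lambda>n. flat 0 (real n + t)) \<longlonglongrightarrow> 1"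
    by (simp, elim Lim_transform_eventually) (use e in \<open>eventually_elim, simp add: flat_def inverse_eq_divide\<close>)
  have "(\<lambda>n. exp (- inverse (real n + t)) * (inverse (real n + t))\<^sup>2) \<longlonglongrightarrow> exp (- 0) * 0\<^sup>2" by (intro tendsto_intros i)
  then show "(\<lambda>n. flat 2 (real n + t)) \<longlonglongrightarrow> 0"
    by (simp, elim Lim_transform_eventually) (use e in \<open>eventually_elim, simp add: flat_def field_simps\<close>)
qed

lemma bump_tendsto_1: "(\<lambda>n. bump (real n) x) \<longlonglongrightarrow> 1"
proof -
  have "(\<lambda>n. bump (real n) x) \<longlonglongrightarrow> (1 * 1) * ((1 * 1) * (1 * 1))"
    unfolding bump_def using flat_at_top(1)[of "- (x $ _)"]
    by (intro tendsto_mult flat_at_top) (simp_all)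
  then show ?thesis by simp
qed

text \<open>The product rule for u times \<open>bump n\<close> leaves the error u times
  \<open>partial i (bump n)\<close>. A bound independent of n and pointwise decay to 0 make this
  error disappear by dominated convergence.\<close>

lemma partial_bump:
  shows partial_bump_bounded: "\<bar>partial i (bump R) x\<bar> \<le> 4"
    and partial_bump_tendsto_0: "(\<lambda>n. partial i (bump (real n)) x) \<longlonglongrightarrow> 0"
proof -
  \<comment> \<open>F is the one-dimensional factor of \<open>bump\<close> and F' its derivative in
    t; each of the two terms of F' is at most 2 in absolute value, whence the bound 4.\<close>
  define F where "F = (\<lambda>R t. flat 0 (R + t) * flat 0 (R - t))"
  define F' where "F' = (\<lambda>R t. flat 2 (R + t) * flat 0 (R - t) - flat 0 (R + t) * flat 2 (R - t))"
  have F: "(F R has_real_derivative F' R t) (at t)" for R t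
  proof -
    have "((\<lambda>t. flat 0 (R + t)) has_real_derivative flat 2 (R + t)) (at t)"
      using flat_derivative[of 0 "R + t"] DERIV_shift[of "flat 0" _ t R] by (simp add: numeral_2_eq_2 add.commute)
    moreover have "((\<lambda>t. flat 0 (R - t)) has_real_derivative - flat 2 (R - t)) (at t)"
      using flat_derivative[of 0 "R - t"] DERIV_mirror[of "\<lambda>t. flat 0 (R + t)" "flat 2 (R - t)" t]
        DERIV_shift[of "flat 0" _ "-t" R] by (simp add: numeral_2_eq_2 add.commute)
    ultimately have "((\<lambda>t. flat 0 (R + t) * flat 0 (R - t)) has_real_derivative
        flat 2 (R + t) * flat 0 (R - t) + (- flat 2 (R - t)) * flat 0 (R + t)) (at t)"
      by (rule DERIV_mult)
    then show ?thesis by (simp add: F_def F'_def algebra_simps)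
  qed
  have d: "(\<lambda>x. F R (x $ j)) differentiable (at x)" for R j and x :: R3
    using partial_chain(2)[where f="\<lambda>x. x $ j", OF differentiable_coord F] .
  have p: "partial i (\<lambda>x. F R (x $ j)) x = F' R (x $ j) * (if i = j then 1 else 0)" for R x i j
    using partial_chain(1)[where f="\<lambda>x. x $ j" and i=i, OF differentiable_coord F] by simp
  have b: "bump R = (\<lambda>x. F R (x $ 1) * (F R (x $ 2) * F R (x $ 3)))" for R
    by (simp add: fun_eq_iff bump_def F_def)
  have pb: "partial i (bump R) x = F' R (x $ 1) * (if i = 1 then 1 else 0) * (F R (x $ 2) * F R (x $ 3)) +
      F R (x $ 1) * (F' R (x $ 2) * (if i = 2 then 1 else 0) * F R (x $ 3) +
        F R (x $ 2) * (F' R (x $ 3) * (if i = 3 then 1 else 0)))" for R x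
    unfolding b by (simp add: partial_mult d p differentiable_mult)
  have Fb: "0 \<le> F R t" "F R t \<le> 1" for R t
    unfolding F_def by (intro mult_le_one mult_nonneg_nonneg flat_nonneg flat_0_le_1)+
  have m2: "\<bar>a * b\<bar> \<le> 2" if "\<bar>a\<bar> \<le> 2" "\<bar>b\<bar> \<le> 1" for a b :: real
    using mult_mono[of "\<bar>a\<bar>" 2 "\<bar>b\<bar>" 1] that by (simp add: abs_mult)
  have m4: "\<bar>a * b\<bar> \<le> 4" if "\<bar>a\<bar> \<le> 4" "\<bar>b\<bar> \<le> 1" for a b :: real
    using mult_mono[of "\<bar>a\<bar>" 4 "\<bar>b\<bar>" 1] that by (simp add: abs_mult)
  have F'b: "\<bar>F' R t\<bar> \<le> 4" for R t
  proof -
    have "\<bar>flat 2 (R + t) * flat 0 (R - t)\<bar> \<le> 2" "\<bar>flat 2 (R - t) * flat 0 (R + t)\<bar> \<le> 2"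
      by (intro m2; simp add: flat_nonneg flat_2_le_2 flat_0_le_1 abs_of_nonneg)+
    then show ?thesis unfolding F'_def by (simp add: mult.commute)
  qed
  have FF: "\<bar>F R s * F R t\<bar> \<le> 1" for R s t
    using Fb by (simp add: abs_mult mult_le_one)
  consider "i = 1" | "i = 2" | "i = 3" using exhaust_3[of i] by blast
  then have "\<exists>j k l. partial i (bump R) x = F' R (x $ j) * (F R (x $ k) * F R (x $ l))"
  proof cases
    case 1 then show ?thesis by - (rule exI[of _ 1], rule exI[of _ 2], rule exI[of _ 3], subst pb, simp)
  next
    case 2 then show ?thesis by - (rule exI[of _ 2], rule exI[of _ 1], rule exI[of _ 3], subst pb, simp)
  next
    case 3 then show ?thesis by - (rule exI[of _ 3], rule exI[of _ 1], rule exI[of _ 2], subst pb, simp)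
  qed
  then obtain j k l where "partial i (bump R) x = F' R (x $ j) * (F R (x $ k) * F R (x $ l))" by blast
  then show "\<bar>partial i (bump R) x\<bar> \<le> 4"
    using m4[OF F'b FF] by simp
  have Ft: "(\<lambda>n. F (real n) t) \<longlonglongrightarrow> 1 * 1" for t
    unfolding F_def using flat_at_top(1)[of "- t"] by (intro tendsto_mult flat_at_top) simp
  have F't: "(\<lambda>n. F' (real n) t) \<longlonglongrightarrow> 0 * 1 - 1 * 0" for t
    unfolding F'_def using flat_at_top(1)[of "- t"] flat_at_top(2)[of "- t"]
    by (intro tendsto_mult tendsto_diff flat_at_top) simp_all
  have "(\<lambda>n. partial i (bump (real n)) x) \<longlonglongrightarrow> 
     (0 * 1 - 1 * 0) * (if i = 1 then 1 else 0) * ((1 * 1) * (1 * 1)) +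
      (1 * 1) * ((0 * 1 - 1 * 0) * (if i = 2 then 1 else 0) * (1 * 1) +
        (1 * 1) * ((0 * 1 - 1 * 0) * (if i = 3 then 1 else 0)))"
    unfolding pb by (intro tendsto_mult tendsto_add Ft F't tendsto_const)
  then show "(\<lambda>n. partial i (bump (real n)) x) \<longlonglongrightarrow> 0" by simp
qed

section \<open>Continuity of translations in L1\<close>

lemma integrable_mult_bounded:
  fixes f g :: "'a \<Rightarrow> real"
  assumes f: "integrable M f" and [measurable]: "g \<in> borel_measurable M" and B: "\<And>x. \<bar>g x\<bar> \<le> B"
  shows "integrable M (\<lambda>x. f x * g x)"
proof (rule Bochner_Integration.integrable_bound)
  show "integrable M (\<lambda>x. B * \<bar>f x\<bar>)" using f by simp
  show "(\<lambda>x. f x * g x) \<in> borel_measurable M" using f by simp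
  show "AE x in M. norm (f x * g x) \<le> norm (B * \<bar>f x\<bar>)"
  proof (rule AE_I2)
    fix x
    have "\<bar>f x\<bar> * \<bar>g x\<bar> \<le> \<bar>f x\<bar> * B" using B by (intro mult_left_mono) auto
    also have "\<dots> \<le> \<bar>B * \<bar>f x\<bar>\<bar>" by (simp add: mult.commute)
    finally show "norm (f x * g x) \<le> norm (B * \<bar>f x\<bar>)" by (simp add: abs_mult)
  qed
qed

text \<open>Induction over integrable functions: indicators, sums, dominated limits. Indicators are
  treated first for open sets, where translates converge at every point of the set, then for Borel
  sets by outer regularity.\<close>

lemma translation_continuous_L1_seq:
  fixes f :: "'a::euclidean_space \<Rightarrow> real" and h :: "nat \<Rightarrow> 'a"
  assumes f: "integrable lborel f" and h: "h \<longlonglongrightarrow> 0"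
  shows "(\<lambda>n. LBINT x. \<bar>f (x + h n) - f x\<bar>) \<longlonglongrightarrow> 0"
  using f
proof (induction f rule: integrable_induct)
  case (base A c)
  have [measurable]: "A \<in> sets borel" using base by simp
  define I :: "'a set \<Rightarrow> 'a \<Rightarrow> real" where "I = indicator"
  have Ii: "integrable lborel (I B)" if "B \<in> sets borel" "emeasure lborel B < \<infinity>" for B
    unfolding I_def using that by (intro integrable_real_indicator) auto
  have Im [measurable]: "I B \<in> borel_measurable borel" if "B \<in> sets borel" for B
    unfolding I_def using that by simp
  have Iti: "integrable lborel (\<lambda>x. I B (x + t))" if "B \<in> sets borel" "emeasure lborel B < \<infinity>" for B t
    using Ii[OF that] integrable_lborel_translate[OF Im] that by blast
  have op: "(\<lambda>n. LBINT x. \<bar>I U (x + h n) - I U x\<bar>) \<longlonglongrightarrow> 0"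
    if U: "open U" "emeasure lborel U < \<infinity>" for U
  proof -
    have [measurable]: "U \<in> sets borel" using U by simp
    \<comment> \<open>For values 0 and 1, |a - b| = a + b - 2ab, and translation preserves
      integrals, so only the overlap of U with its translate must converge. The overlap is 0 off U,
      so no convergence is asked for at boundary points.\<close>
    have eq: "(LBINT x. \<bar>I U (x + h n) - I U x\<bar>) = 2 * (LBINT x. I U x) - 2 * (LBINT x. I U (x + h n) * I U x)" for n
    proof -
      have "integrable lborel (\<lambda>x. I U x * I U (x + h n))"
        by (rule integrable_mult_bounded[OF Ii, where B=1]) (use U in \<open>auto simp: I_def indicator_def\<close>)
      then have "integrable lborel (\<lambda>x. I U (x + h n) * I U x)" by (simp add: mult.commute)
      moreover have "\<bar>I U (x + h n) - I U x\<bar> = I U (x + h n) + I U x - 2 * (I U (x + h n) * I U x)" for x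
        by (auto simp: I_def indicator_def)
      ultimately show ?thesis
        using Ii[of U] Iti[of U "h n"] U integral_lborel_translate[OF Im, of U "h n"] by simp
    qed
    have "(\<lambda>n. LBINT x. I U (x + h n) * I U x) \<longlonglongrightarrow> (LBINT x. I U x)"
    proof (rule integral_dominated_convergence[where w = "I U"])
      show "AE x in lborel. (\<lambda>n. I U (x + h n) * I U x) \<longlonglongrightarrow> I U x"
      proof (rule AE_I2)
        fix x
        show "(\<lambda>n. I U (x + h n) * I U x) \<longlonglongrightarrow> I U x"
        proof (cases "x \<in> U")
          case True
          have "(\<lambda>n. x + h n) \<longlonglongrightarrow> x" using tendsto_add[OF tendsto_const h, of x] by simp
          then have "eventually (\<lambda>n. x + h n \<in> U) sequentially"
            using True U topological_tendstoD by blast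
          then have "eventually (\<lambda>n. I U x = I U (x + h n) * I U x) sequentially"
            by eventually_elim (use True in \<open>simp add: I_def\<close>)
          then show ?thesis by (rule Lim_transform_eventually[OF tendsto_const])
        qed (simp add: I_def)
      qed
      show "integrable lborel (I U)" using U by (intro Ii) auto
    qed (auto simp: I_def indicator_def)
    then have "(\<lambda>n. 2 * (LBINT x. I U x) - 2 * (LBINT x. I U (x + h n) * I U x))
        \<longlonglongrightarrow> 2 * (LBINT x. I U x) - 2 * (LBINT x. I U x)"
      by (intro tendsto_intros)
    then show ?thesis by (simp add: eq)
  qed
  have A: "(\<lambda>n. LBINT x. \<bar>I A (x + h n) - I A x\<bar>) \<longlonglongrightarrow> 0"
  proof (rule LIMSEQ_I)
    fix e :: real assume e: "e > 0"
    \<comment> \<open>The excess U - A costs at most e / 4 for A and e / 4 for its translate,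
      leaving e / 2 for the open set.\<close>
    obtain U where U: "open U" "A \<subseteq> U" "emeasure lborel (U - A) < ennreal (e / 4)"
      using outer_regular_lborel[of A "e / 4"] e by auto
    have [measurable]: "U \<in> sets borel" using U by simp
    have UA: "emeasure lborel (U - A) < \<infinity>" using U(3) by (auto intro: less_trans)
    have "emeasure lborel U \<le> emeasure lborel A + emeasure lborel (U - A)"
    proof -
      have "U = A \<union> (U - A)" using U by auto
      then show ?thesis using emeasure_subadditive[of A lborel "U - A"] by simp
    qed
    also have "\<dots> < \<infinity>" using base UA by simp
    finally have Uf: "emeasure lborel U < \<infinity>" .
    have mUA: "(LBINT x. I (U - A) x) < e / 4"
    proof -
      have "(LBINT x. I (U - A) x) = measure lborel (U - A)"
        unfolding I_def by simp
      also have "\<dots> < e / 4"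
      proof -
        have "emeasure lborel (U - A) = ennreal (measure lborel (U - A))"
          using UA by (intro emeasure_eq_ennreal_measure) auto
        then show ?thesis using U(3) by (simp only: ennreal_less_iff measure_nonneg)
      qed
      finally show ?thesis .
    qed
    obtain N where N: "\<And>n. n \<ge> N \<Longrightarrow> (LBINT x. \<bar>I U (x + h n) - I U x\<bar>) < e / 2"
      using order_tendstoD(2)[OF op[OF U(1) Uf], of "e / 2"] e unfolding eventually_sequentially by auto
    have "(LBINT x. \<bar>I A (x + h n) - I A x\<bar>) < e" if n: "n \<ge> N" for n
    proof -
      have i1: "integrable lborel (\<lambda>x. \<bar>I U (x + h n) - I U x\<bar>)"
        using Ii[of U] Iti[of U "h n"] Uf by auto
      have i2: "integrable lborel (\<lambda>x. I (U - A) (x + h n))" "integrable lborel (I (U - A))"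
        using Ii[of "U - A"] Iti[of "U - A" "h n"] UA by auto
      have "(LBINT x. \<bar>I A (x + h n) - I A x\<bar>)
          \<le> (LBINT x. \<bar>I U (x + h n) - I U x\<bar> + (I (U - A) (x + h n) + I (U - A) x))"
      proof (rule integral_mono)
        show "integrable lborel (\<lambda>x. \<bar>I A (x + h n) - I A x\<bar>)"
          using Ii[of A] Iti[of A "h n"] base by auto
        show "\<bar>I A (x + h n) - I A x\<bar> \<le> \<bar>I U (x + h n) - I U x\<bar> + (I (U - A) (x + h n) + I (U - A) x)" for x
          using U(2) by (auto simp: I_def indicator_def)
      qed (use i1 i2 in auto)
      also have "\<dots> = (LBINT x. \<bar>I U (x + h n) - I U x\<bar>) + ((LBINT x. I (U - A) x) + (LBINT x. I (U - A) x))"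
        using i1 i2 integral_lborel_translate[OF Im, of "U - A" "h n"] by simp
      also have "\<dots> < e" using N[OF n] mUA by linarith
      finally show ?thesis .
    qed
    then show "\<exists>N. \<forall>n\<ge>N. norm ((LBINT x. \<bar>I A (x + h n) - I A x\<bar>) - 0) < e"
      by (intro exI[of _ N]) auto
  qed
  have "(LBINT x. \<bar>indicat_real A (x + h n) *\<^sub>R c - indicat_real A x *\<^sub>R c\<bar>)
      = \<bar>c\<bar> * (LBINT x. \<bar>I A (x + h n) - I A x\<bar>)" for n
    by (subst integral_mult_right_zero[symmetric], rule Bochner_Integration.integral_cong)
       (auto simp: I_def indicator_def)
  then show ?case using tendsto_mult[OF tendsto_const A, of "\<bar>c\<bar>"] by simp
next
  case (add f g)
  have fm: "f \<in> borel_measurable borel" "g \<in> borel_measurable borel"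
    using add borel_measurable_integrable by auto
  have i: "integrable lborel (\<lambda>x. \<bar>f (x + h n) - f x\<bar>)" "integrable lborel (\<lambda>x. \<bar>g (x + h n) - g x\<bar>)"
    "integrable lborel (\<lambda>x. \<bar>f (x + h n) + g (x + h n) - (f x + g x)\<bar>)" for n
    using add integrable_lborel_translate[OF fm(1), of "h n"] integrable_lborel_translate[OF fm(2), of "h n"] by auto
  have "(LBINT x. \<bar>f (x + h n) + g (x + h n) - (f x + g x)\<bar>)
      \<le> (LBINT x. \<bar>f (x + h n) - f x\<bar>) + (LBINT x. \<bar>g (x + h n) - g x\<bar>)" for n
    unfolding Bochner_Integration.integral_add[OF i(1,2), symmetric]
    by (rule integral_mono) (use i in auto)
  moreover have "(\<lambda>n. (LBINT x. \<bar>f (x + h n) - f x\<bar>) + (LBINT x. \<bar>g (x + h n) - g x\<bar>)) \<longlonglongrightarrow> 0 + 0"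
    using add by (intro tendsto_add)
  ultimately show ?case
    by - (rule tendsto_sandwich[of "\<lambda>n. 0" _ _ "\<lambda>n. (LBINT x. \<bar>f (x + h n) - f x\<bar>) + (LBINT x. \<bar>g (x + h n) - g x\<bar>)"], auto)
next
  case (lim f s)
  have fm: "f \<in> borel_measurable borel" "\<And>k. s k \<in> borel_measurable borel"
    using borel_measurable_integrable[OF lim.hyps(4)] borel_measurable_integrable[OF lim.hyps(1)] by auto
  have "(\<lambda>k. LBINT x. \<bar>s k x - f x\<bar>) \<longlonglongrightarrow> (\<integral>x. 0 \<partial>(lborel :: 'a measure))"
  \<comment> \<open>The approximants of the induction principle satisfy |s k| \<le> 2 |f|, so |s k -
    f| is dominated by 3 |f|.\<close>
  proof (rule integral_dominated_convergence[where w = "\<lambda>x. 3 * \<bar>f x\<bar>"])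
    show "integrable lborel (\<lambda>x. 3 * \<bar>f x\<bar>)" using lim.hyps(4) by simp
    show "AE x in lborel. (\<lambda>k. \<bar>s k x - f x\<bar>) \<longlonglongrightarrow> 0"
      using lim.hyps(2) by (intro AE_I2 tendsto_rabs_zero LIM_zero) auto
    show "AE x in lborel. norm \<bar>s k x - f x\<bar> \<le> 3 * \<bar>f x\<bar>" for k
    proof (rule AE_I2)
      fix x
      have "\<bar>s k x\<bar> \<le> 2 * \<bar>f x\<bar>" using lim.hyps(3)[of x k] by simp
      then show "norm \<bar>s k x - f x\<bar> \<le> 3 * \<bar>f x\<bar>" unfolding real_norm_def by linarith
    qed
  qed (use fm in auto)
  then have L: "(\<lambda>k. LBINT x. \<bar>s k x - f x\<bar>) \<longlonglongrightarrow> 0" by simp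
  show ?case
  proof (rule LIMSEQ_I)
    fix e :: real assume e: "e > 0"
    obtain k where k: "(LBINT x. \<bar>s k x - f x\<bar>) < e / 4"
      using order_tendstoD(2)[OF L, of "e / 4"] e unfolding eventually_sequentially by auto
    obtain N where N: "\<And>n. n \<ge> N \<Longrightarrow> (LBINT x. \<bar>s k (x + h n) - s k x\<bar>) < e / 2"
      using order_tendstoD(2)[OF lim.IH[of k], of "e / 2"] e unfolding eventually_sequentially by auto
    have "(LBINT x. \<bar>f (x + h n) - f x\<bar>) < e" if n: "n \<ge> N" for n
    proof -
      define d where "d = (\<lambda>x. \<bar>s k x - f x\<bar>)"
      have dm: "d \<in> borel_measurable borel" using fm by (simp add: d_def)
      have di: "integrable lborel d" using lim.hyps(1,4) by (simp add: d_def)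
      have di': "integrable lborel (\<lambda>x. d (x + h n))" using di integrable_lborel_translate[OF dm] by blast
      have si: "integrable lborel (\<lambda>x. \<bar>s k (x + h n) - s k x\<bar>)"
        using lim.hyps(1) integrable_lborel_translate[OF fm(2), of k "h n"] by simp
      have "(LBINT x. \<bar>f (x + h n) - f x\<bar>) \<le> (LBINT x. \<bar>s k (x + h n) - s k x\<bar> + (d (x + h n) + d x))"
        by (rule integral_mono)
           (use lim.hyps(4) integrable_lborel_translate[OF fm(1), of "h n"] di di' si in \<open>auto simp: d_def\<close>)
      also have "\<dots> = (LBINT x. \<bar>s k (x + h n) - s k x\<bar>) + ((LBINT x. d x) + (LBINT x. d x))"
        using di di' si integral_lborel_translate[OF dm, of "h n"] by simp
      also have "\<dots> < e" using N[OF n] k by (simp add: d_def)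
      finally show ?thesis .
    qed
    then show "\<exists>N. \<forall>n\<ge>N. norm ((LBINT x. \<bar>f (x + h n) - f x\<bar>) - 0) < e"
      by (intro exI[of _ N]) auto
  qed
qed

lemma translation_continuous_L1:
  fixes f :: "'a::euclidean_space \<Rightarrow> real"
  assumes f: "integrable lborel f" and e: "e > 0"
  obtains d where "d > 0" "\<And>z. norm z < d \<Longrightarrow> (LBINT x. \<bar>f (x + z) - f x\<bar>) < e"
proof (rule ccontr)
  assume "\<not> thesis"
  then have "\<forall>d>0. \<exists>z. norm z < d \<and> \<not> (LBINT x. \<bar>f (x + z) - f x\<bar>) < e"
    using that by blast
  then have "\<forall>n::nat. \<exists>z. norm z < 1 / real (Suc n) \<and> \<not> (LBINT x. \<bar>f (x + z) - f x\<bar>) < e"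
    by auto
  then obtain h where h: "\<And>n. norm (h n) < 1 / real (Suc n)"
    and ge: "\<And>n. \<not> (LBINT x. \<bar>f (x + h n) - f x\<bar>) < e"
    by metis
  have "h \<longlonglongrightarrow> 0"
    by (rule Lim_null_comparison[OF _ LIMSEQ_Suc[OF lim_1_over_n]]) (intro always_eventually allI less_imp_le h)
  from order_tendstoD(2)[OF translation_continuous_L1_seq[OF f this] e]
  have "\<exists>n. (LBINT x. \<bar>f (x + h n) - f x\<bar>) < e"
    unfolding eventually_sequentially by blast
  with ge show False by blast
qed

section \<open>Mollification\<close>

definition conv :: "(R3 \<Rightarrow> real) \<Rightarrow> (R3 \<Rightarrow> real) \<Rightarrow> R3 \<Rightarrow> real" where
  "conv f \<eta> x = (LBINT y. f y * \<eta> (x - y))"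

lemma mvt_partial:
  fixes f :: "R3 \<Rightarrow> real"
  assumes d: "\<And>x. f differentiable (at x)"
  obtains z where "0 < z" "z < 1" "f (x + h) - f x = (\<Sum>i\<in>UNIV. h $ i * partial i f (x + z *\<^sub>R h))"
proof -
  have D: "((\<lambda>s. f (x + s *\<^sub>R h)) has_real_derivative (\<Sum>i\<in>UNIV. h $ i * partial i f (x + s *\<^sub>R h))) (at s)" for s
  proof -
    have "((\<lambda>s. f (x + s *\<^sub>R h)) has_derivative (\<lambda>t. \<Sum>i\<in>UNIV. (t *\<^sub>R h) $ i * partial i f (x + s *\<^sub>R h))) (at s)"
      by (rule has_derivative_compose[of "\<lambda>s. x + s *\<^sub>R h", OF _ has_derivative_partial[OF d]])
         (auto intro!: derivative_eq_intros)
    moreover have "(\<lambda>t. \<Sum>i\<in>UNIV. (t *\<^sub>R h) $ i * partial i f (x + s *\<^sub>R h))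
        = (*) (\<Sum>i\<in>UNIV. h $ i * partial i f (x + s *\<^sub>R h))"
      unfolding fun_eq_iff sum_distrib_right by (simp add: mult_ac)
    ultimately show ?thesis unfolding has_field_derivative_def by simp
  qed
  have "\<exists>z. 0 < z \<and> z < 1 \<and> f (x + 1 *\<^sub>R h) - f (x + 0 *\<^sub>R h)
      = (1 - 0) * (\<Sum>i\<in>UNIV. h $ i * partial i f (x + z *\<^sub>R h))"
    by (rule MVT2) (auto intro: D)
  then show ?thesis using that by auto
qed

lemma abs_sum_coord_le:
  fixes h :: R3
  assumes "\<And>i. \<bar>a i\<bar> \<le> B"
  shows "\<bar>\<Sum>i\<in>UNIV. h $ i * a i\<bar> \<le> 3 * B * norm h"
proof -
  have "\<bar>\<Sum>i\<in>UNIV. h $ i * a i\<bar> \<le> (\<Sum>i\<in>(UNIV::3 set). norm h * B)"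
    by (rule order_trans[OF sum_abs sum_mono])
       (auto simp: abs_mult intro!: mult_mono assms component_le_norm_cart)
  then show ?thesis by (simp add: mult_ac)
qed

lemma test_fun_partials_bounded:
  assumes "test_fun \<eta>"
  obtains M where "\<And>i x. \<bar>partial i \<eta> x\<bar> \<le> M"
proof -
  have "\<forall>i. \<exists>M. \<forall>x. \<bar>partial i \<eta> x\<bar> \<le> M"
    using test_fun_bounded[OF test_fun_partial[OF assms]] by blast
  then obtain M where M: "\<And>i x. \<bar>partial i \<eta> x\<bar> \<le> M i" by metis
  have "\<bar>partial i \<eta> x\<bar> \<le> Max (range M)" for i x
    using M[of i x] by (rule order_trans) auto
  then show ?thesis using that by blast
qed

text \<open>Two applications of the mean value theorem, each costing a factor 3 for the coordinates.
  That C is independent of x is what allows the remainder to be integrated in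
  \<open>conv_derivative\<close>.\<close>

lemma test_fun_taylor:
  assumes \<eta>: "test_fun \<eta>"
  obtains C where "\<And>x h. \<bar>\<eta> (x + h) - \<eta> x - (\<Sum>i\<in>UNIV. h $ i * partial i \<eta> x)\<bar> \<le> C * (norm h)\<^sup>2"
proof -
  have "\<exists>M. \<forall>j x. \<bar>partial j (partial i \<eta>) x\<bar> \<le> M" for i
    by (rule test_fun_partials_bounded[OF test_fun_partial[OF \<eta>], of i]) blast
  then obtain M where M: "\<And>i j x. \<bar>partial j (partial i \<eta>) x\<bar> \<le> M i" by metis
  define K where "K = Max (range M)"
  have K: "\<bar>partial j (partial i \<eta>) x\<bar> \<le> K" for i j x
    using M[of j i x] unfolding K_def by (rule order_trans) auto
  then have K0: "K \<ge> 0" by (meson abs_ge_zero order_trans)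
  have L: "\<bar>partial i \<eta> (x + h) - partial i \<eta> x\<bar> \<le> 3 * K * norm h" for i x h
  proof -
    obtain z where "partial i \<eta> (x + h) - partial i \<eta> x = (\<Sum>j\<in>UNIV. h $ j * partial j (partial i \<eta>) (x + z *\<^sub>R h))"
      by (rule mvt_partial[OF test_fun_differentiable[OF test_fun_partial[OF \<eta>]]])
    then show ?thesis using abs_sum_coord_le[OF K] by simp
  qed
  have "\<bar>\<eta> (x + h) - \<eta> x - (\<Sum>i\<in>UNIV. h $ i * partial i \<eta> x)\<bar> \<le> (9 * K) * (norm h)\<^sup>2" for x h
  proof -
    obtain z where z: "0 < z" "z < 1" "\<eta> (x + h) - \<eta> x = (\<Sum>i\<in>UNIV. h $ i * partial i \<eta> (x + z *\<^sub>R h))"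
      by (rule mvt_partial[OF test_fun_differentiable[OF \<eta>], of x h])
    have "\<eta> (x + h) - \<eta> x - (\<Sum>i\<in>UNIV. h $ i * partial i \<eta> x)
        = (\<Sum>i\<in>UNIV. h $ i * (partial i \<eta> (x + z *\<^sub>R h) - partial i \<eta> x))"
      by (simp add: z(3) sum_subtractf right_diff_distrib)
    also have "\<bar>\<dots>\<bar> \<le> 3 * (3 * K * norm h) * norm h"
    proof (rule abs_sum_coord_le)
      fix i
      have "\<bar>partial i \<eta> (x + z *\<^sub>R h) - partial i \<eta> x\<bar> \<le> 3 * K * norm (z *\<^sub>R h)" by (rule L)
      also have "\<dots> \<le> 3 * K * norm h"
        using K0 z by (intro mult_left_mono) (auto intro: mult_left_le_one_le)
      finally show "\<bar>partial i \<eta> (x + z *\<^sub>R h) - partial i \<eta> x\<bar> \<le> 3 * K * norm h" .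
    qed
    finally show ?thesis by (simp add: power2_eq_square mult_ac)
  qed
  then show ?thesis using that by blast
qed

lemma conv_integrable:
  assumes f: "integrable lborel f" and \<eta>: "test_fun \<eta>"
  shows "integrable lborel (\<lambda>y. f y * \<eta> (x - y))"
proof -
  obtain M where "\<And>x. \<bar>\<eta> x\<bar> \<le> M" using test_fun_bounded[OF \<eta>] by blast
  then show ?thesis
    using test_fun_measurable[OF \<eta>] by (intro integrable_mult_bounded[OF f, where B=M]) auto
qed

text \<open>The integrated Taylor remainder is at most C times the L1 norm of f times |h|^2, hence
  o(|h|). All derivatives fall on the kernel; f is merely integrable.\<close>

lemma conv_derivative:
  assumes f: "integrable lborel f" and \<eta>: "test_fun \<eta>"
  shows "(conv f \<eta> has_derivative (\<lambda>h. \<Sum>i\<in>UNIV. h $ i * conv f (partial i \<eta>) x)) (at x)"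
proof -
  obtain C where C: "\<And>x h. \<bar>\<eta> (x + h) - \<eta> x - (\<Sum>i\<in>UNIV. h $ i * partial i \<eta> x)\<bar> \<le> C * (norm h)\<^sup>2"
    by (rule test_fun_taylor[OF \<eta>]) blast
  define K where "K = C * (LBINT y. \<bar>f y\<bar>)"
  have est: "\<bar>conv f \<eta> (x + h) - conv f \<eta> x - (\<Sum>i\<in>UNIV. h $ i * conv f (partial i \<eta>) x)\<bar> \<le> K * (norm h)\<^sup>2" for h
  proof -
    note i = conv_integrable[OF f \<eta>] conv_integrable[OF f test_fun_partial[OF \<eta>]]
    have eq: "conv f \<eta> (x + h) - conv f \<eta> x - (\<Sum>i\<in>UNIV. h $ i * conv f (partial i \<eta>) x)
      = (LBINT y. f y * \<eta> (x + h - y) - f y * \<eta> (x - y) - (\<Sum>i\<in>UNIV. h $ i * (f y * partial i \<eta> (x - y))))"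
      unfolding conv_def using i by simp
    have "\<bar>\<dots>\<bar> \<le> (LBINT y. \<bar>f y * \<eta> (x + h - y) - f y * \<eta> (x - y) - (\<Sum>i\<in>UNIV. h $ i * (f y * partial i \<eta> (x - y)))\<bar>)"
      by (rule integral_abs_bound)
    also have "\<dots> \<le> (LBINT y. \<bar>f y\<bar> * (C * (norm h)\<^sup>2))"
    proof (rule integral_mono)
      fix y
      have "f y * \<eta> (x + h - y) - f y * \<eta> (x - y) - (\<Sum>i\<in>UNIV. h $ i * (f y * partial i \<eta> (x - y)))
        = f y * (\<eta> ((x - y) + h) - \<eta> (x - y) - (\<Sum>i\<in>UNIV. h $ i * partial i \<eta> (x - y)))"
        by (simp add: right_diff_distrib sum_distrib_left mult.left_commute algebra_simps)
      then show "\<bar>f y * \<eta> (x + h - y) - f y * \<eta> (x - y) - (\<Sum>i\<in>UNIV. h $ i * (f y * partial i \<eta> (x - y)))\<bar>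
        \<le> \<bar>f y\<bar> * (C * (norm h)\<^sup>2)"
        using C[of "x - y" h] by (simp add: abs_mult mult_left_mono)
    qed (use f i in auto)
    also have "\<dots> = K * (norm h)\<^sup>2" by (simp add: K_def)
    finally show ?thesis using eq by simp
  qed
  have "bounded_linear (\<lambda>h::R3. \<Sum>i\<in>UNIV. h $ i * conv f (partial i \<eta>) x)"
    by (intro bounded_linear_sum bounded_linear_mult_const bounded_linear_vec_nth)
  moreover have "(\<lambda>h. norm (conv f \<eta> (x + h) - conv f \<eta> x - (\<Sum>i\<in>UNIV. h $ i * conv f (partial i \<eta>) x)) / norm h) \<midarrow>0\<rightarrow> 0"
  proof (rule Lim_null_comparison)
    show "((\<lambda>h. K * norm h) \<longlongrightarrow> 0) (at (0::R3))"
      by (auto intro!: tendsto_eq_intros)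
    show "\<forall>\<^sub>F h in at 0. norm (norm (conv f \<eta> (x + h) - conv f \<eta> x - (\<Sum>i\<in>UNIV. h $ i * conv f (partial i \<eta>) x)) / norm h) \<le> K * norm h"
    proof (rule eventually_at_topological[THEN iffD2], intro exI[of _ UNIV] conjI allI impI ballI)
      fix h :: R3 assume "h \<noteq> 0"
      then show "norm (norm (conv f \<eta> (x + h) - conv f \<eta> x - (\<Sum>i\<in>UNIV. h $ i * conv f (partial i \<eta>) x)) / norm h) \<le> K * norm h"
        using est[of h] by (simp add: divide_le_eq power2_eq_square mult.assoc)
    qed auto
  qed
  ultimately show ?thesis unfolding has_derivative_at by blast
qed

lemma conv_partial:
  assumes f: "integrable lborel f" and \<eta>: "test_fun \<eta>"
  shows "partial i (conv f \<eta>) = conv f (partial i \<eta>)"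
proof
  fix x
  show "partial i (conv f \<eta>) x = conv f (partial i \<eta>) x"
    using partial_eqI[OF conv_derivative[OF f \<eta>], of i x]
    by (simp add: axis_def if_distrib[where f="\<lambda>a. a * _"] cong: if_cong)
qed

lemma conv_smooth:
  assumes f: "integrable lborel f" and \<eta>: "test_fun \<eta>"
  shows "smooth_fun (conv f \<eta>)"
proof (rule smooth_fun_coinduct[of _ "{conv f \<eta> | \<eta>. test_fun \<eta>}"])
  show "conv f \<eta> \<in> {conv f \<eta> | \<eta>. test_fun \<eta>}" using \<eta> by blast
  show "g differentiable (at x)" if "g \<in> {conv f \<eta> | \<eta>. test_fun \<eta>}" for g x
    using that conv_derivative[OF f] unfolding differentiable_def by blast
  show "partial i g \<in> {conv f \<eta> | \<eta>. test_fun \<eta>}" if "g \<in> {conv f \<eta> | \<eta>. test_fun \<eta>}" for g i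
    using that conv_partial[OF f] test_fun_partial by blast
qed

lemma conv_test_fun:
  assumes f: "integrable lborel f" and \<eta>: "test_fun \<eta>" and r: "\<And>x. norm x > r \<Longrightarrow> f x = 0"
  shows "test_fun (conv f \<eta>)"
proof -
  obtain s where s: "\<And>x. norm x > s \<Longrightarrow> \<eta> x = 0" using test_fun_support[OF \<eta>] by blast
  have "conv f \<eta> x = 0" if x: "norm x > r + s" for x
  proof -
    have "f y * \<eta> (x - y) = 0" for y
    proof (cases "norm y > r")
      case False
      then have "norm (x - y) > s" using x norm_triangle_ineq2[of x y] by linarith
      then show ?thesis using s by simp
    qed (use r in simp)
    then show ?thesis unfolding conv_def by (simp only: integral_zero)
  qed
  then show ?thesis unfolding test_fun_iff using conv_smooth[OF f \<eta>] by blast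
qed

lemma conv_reflect:
  assumes [measurable]: "f \<in> borel_measurable borel" "\<eta> \<in> borel_measurable borel"
  shows "conv f \<eta> x = (LBINT z. f (x - z) * \<eta> z)"
  unfolding conv_def using integral_lborel_reflect[of "\<lambda>y. f y * \<eta> (x - y)" x] by simp

locale mollifier =
  fixes \<eta> :: "R3 \<Rightarrow> real"
  assumes test: "test_fun \<eta>" and nonneg: "\<And>x. \<eta> x \<ge> 0" and mass: "(LBINT x. \<eta> x) = 1"
begin

lemma measurable_eta [measurable]: "\<eta> \<in> borel_measurable borel"
  by (rule test_fun_measurable[OF test])

text \<open>Jensen's inequality for the probability density y |-> \<eta> (x - y), obtained by
  expanding the nonnegative variance around the mean \<open>conv f \<eta> x\<close>.\<close>

lemma conv_square_le:
  assumes f: "integrable lborel f" "integrable lborel (\<lambda>x. (f x)\<^sup>2)"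
  shows "(conv f \<eta> x)\<^sup>2 \<le> conv (\<lambda>x. (f x)\<^sup>2) \<eta> x"
proof -
  let ?c = "conv f \<eta> x"
  have i: "integrable lborel (\<lambda>y. (f y)\<^sup>2 * \<eta> (x - y))" "integrable lborel (\<lambda>y. f y * \<eta> (x - y))"
    "integrable lborel (\<lambda>y. \<eta> (x - y))"
    using f test by (auto intro: conv_integrable simp: integrable_lborel_reflect test_fun_integrable)
  have "0 \<le> (LBINT y. (f y - ?c)\<^sup>2 * \<eta> (x - y))"
    by (intro integral_nonneg_AE AE_I2 mult_nonneg_nonneg nonneg) simp
  also have "\<dots> = (LBINT y. (f y)\<^sup>2 * \<eta> (x - y) - 2 * ?c * (f y * \<eta> (x - y)) + ?c\<^sup>2 * \<eta> (x - y))"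
    by (intro Bochner_Integration.integral_cong) (auto simp: power2_eq_square algebra_simps)
  also have "\<dots> = (LBINT y. (f y)\<^sup>2 * \<eta> (x - y)) - 2 * ?c * (LBINT y. f y * \<eta> (x - y)) + ?c\<^sup>2 * (LBINT y. \<eta> (x - y))"
    using i by simp
  also have "(LBINT y. \<eta> (x - y)) = 1" using mass by (simp add: integral_lborel_reflect)
  also have "(LBINT y. f y * \<eta> (x - y)) = ?c" by (simp add: conv_def)
  finally show ?thesis by (simp add: conv_def power2_eq_square)
qed

lemma nn_integral_eta: "(\<integral>\<^sup>+x. ennreal (\<eta> x) \<partial>lborel) = 1"
  using nn_integral_eq_integral[OF test_fun_integrable[OF test]] nonneg mass by simp

lemma nn_integral_conv:
  assumes g: "integrable lborel g" "\<And>x. g x \<ge> 0"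
  shows "(\<integral>\<^sup>+x. ennreal (conv g \<eta> x) \<partial>lborel) = (\<integral>\<^sup>+x. ennreal (g x) \<partial>lborel)"
proof -
  have [measurable]: "g \<in> borel_measurable borel" using g borel_measurable_integrable by auto
  have "(\<integral>\<^sup>+x. ennreal (conv g \<eta> x) \<partial>lborel) = (\<integral>\<^sup>+x. (\<integral>\<^sup>+y. ennreal (g y * \<eta> (x - y)) \<partial>lborel) \<partial>lborel)"
    unfolding conv_def using conv_integrable[OF g(1) test] g(2) nonneg
    by (intro nn_integral_cong) (simp add: nn_integral_eq_integral)
  also have "\<dots> = (\<integral>\<^sup>+y. (\<integral>\<^sup>+x. ennreal (g y * \<eta> (x - y)) \<partial>lborel) \<partial>lborel)"
    by (rule lborel_pair.Fubini') measurable
  also have "\<dots> = (\<integral>\<^sup>+y. ennreal (g y) * (\<integral>\<^sup>+x. ennreal (\<eta> (x + (- y))) \<partial>lborel) \<partial>lborel)"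
    using g nonneg by (simp add: ennreal_mult nn_integral_cmult)
  also have "\<dots> = (\<integral>\<^sup>+y. ennreal (g y) \<partial>lborel)"
    by (subst nn_integral_lborel_translate) (simp_all add: nn_integral_eta)
  finally show ?thesis .
qed

lemma conv_measurable [measurable]: "integrable lborel f \<Longrightarrow> conv f \<eta> \<in> borel_measurable borel"
  using conv_derivative[OF _ test] by (intro differentiable_borel_measurable) (auto simp: differentiable_def)

text \<open>Pointwise Jensen, then Tonelli with the mass 1 of \<eta>. The constant 1 matters: it
  keeps the Dirichlet integrals of the approximants below those of the truncated function, so sharp
  constants survive the limit.\<close>

lemma conv_L2:
  assumes f: "integrable lborel f" "integrable lborel (\<lambda>x. (f x)\<^sup>2)"
  shows "integrable lborel (\<lambda>x. (conv f \<eta> x)\<^sup>2)"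
    and "(LBINT x. (conv f \<eta> x)\<^sup>2) \<le> (LBINT x. (f x)\<^sup>2)"
proof -
  have "(\<integral>\<^sup>+x. ennreal ((conv f \<eta> x)\<^sup>2) \<partial>lborel) \<le> (\<integral>\<^sup>+x. ennreal (conv (\<lambda>x. (f x)\<^sup>2) \<eta> x) \<partial>lborel)"
    by (intro nn_integral_mono ennreal_leI conv_square_le f)
  also have "\<dots> = (\<integral>\<^sup>+x. ennreal ((f x)\<^sup>2) \<partial>lborel)" by (rule nn_integral_conv[OF f(2)]) simp
  also have "\<dots> = ennreal (LBINT x. (f x)\<^sup>2)" by (rule nn_integral_eq_integral[OF f(2)]) simp
  finally have *: "(\<integral>\<^sup>+x. ennreal ((conv f \<eta> x)\<^sup>2) \<partial>lborel) \<le> ennreal (LBINT x. (f x)\<^sup>2)" .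
  show i: "integrable lborel (\<lambda>x. (conv f \<eta> x)\<^sup>2)"
    by (rule integrableI_bounded) (use * f in \<open>auto intro: le_less_trans\<close>)
  show "(LBINT x. (conv f \<eta> x)\<^sup>2) \<le> (LBINT x. (f x)\<^sup>2)"
    using * nn_integral_eq_integral[OF i] by (simp add: ennreal_le_iff)
qed

text \<open>\<open>conv f \<eta>\<close> is an average of translates of f with weight \<eta>, so by
  Tonelli its L1 distance to f is at most the averaged distance of the translates. Only shifts in
  the support of \<eta> count.\<close>

lemma conv_L1_close:
  assumes f: "integrable lborel f"
    and close: "\<And>z. \<eta> z \<noteq> 0 \<Longrightarrow> (LBINT x. \<bar>f (x + (- z)) - f x\<bar>) \<le> e"
  shows "integrable lborel (\<lambda>x. conv f \<eta> x - f x)"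
    and "(LBINT x. \<bar>conv f \<eta> x - f x\<bar>) \<le> e"
proof -
  have fm [measurable]: "f \<in> borel_measurable borel" using f borel_measurable_integrable by auto
  have pt: "ennreal \<bar>conv f \<eta> x - f x\<bar> \<le> (\<integral>\<^sup>+z. ennreal (\<bar>f (x - z) - f x\<bar> * \<eta> z) \<partial>lborel)" for x
  proof -
    have i1: "integrable lborel (\<lambda>z. f (x - z) * \<eta> z)"
      using conv_integrable[OF f test, of x] integrable_lborel_reflect[of "\<lambda>y. f y * \<eta> (x - y)" x] by simp
    have i2: "integrable lborel (\<lambda>z. f x * \<eta> z)" using test_fun_integrable[OF test] by simp
    have "conv f \<eta> x - f x = (LBINT z. f (x - z) * \<eta> z) - (LBINT z. f x * \<eta> z)"
      using mass by (simp add: conv_reflect)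
    also have "\<dots> = (LBINT z. (f (x - z) - f x) * \<eta> z)"
      using i1 i2 by (simp add: left_diff_distrib)
    finally have "ennreal \<bar>conv f \<eta> x - f x\<bar> \<le> (\<integral>\<^sup>+z. ennreal \<bar>(f (x - z) - f x) * \<eta> z\<bar> \<partial>lborel)"
      using integral_norm_bound_ennreal[of lborel "\<lambda>z. (f (x - z) - f x) * \<eta> z"] i1 i2
      by (simp add: left_diff_distrib)
    then show ?thesis by (simp add: abs_mult nonneg)
  qed
  have "(\<integral>\<^sup>+x. ennreal \<bar>conv f \<eta> x - f x\<bar> \<partial>lborel) \<le> (\<integral>\<^sup>+x. (\<integral>\<^sup>+z. ennreal (\<bar>f (x - z) - f x\<bar> * \<eta> z) \<partial>lborel) \<partial>lborel)"
    by (intro nn_integral_mono pt)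
  also have "\<dots> = (\<integral>\<^sup>+z. (\<integral>\<^sup>+x. ennreal (\<bar>f (x - z) - f x\<bar> * \<eta> z) \<partial>lborel) \<partial>lborel)"
    by (rule lborel_pair.Fubini') measurable
  also have "\<dots> \<le> (\<integral>\<^sup>+z. ennreal e * ennreal (\<eta> z) \<partial>lborel)"
  proof (rule nn_integral_mono)
    fix z
    have i: "integrable lborel (\<lambda>x. \<bar>f (x - z) - f x\<bar>)"
      using f integrable_lborel_translate[OF fm, of "- z"] by simp
    have "(\<integral>\<^sup>+x. ennreal (\<bar>f (x - z) - f x\<bar> * \<eta> z) \<partial>lborel) = ennreal (LBINT x. \<bar>f (x - z) - f x\<bar>) * ennreal (\<eta> z)"
      using nonneg nn_integral_eq_integral[OF i] by (simp add: ennreal_mult nn_integral_multc)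
    also have "\<dots> \<le> ennreal e * ennreal (\<eta> z)"
      using close[of z] by (cases "\<eta> z = 0") (auto intro!: mult_right_mono ennreal_leI)
    finally show "(\<integral>\<^sup>+x. ennreal (\<bar>f (x - z) - f x\<bar> * \<eta> z) \<partial>lborel) \<le> ennreal e * ennreal (\<eta> z)" .
  qed
  also have "\<dots> = ennreal e" by (simp add: nn_integral_cmult nn_integral_eta)
  finally have *: "(\<integral>\<^sup>+x. ennreal \<bar>conv f \<eta> x - f x\<bar> \<partial>lborel) \<le> ennreal e" .
  show i: "integrable lborel (\<lambda>x. conv f \<eta> x - f x)"
    by (rule integrableI_bounded) (use * f in \<open>auto intro: le_less_trans\<close>)
  \<comment> \<open>The sign of e comes from \<open>close\<close> itself: total mass 1 provides a
    point where \<eta> is nonzero, and there e bounds an integral of an absolute value.\<close>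
  have "\<exists>z. \<eta> z \<noteq> 0" using mass by (metis Bochner_Integration.integral_cong integral_zero zero_neq_one)
  then obtain z where "\<eta> z \<noteq> 0" by blast
  then have "(LBINT x. \<bar>f (x + (- z)) - f x\<bar>) \<le> e" by (rule close)
  moreover have "0 \<le> (LBINT x. \<bar>f (x + (- z)) - f x\<bar>)" by (intro integral_nonneg_AE AE_I2) simp
  ultimately have "0 \<le> e" by linarith
  then show "(LBINT x. \<bar>conv f \<eta> x - f x\<bar>) \<le> e"
    using * nn_integral_eq_integral[OF integrable_abs[OF i]] by (simp add: ennreal_le_iff)
qed

end

lemma mollifier_exists:
  assumes "\<delta> > 0"
  obtains \<eta> where "mollifier \<eta>" "\<And>z. \<eta> z \<noteq> 0 \<Longrightarrow> norm z < \<delta>"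
proof -
  \<comment> \<open>\<open>bump R\<close> lives in the ball of radius 3R, so R = \<delta> / 4 keeps
    the support strictly inside radius \<delta>.\<close>
  define R where "R = \<delta> / 4"
  have R: "R > 0" using assms by (simp add: R_def)
  define m where "m = (LBINT x. bump R x)"
  have m: "m > 0"
  proof (rule ccontr)
    assume "\<not> m > 0"
    moreover have "m \<ge> 0" unfolding m_def by (intro integral_nonneg_AE AE_I2 bump_nonneg)
    ultimately have "m = 0" by simp
    then have "AE x in lborel. bump R x = 0"
      using integral_nonneg_eq_0_iff_AE[OF test_fun_integrable[OF test_fun_bump]] bump_nonneg
      by (auto simp: m_def)
    then have "AE x in lborel. x \<notin> ball (0::R3) R"
      by eventually_elim (use bump_pos in \<open>force simp: dist_norm\<close>)
    then have "ball (0::R3) R \<in> null_sets lborel" by (simp add: AE_iff_null_sets)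
    then have "emeasure lborel (ball (0::R3) R) = 0" by auto
    then show False using R open_not_negligible[of "ball (0::R3) R"]
      by (auto simp: negligible_iff_null_sets null_sets_def)
  qed
  show ?thesis
  proof (rule that[of "\<lambda>x. (1 / m) * bump R x"])
    show "mollifier (\<lambda>x. (1 / m) * bump R x)"
    proof
      show "test_fun (\<lambda>x. 1 / m * bump R x)"
        by (intro test_fun_smooth_mult smooth_fun_const test_fun_bump)
      show "(LBINT x. 1 / m * bump R x) = 1"
        using m by (simp add: m_def[symmetric])
    qed (use m bump_nonneg in auto)
    show "norm z < \<delta>" if "1 / m * bump R z \<noteq> 0" for z
      using that bump_support[of R z] assms by (fastforce simp: R_def not_less)
  qed
qed

lemma mollify_L1:
  assumes "integrable lborel f" "e > 0"
  obtains \<eta> where "mollifier \<eta>" "integrable lborel (\<lambda>x. conv f \<eta> x - f x)"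
    "(LBINT x. \<bar>conv f \<eta> x - f x\<bar>) \<le> e"
proof -
  obtain d where d: "d > 0" "\<And>z. norm z < d \<Longrightarrow> (LBINT x. \<bar>f (x + z) - f x\<bar>) < e"
    using translation_continuous_L1[OF assms] by blast
  obtain \<eta> where \<eta>: "mollifier \<eta>" "\<And>z. \<eta> z \<noteq> 0 \<Longrightarrow> norm z < d"
    using mollifier_exists[OF d(1)] by blast
  have "(LBINT x. \<bar>f (x + (- z)) - f x\<bar>) \<le> e" if "\<eta> z \<noteq> 0" for z
    using d(2)[of "- z"] \<eta>(2)[OF that] by simp
  then show ?thesis using mollifier.conv_L1_close[OF \<eta>(1) assms(1)] that[OF \<eta>(1)] by blast
qed

section \<open>Weak gradients and smooth approximation\<close>

lemma test_fun_abs_bounded_indicator: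
  assumes "test_fun \<phi>"
  obtains M r where "M \<ge> 0" "\<And>x. \<bar>\<phi> x\<bar> \<le> M * indicator (cball 0 r) x"
proof -
  obtain M where M: "M \<ge> 0" "\<And>x. \<bar>\<phi> x\<bar> \<le> M" using test_fun_bounded[OF assms] by blast
  obtain r where r: "\<And>x. norm x > r \<Longrightarrow> \<phi> x = 0" using test_fun_support[OF assms] by blast
  have "\<bar>\<phi> x\<bar> \<le> M * indicator (cball 0 r) x" for x
    using M(2)[of x] r[of x] by (cases "norm x > r") (auto simp: indicator_def)
  then show ?thesis using that[OF M(1)] by blast
qed

lemma L2_test_integrable:
  assumes [measurable]: "u \<in> borel_measurable borel" and u: "integrable lborel (\<lambda>x. (u x)\<^sup>2)" and \<phi>: "test_fun \<phi>"
  shows "integrable lborel (\<lambda>x. u x * \<phi> x)"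
proof (rule Bochner_Integration.integrable_bound)
  have [measurable]: "\<phi> \<in> borel_measurable borel" by (rule test_fun_measurable[OF \<phi>])
  obtain M where M: "\<And>x. \<bar>\<phi> x\<bar> \<le> M" using test_fun_bounded[OF \<phi>] by blast
  have "integrable lborel (\<lambda>x. \<phi> x * \<phi> x)"
    by (rule integrable_mult_bounded[OF test_fun_integrable[OF \<phi>]]) (use M in auto)
  then show "integrable lborel (\<lambda>x. (u x)\<^sup>2 + \<phi> x * \<phi> x)" using u by simp
  show "(\<lambda>x. u x * \<phi> x) \<in> borel_measurable lborel" by measurable
  show "AE x in lborel. norm (u x * \<phi> x) \<le> norm ((u x)\<^sup>2 + \<phi> x * \<phi> x)"
  proof (rule AE_I2)
    fix x
    have "0 \<le> (\<bar>u x\<bar> - \<bar>\<phi> x\<bar>)\<^sup>2" "0 \<le> \<bar>u x\<bar> * \<bar>\<phi> x\<bar>" by auto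
    then have "\<bar>u x\<bar> * \<bar>\<phi> x\<bar> \<le> \<bar>u x\<bar>\<^sup>2 + \<bar>\<phi> x\<bar>\<^sup>2" unfolding power2_diff by linarith
    then show "norm (u x * \<phi> x) \<le> norm ((u x)\<^sup>2 + \<phi> x * \<phi> x)"
      by (simp add: abs_mult power2_eq_square)
  qed
qed

text \<open>The fundamental lemma of the calculus of variations. Truncation by \<open>bump n\<close>
  makes h integrable; the mollifications of the truncated function vanish identically and are
  arbitrarily close to it in L1.\<close>

lemma AE_zero_if_test_integrals_zero:
  assumes [measurable]: "h \<in> borel_measurable borel"
    and i: "\<And>\<phi>. test_fun \<phi> \<Longrightarrow> integrable lborel (\<lambda>x. h x * \<phi> x)"
    and z: "\<And>\<phi>. test_fun \<phi> \<Longrightarrow> (LBINT x. h x * \<phi> x) = 0"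
  shows "AE x in lborel. h x = 0"
proof -
  have "AE x in lborel. h x * bump (real n) x = 0" for n
  proof -
    define f where "f = (\<lambda>x. h x * bump (real n) x)"
    have f: "integrable lborel f" unfolding f_def by (intro i test_fun_bump)
    have "(LBINT x. \<bar>f x\<bar>) \<le> e" if e: "e > 0" for e
    proof -
      obtain \<eta> where \<eta>: "mollifier \<eta>" "(LBINT x. \<bar>conv f \<eta> x - f x\<bar>) \<le> e"
        by (rule mollify_L1[OF f e])
      have "conv f \<eta> x = 0" for x
      proof -
        \<comment> \<open>The value \<open>conv f \<eta> x\<close> is the integral of h against this
          test function.\<close>
        have "test_fun (\<lambda>y. bump (real n) y * \<eta> (x - y))"
          using test_fun_smooth_mult[of "bump (real n)" "\<lambda>y. \<eta> (x - y)"] test_fun_bump[of "real n"]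
            test_fun_reflect[OF mollifier.test[OF \<eta>(1)]] by (simp add: test_fun_def)
        from z[OF this] show ?thesis by (simp add: conv_def f_def mult.assoc)
      qed
      with \<eta>(2) show ?thesis by simp
    qed
    then have "(LBINT x. \<bar>f x\<bar>) \<le> 0" by (rule field_le_epsilon[of _ 0, simplified])
    moreover have "(LBINT x. \<bar>f x\<bar>) \<ge> 0" by (intro integral_nonneg_AE) simp
    ultimately have "AE x in lborel. \<bar>f x\<bar> = 0"
      using integral_nonneg_eq_0_iff_AE[OF integrable_abs[OF f]] by auto
    then show ?thesis by (simp add: f_def)
  qed
  then have "AE x in lborel. \<forall>n. h x * bump (real n) x = 0" unfolding AE_all_countable ..
  then show ?thesis
  proof eventually_elim
    fix x assume *: "\<forall>n. h x * bump (real n) x = 0"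
    obtain n :: nat where "norm x < real n" using reals_Archimedean2 by blast
    then show "h x = 0" using * bump_pos[of x "real n"] by (metis mult_eq_0_iff less_irrefl)
  qed
qed

lemma lebesgue_test_integrable:
  assumes "loc_integrable f" "test_fun \<phi>"
  shows "integrable lebesgue (\<lambda>x. f x * \<phi> x)"
proof -
  obtain M r where M: "M \<ge> 0" "\<And>x. \<bar>\<phi> x\<bar> \<le> M * indicator (cball 0 r) x"
    by (rule test_fun_abs_bounded_indicator[OF assms(2)]) blast
  have i: "integrable lebesgue (\<lambda>x. indicator (cball 0 r) x * f x)"
    using assms(1) unfolding loc_integrable_def set_integrable_def by simp
  have bM: "\<bar>\<phi> x\<bar> \<le> M" for x
    using M(1) M(2)[of x] by (cases "norm x \<le> r") (auto simp: indicator_def)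
  have "integrable lebesgue (\<lambda>x. (indicator (cball 0 r) x * f x) * \<phi> x)"
    by (rule integrable_mult_bounded[OF i, of _ M])
       (use test_fun_measurable[OF assms(2)] bM in \<open>auto intro: measurable_completion\<close>)
  moreover have "(indicator (cball 0 r) x * f x) * \<phi> x = f x * \<phi> x" for x
    using M(2)[of x] by (cases "norm x \<le> r") (auto simp: indicator_def)
  ultimately show ?thesis by simp
qed

text \<open>\<open>weak_solution\<close> and \<open>H1\<close> each provide a weak gradient of their
  own, and square integrability is known only for the one from \<open>H1\<close>. Uniqueness lets
  the equation be read with that one.\<close>

lemma weak_gradient_unique:
  assumes "weak_gradient u Du" "weak_gradient u Du'"
  shows "AE x in lebesgue. Du x = Du' x"
proof -
  have "AE x in lebesgue. Du x $ i = Du' x $ i" for i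
  proof -
    define h where "h = (\<lambda>x. Du x $ i - Du' x $ i)"
    have im: "integrable lebesgue (\<lambda>x. Du x $ i * \<phi> x)" "integrable lebesgue (\<lambda>x. Du' x $ i * \<phi> x)" if "test_fun \<phi>" for \<phi>
      using lebesgue_test_integrable[OF _ that] assms unfolding weak_gradient_def by auto
    have hi: "integrable lebesgue (\<lambda>x. h x * \<phi> x)" if "test_fun \<phi>" for \<phi>
      using im[OF that] by (simp add: h_def left_diff_distrib)
    have hz: "(\<integral>x. h x * \<phi> x \<partial>lebesgue) = 0" if "test_fun \<phi>" for \<phi>
    proof -
      have "(\<integral>x. h x * \<phi> x \<partial>lebesgue) = (\<integral>x. Du x $ i * \<phi> x \<partial>lebesgue) - (\<integral>x. Du' x $ i * \<phi> x \<partial>lebesgue)"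
        using im[OF that] by (simp add: h_def left_diff_distrib)
      also have "\<dots> = - (\<integral>x. u x * partial i \<phi> x \<partial>lebesgue) + (\<integral>x. u x * partial i \<phi> x \<partial>lebesgue)"
        using assms that unfolding weak_gradient_def by simp
      finally show ?thesis by simp
    qed
    have "h \<in> borel_measurable lebesgue"
    proof -
      have "(\<lambda>x. Du x $ i) \<in> borel_measurable lebesgue" "(\<lambda>x. Du' x $ i) \<in> borel_measurable lebesgue"
        using assms unfolding weak_gradient_def
        by (auto intro!: measurable_compose[OF _ borel_measurable_continuous_onI[of "\<lambda>x. x $ i"]] continuous_intros)
      then show ?thesis unfolding h_def by simp
    qed
    then obtain h' where h': "h' \<in> borel_measurable lborel" and eq: "AE x in lborel. h x = h' x"
      using completion_ex_borel_measurable_real[of h lborel] by (auto simp: eq_commute)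
    have h'm [measurable]: "h' \<in> borel_measurable borel" using h' by simp
    have eqc: "AE x in lebesgue. h x = h' x" using eq by (rule AE_completion)
    have "AE x in lborel. h' x = 0"
    proof (rule AE_zero_if_test_integrals_zero)
      fix \<phi> assume \<phi>: "test_fun \<phi>"
      have pm [measurable]: "\<phi> \<in> borel_measurable borel" by (rule test_fun_measurable[OF \<phi>])
      have hm': "(\<lambda>x. h' x * \<phi> x) \<in> borel_measurable lebesgue"
        by (rule measurable_completion) simp
      have ae: "AE x in lebesgue. h x * \<phi> x = h' x * \<phi> x" using eqc by eventually_elim simp
      have "integrable lebesgue (\<lambda>x. h' x * \<phi> x)"
        using hi[OF \<phi>] integrable_cong_AE_imp[OF _ hm' ae] by blast
      then show "integrable lborel (\<lambda>x. h' x * \<phi> x)" by (simp add: integrable_completion)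
      have "(\<integral>x. h' x * \<phi> x \<partial>lebesgue) = 0"
        using integral_cong_AE[OF borel_measurable_integrable[OF hi[OF \<phi>]] hm' ae] hz[OF \<phi>] by simp
      then show "(LBINT x. h' x * \<phi> x) = 0" by (simp add: integral_completion)
    qed simp
    then have "AE x in lebesgue. h' x = 0" by (rule AE_completion)
    with eqc show ?thesis by eventually_elim (simp add: h_def)
  qed
  then have "AE x in lebesgue. \<forall>i. Du x $ i = Du' x $ i" by (simp add: AE_all_countable)
  then show ?thesis by eventually_elim (simp add: vec_eq_iff)
qed

text \<open>An H^1 function with Borel representatives of the function and of each component of its
  weak gradient, so that \<open>lborel\<close> and its products, and with them Tonelli and Fubini,
  apply directly.\<close>

locale sobolev_borel =
  fixes u :: "R3 \<Rightarrow> real" and g :: "3 \<Rightarrow> R3 \<Rightarrow> real"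
  assumes um [measurable]: "u \<in> borel_measurable borel"
    and gm [measurable]: "\<And>i. g i \<in> borel_measurable borel"
    and u2: "integrable lborel (\<lambda>x. (u x)\<^sup>2)"
    and g2: "\<And>i. integrable lborel (\<lambda>x. (g i x)\<^sup>2)"
    and weak: "\<And>\<phi> i. test_fun \<phi> \<Longrightarrow> (LBINT x. u x * partial i \<phi> x) = - (LBINT x. g i x * \<phi> x)"
begin

definition cut :: "nat \<Rightarrow> R3 \<Rightarrow> real" where "cut n x = u x * bump (real n) x"

text \<open>The Leibniz rule for \<open>cut n\<close>; \<open>cut_weak\<close> proves that it is the
  weak gradient.\<close>

definition gcut :: "nat \<Rightarrow> 3 \<Rightarrow> R3 \<Rightarrow> real" where
  "gcut n i x = g i x * bump (real n) x + u x * partial i (bump (real n)) x"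

lemma bump_measurable [measurable]: "bump R \<in> borel_measurable borel" "partial i (bump R) \<in> borel_measurable borel"
  by (intro test_fun_measurable test_fun_partial test_fun_bump)+

lemma cut_integrable: "integrable lborel (cut n)"
  unfolding cut_def by (intro L2_test_integrable u2 um test_fun_bump)

lemma gcut_integrable: "integrable lborel (gcut n i)"
  unfolding gcut_def
  by (intro Bochner_Integration.integrable_add L2_test_integrable u2 g2 um gm test_fun_bump test_fun_partial)

lemma cut_square_le: "(cut n x)\<^sup>2 \<le> (u x)\<^sup>2"
proof -
  have "\<bar>cut n x\<bar> \<le> \<bar>u x\<bar>"
    unfolding cut_def using bump_nonneg[of "real n" x] bump_le_1[of "real n" x]
    by (simp add: abs_mult mult_left_le)
  then show ?thesis by (simp add: abs_le_square_iff)
qed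

lemma cut_L2: "integrable lborel (\<lambda>x. (cut n x)\<^sup>2)"
  by (rule Bochner_Integration.integrable_bound[OF u2]) (use cut_square_le in \<open>auto simp: cut_def\<close>)

text \<open>From (a + b)^2 \<le> 2 a^2 + 2 b^2 and the bound 4 on the cut-off derivative, so 32 = 2
  * 4^2. The right side does not depend on n and dominates the sequence.\<close>

lemma gcut_square_le: "(gcut n i x)\<^sup>2 \<le> 2 * (g i x)\<^sup>2 + 32 * (u x)\<^sup>2"
proof -
  have a: "(g i x * bump (real n) x)\<^sup>2 \<le> (g i x)\<^sup>2"
    using bump_nonneg[of "real n" x] bump_le_1[of "real n" x]
    by (simp add: power_mult_distrib mult_left_le power_le_one)
  have "(partial i (bump (real n)) x)\<^sup>2 \<le> 4\<^sup>2"
    using partial_bump_bounded[of i "real n" x] by (subst abs_le_square_iff[symmetric]) simp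
  then have b: "(u x * partial i (bump (real n)) x)\<^sup>2 \<le> (u x)\<^sup>2 * 16"
    by (simp add: power_mult_distrib mult_left_mono)
  have "(a + b)\<^sup>2 \<le> 2 * a\<^sup>2 + 2 * b\<^sup>2" for a b :: real
    using zero_le_power2[of "a - b"] unfolding power2_diff power2_sum by linarith
  from this[of "g i x * bump (real n) x" "u x * partial i (bump (real n)) x"] a b
  show ?thesis unfolding gcut_def by linarith
qed

lemma gcut_L2: "integrable lborel (\<lambda>x. (gcut n i x)\<^sup>2)"
proof (rule Bochner_Integration.integrable_bound)
  show "integrable lborel (\<lambda>x. 2 * (g i x)\<^sup>2 + 32 * (u x)\<^sup>2)" using u2 g2 by simp
  show "(\<lambda>x. (gcut n i x)\<^sup>2) \<in> borel_measurable lborel" unfolding gcut_def by measurable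
  show "AE x in lborel. norm ((gcut n i x)\<^sup>2) \<le> norm (2 * (g i x)\<^sup>2 + 32 * (u x)\<^sup>2)"
  proof (rule AE_I2)
    fix x show "norm ((gcut n i x)\<^sup>2) \<le> norm (2 * (g i x)\<^sup>2 + 32 * (u x)\<^sup>2)"
      using gcut_square_le[of n i x] by simp
  qed
qed

lemma gcut_integral_tendsto: "(\<lambda>n. LBINT x. (gcut n i x)\<^sup>2) \<longlonglongrightarrow> (LBINT x. (g i x)\<^sup>2)"
proof (rule integral_dominated_convergence)
  show "integrable lborel (\<lambda>x. 2 * (g i x)\<^sup>2 + 32 * (u x)\<^sup>2)" using u2 g2 by simp
  show "(\<lambda>x. (gcut n i x)\<^sup>2) \<in> borel_measurable lborel" for n unfolding gcut_def by measurable
  show "(\<lambda>x. (g i x)\<^sup>2) \<in> borel_measurable lborel" by measurable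
  show "AE x in lborel. norm ((gcut n i x)\<^sup>2) \<le> 2 * (g i x)\<^sup>2 + 32 * (u x)\<^sup>2" for n
    using gcut_square_le[of n i] by simp
  show "AE x in lborel. (\<lambda>n. (gcut n i x)\<^sup>2) \<longlonglongrightarrow> (g i x)\<^sup>2"
  proof (rule AE_I2)
    fix x
    have "(\<lambda>n. (gcut n i x)\<^sup>2) \<longlonglongrightarrow> (g i x * 1 + u x * 0)\<^sup>2"
      unfolding gcut_def by (intro tendsto_intros bump_tendsto_1 partial_bump_tendsto_0)
    then show "(\<lambda>n. (gcut n i x)\<^sup>2) \<longlonglongrightarrow> (g i x)\<^sup>2" by simp
  qed
qed

text \<open>The weak derivative of u is tested against the product of \<open>bump n\<close> and
  \<phi>, whose partial splits into the two terms to be sorted.\<close>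

lemma cut_weak:
  assumes \<phi>: "test_fun \<phi>"
  shows "(LBINT x. cut n x * partial i \<phi> x) = - (LBINT x. gcut n i x * \<phi> x)"
proof -
  let ?b = "bump (real n)"
  have b: "test_fun ?b" by (rule test_fun_bump)
  have sb: "smooth_fun ?b" and s\<phi>: "smooth_fun \<phi>" using b \<phi> unfolding test_fun_def by auto
  have p: "partial i (\<lambda>x. ?b x * \<phi> x) x = partial i ?b x * \<phi> x + ?b x * partial i \<phi> x" for x
    by (intro partial_mult test_fun_differentiable b \<phi>)
  have t1: "test_fun (\<lambda>x. ?b x * \<phi> x)" by (rule test_fun_smooth_mult[OF sb \<phi>])
  have t2: "test_fun (\<lambda>x. partial i ?b x * \<phi> x)" by (rule test_fun_smooth_mult[OF smooth_fun_partial[OF sb] \<phi>])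
  have t3: "test_fun (\<lambda>x. ?b x * partial i \<phi> x)" by (rule test_fun_smooth_mult[OF sb test_fun_partial[OF \<phi>]])
  have i: "integrable lborel (\<lambda>x. u x * (partial i ?b x * \<phi> x))" "integrable lborel (\<lambda>x. u x * (?b x * partial i \<phi> x))"
    "integrable lborel (\<lambda>x. g i x * (?b x * \<phi> x))"
    by (intro L2_test_integrable um u2 gm g2 t1 t2 t3)+
  have "(LBINT x. u x * (partial i ?b x * \<phi> x)) + (LBINT x. u x * (?b x * partial i \<phi> x))
      = - (LBINT x. g i x * (?b x * \<phi> x))"
    using weak[OF t1, of i] i(1,2) by (simp add: p distrib_left)
  moreover have "(LBINT x. gcut n i x * \<phi> x)
      = (LBINT x. g i x * (?b x * \<phi> x)) + (LBINT x. u x * (partial i ?b x * \<phi> x))"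
    using i(1,3) by (simp add: gcut_def distrib_right mult.assoc)
  ultimately show ?thesis by (simp add: cut_def mult.assoc)
qed

text \<open>Differentiation hits the kernel; testing the weak gradient of \<open>cut n\<close>
  against y |-> \<eta> (x - y) moves it onto the function, the sign of the reflection cancelling the
  sign of integration by parts.\<close>

lemma cut_conv_partial:
  assumes \<eta>: "test_fun \<eta>"
  shows "partial i (conv (cut n) \<eta>) x = conv (gcut n i) \<eta> x"
proof -
  have p: "partial i (\<lambda>y. \<eta> (x - y)) y = - partial i \<eta> (x - y)" for y
    by (rule partial_reflect(1)) (rule test_fun_differentiable[OF \<eta>])
  have "(LBINT y. cut n y * - partial i \<eta> (x - y)) = - (LBINT y. gcut n i y * \<eta> (x - y))"
    using cut_weak[OF test_fun_reflect[OF \<eta>], of n i x] by (simp add: p)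
  then show ?thesis
    by (simp add: conv_partial[OF cut_integrable \<eta>]) (simp add: conv_def)
qed

text \<open>Since u is only square integrable, it is truncated before being mollified with L1 error
  at most 1 / (n + 1). The Dirichlet integrals are merely bounded above by a convergent sequence:
  with a.e. convergence this is what Fatou's lemma needs in the applications.\<close>

theorem smooth_approximation:
  obtains w a where "\<And>n. test_fun (w n)" "AE x in lborel. (\<lambda>n. w n x) \<longlonglongrightarrow> u x"
    "\<And>n. (LBINT x. (w n x)\<^sup>2) \<le> (LBINT x. (u x)\<^sup>2)"
    "\<And>n. (\<Sum>i\<in>UNIV. LBINT x. (partial i (w n) x)\<^sup>2) \<le> a n"
    "a \<longlonglongrightarrow> (\<Sum>i\<in>UNIV. LBINT x. (g i x)\<^sup>2)"
proof -
  have "\<exists>\<eta>. mollifier \<eta> \<and> integrable lborel (\<lambda>x. conv (cut n) \<eta> x - cut n x) \<and>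
      (LBINT x. \<bar>conv (cut n) \<eta> x - cut n x\<bar>) \<le> 1 / real (Suc n)" for n
    by (rule mollify_L1[OF cut_integrable, of "1 / real (Suc n)" n]) auto
  then obtain \<eta> where \<eta>: "\<And>n. mollifier (\<eta> n)" "\<And>n. integrable lborel (\<lambda>x. conv (cut n) (\<eta> n) x - cut n x)"
    "\<And>n. (LBINT x. \<bar>conv (cut n) (\<eta> n) x - cut n x\<bar>) \<le> 1 / real (Suc n)"
    by metis
  define v where "v = (\<lambda>n. conv (cut n) (\<eta> n))"
  have "(\<lambda>n. LBINT x. norm (v n x - cut n x)) \<longlonglongrightarrow> 0"
    by (rule tendsto_sandwich[OF _ _ tendsto_const LIMSEQ_Suc[OF lim_1_over_n]])
       (use \<eta>(3) in \<open>auto simp: v_def simp del: of_nat_Suc\<close>)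
  \<comment> \<open>L1 convergence of the mollification error gives a.e. convergence along a
    subsequence.\<close>
  then obtain r :: "nat \<Rightarrow> nat" where r: "strict_mono r" "AE x in lborel. (\<lambda>n. v (r n) x - cut (r n) x) \<longlonglongrightarrow> 0"
    using tendsto_L1_AE_subseq[of lborel "\<lambda>n x. v n x - cut n x"] \<eta>(2) unfolding v_def by blast
  show ?thesis
  proof (rule that[of "\<lambda>n. v (r n)" "\<lambda>n. \<Sum>i\<in>UNIV. LBINT x. (gcut (r n) i x)\<^sup>2"])
    fix n
    have t: "test_fun (\<eta> m)" for m using \<eta>(1) mollifier.test by blast
    show "test_fun (v (r n))"
      unfolding v_def
      by (rule conv_test_fun[OF cut_integrable t, of "3 * real (r n)"]) (simp add: cut_def bump_support)
    have "(LBINT x. (v (r n) x)\<^sup>2) \<le> (LBINT x. (cut (r n) x)\<^sup>2)"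
      unfolding v_def by (rule mollifier.conv_L2(2)[OF \<eta>(1) cut_integrable cut_L2])
    also have "\<dots> \<le> (LBINT x. (u x)\<^sup>2)"
      by (rule integral_mono[OF cut_L2 u2]) (rule cut_square_le)
    finally show "(LBINT x. (v (r n) x)\<^sup>2) \<le> (LBINT x. (u x)\<^sup>2)" .
    show "(\<Sum>i\<in>UNIV. LBINT x. (partial i (v (r n)) x)\<^sup>2) \<le> (\<Sum>i\<in>UNIV. LBINT x. (gcut (r n) i x)\<^sup>2)"
      unfolding v_def cut_conv_partial[OF t]
      by (intro sum_mono mollifier.conv_L2(2)[OF \<eta>(1) gcut_integrable gcut_L2])
  next
    have "(\<lambda>n. \<Sum>i\<in>UNIV. LBINT x. (gcut n i x)\<^sup>2) \<longlonglongrightarrow> (\<Sum>i\<in>UNIV. LBINT x. (g i x)\<^sup>2)"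
      by (intro tendsto_sum gcut_integral_tendsto)
    from LIMSEQ_subseq_LIMSEQ[OF this r(1)]
    show "(\<lambda>n. \<Sum>i\<in>UNIV. LBINT x. (gcut (r n) i x)\<^sup>2) \<longlonglongrightarrow> (\<Sum>i\<in>UNIV. LBINT x. (g i x)\<^sup>2)"
      by (simp add: o_def)
  next
    show "AE x in lborel. (\<lambda>n. v (r n) x) \<longlonglongrightarrow> u x"
      using r(2)
    proof eventually_elim
      fix x assume *: "(\<lambda>n. v (r n) x - cut (r n) x) \<longlonglongrightarrow> 0"
      have "(\<lambda>n. cut n x) \<longlonglongrightarrow> u x * 1"
        unfolding cut_def by (intro tendsto_intros bump_tendsto_1)
      from tendsto_add[OF * LIMSEQ_subseq_LIMSEQ[OF this r(1), unfolded o_def]]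
      show "(\<lambda>n. v (r n) x) \<longlonglongrightarrow> u x" by simp
    qed
  qed
qed

end

section \<open>Radial integrals\<close>

lemma emeasure_cball_R3: "r \<ge> 0 \<Longrightarrow> emeasure lborel (cball (c::R3) r) = ennreal (4 / 3 * pi * r ^ 3)"
  by (simp add: emeasure_cball unit_ball_vol_3)

text \<open>Polar coordinates for radial functions: both measures give a half-line up to r the
  volume of the ball of radius r, and half-lines generate the Borel sets.\<close>

lemma distr_norm_R3:
  "distr lborel borel (norm :: R3 \<Rightarrow> real) = density lborel (\<lambda>r. ennreal (4 * pi * r\<^sup>2) * indicator {0..} r)"
proof (rule measure_eqI_generator_eq[where E = "range atMost" and \<Omega> = UNIV and A = "\<lambda>n. {..real n}"])
  show "Int_stable (range (atMost :: real \<Rightarrow> _))"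
    by (auto simp: Int_stable_def)
  have *: "emeasure (distr lborel borel (norm :: R3 \<Rightarrow> real)) {..r} = ennreal (4 / 3 * pi * (max r 0) ^ 3)" for r
  proof -
    have "emeasure (distr lborel borel (norm :: R3 \<Rightarrow> real)) {..r} = emeasure lborel (cball (0::R3) r)"
      by (subst emeasure_distr) (auto simp: vimage_def cball_def intro!: arg_cong[where f = "emeasure lborel"])
    then show ?thesis by (cases "r \<ge> 0") (auto simp: emeasure_cball_R3 max_def)
  qed
  show "emeasure (distr lborel borel (norm :: R3 \<Rightarrow> real)) X
      = emeasure (density lborel (\<lambda>r. ennreal (4 * pi * r\<^sup>2) * indicator {0..} r)) X"
    if XE: "X \<in> range atMost" for X
  proof -
    obtain r where X: "X = {..r}" using XE by auto
    have "emeasure (density lborel (\<lambda>r. ennreal (4 * pi * r\<^sup>2) * indicator {0..} r)) X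
        = (\<integral>\<^sup>+s. ennreal (4 * pi * s\<^sup>2) * indicator {0..max r 0} s \<partial>lborel)"
      unfolding X by (subst emeasure_density, simp, simp, intro nn_integral_cong_AE AE_I[where N = "{0}"])
         (auto simp: indicator_def max_def split: if_splits)
    also have "\<dots> = ennreal (4 / 3 * pi * (max r 0) ^ 3 - 4 / 3 * pi * 0 ^ 3)"
      by (rule nn_integral_FTC_Icc) (auto intro!: derivative_eq_intros simp: field_simps)
    finally show ?thesis unfolding X * by simp
  qed
  show "emeasure (distr lborel borel (norm :: R3 \<Rightarrow> real)) {..real n} \<noteq> \<infinity>" for n
    unfolding * by simp
  show "(\<Union>n. {..real n}) = UNIV" using real_arch_simple by auto
qed (auto simp: borel_eq_atMost)

lemma nn_integral_radial:
  assumes [measurable]: "F \<in> borel_measurable borel"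
  shows "(\<integral>\<^sup>+x. F (norm (x::R3)) \<partial>lborel) = (\<integral>\<^sup>+r. F r * (ennreal (4 * pi * r\<^sup>2) * indicator {0..} r) \<partial>lborel)"
proof -
  have "(\<integral>\<^sup>+x. F (norm (x::R3)) \<partial>lborel) = (\<integral>\<^sup>+r. F r \<partial>distr lborel borel (norm :: R3 \<Rightarrow> real))"
    by (subst nn_integral_distr) auto
  also have "\<dots> = (\<integral>\<^sup>+r. (ennreal (4 * pi * r\<^sup>2) * indicator {0..} r) * F r \<partial>lborel)"
    unfolding distr_norm_R3 by (subst nn_integral_density) auto
  finally show ?thesis by (simp add: mult.commute)
qed

lemma sqrt_1_plus_square_pos: "0 < sqrt (1 + r\<^sup>2)" "1 + r\<^sup>2 \<noteq> (0::real)"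
  by (auto simp: add_pos_nonneg add_nonneg_eq_0_iff)

text \<open>The integrand is minus the Laplacian of \<open>1 / sqrt (1 + (norm x)\<^sup>2)\<close>.\<close>

lemma nn_integral_plummer:
  "(\<integral>\<^sup>+x. ennreal (3 / sqrt (1 + (norm (x::R3))\<^sup>2) ^ 5) \<partial>lborel) = ennreal (4 * pi)"
proof -
  have "(\<integral>\<^sup>+x. ennreal (3 / sqrt (1 + (norm (x::R3))\<^sup>2) ^ 5) \<partial>lborel)
      = (\<integral>\<^sup>+r. ennreal (3 / sqrt (1 + r\<^sup>2) ^ 5) * (ennreal (4 * pi * r\<^sup>2) * indicator {0..} r) \<partial>lborel)"
    by (rule nn_integral_radial) measurable
  also have "\<dots> = (\<integral>\<^sup>+r. ennreal (12 * pi * r\<^sup>2 / sqrt (1 + r\<^sup>2) ^ 5) * indicator {0..} r \<partial>lborel)"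
    by (intro nn_integral_cong) (auto simp: indicator_def ennreal_mult[symmetric])
  also have "\<dots> = ennreal (4 * pi - 4 * pi * 0 ^ 3 / sqrt (1 + 0\<^sup>2) ^ 3)"
  proof (rule nn_integral_FTC_atLeast)
    \<comment> \<open>The antiderivative is the flux through the sphere of radius r of minus the
      gradient of 1 / sqrt (1 + r^2), namely 4 pi r^2 times r / sqrt (1 + r^2)^3.\<close>
    show "((\<lambda>r. 4 * pi * r ^ 3 / sqrt (1 + r\<^sup>2) ^ 3) has_real_derivative 12 * pi * r\<^sup>2 / sqrt (1 + r\<^sup>2) ^ 5) (at r)" for r
    proof -
      define s where "s = sqrt (1 + r\<^sup>2)"
      have s: "s > 0" "s\<^sup>2 = 1 + r\<^sup>2" using sqrt_1_plus_square_pos[of r] by (auto simp: s_def)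
      have d: "((\<lambda>r. sqrt (1 + r\<^sup>2)) has_real_derivative r / s) (at r)"
        using sqrt_1_plus_square_pos[of r] add_pos_nonneg[OF zero_less_one zero_le_power2[of r]]
        by (auto intro!: derivative_eq_intros simp: s_def field_simps)
      have "((\<lambda>r. 4 * pi * r ^ 3 / sqrt (1 + r\<^sup>2) ^ 3) has_real_derivative
         ((4 * pi * (3 * r\<^sup>2)) * s ^ 3 - 4 * pi * r ^ 3 * (3 * s\<^sup>2 * (r / s))) / (s ^ 3 * s ^ 3)) (at r)"
        unfolding s_def using sqrt_1_plus_square_pos[of r] d[unfolded s_def]
        by (auto intro!: derivative_eq_intros simp: power2_eq_square)
           (simp add: divide_inverse algebra_simps)
      moreover have "((4 * pi * (3 * r\<^sup>2)) * s ^ 3 - 4 * pi * r ^ 3 * (3 * s\<^sup>2 * (r / s))) / (s ^ 3 * s ^ 3) = 12 * pi * r\<^sup>2 / s ^ 5"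
      proof -
        have "(4 * pi * (3 * r\<^sup>2)) * s ^ 3 - 4 * pi * r ^ 3 * (3 * s\<^sup>2 * (r / s)) = 12 * pi * r\<^sup>2 * s * (s\<^sup>2 - r\<^sup>2)"
          using s(1) by (simp add: field_simps power2_eq_square power3_eq_cube)
        also have "\<dots> = 12 * pi * r\<^sup>2 * s" by (simp add: s(2))
        finally show ?thesis using s(1) by (simp add: field_simps eval_nat_numeral)
      qed
      ultimately show ?thesis by (simp add: s_def)
    qed
    have "((\<lambda>r. 4 * pi / sqrt (1 / r\<^sup>2 + 1) ^ 3) \<longlongrightarrow> 4 * pi / sqrt (0 + 1) ^ 3) (at_top :: real filter)"
      by (intro tendsto_intros tendsto_divide_0[OF tendsto_const] filterlim_at_top_imp_at_infinity filterlim_pow_at_top filterlim_ident) auto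
    then have "((\<lambda>r. 4 * pi / sqrt (1 / r\<^sup>2 + 1) ^ 3) \<longlongrightarrow> 4 * pi) (at_top :: real filter)" by simp
    then show "((\<lambda>r. 4 * pi * r ^ 3 / sqrt (1 + r\<^sup>2) ^ 3) \<longlongrightarrow> 4 * pi) at_top"
    proof (rule Lim_transform_eventually)
      show "\<forall>\<^sub>F r in at_top. 4 * pi / sqrt (1 / r\<^sup>2 + 1) ^ 3 = 4 * pi * r ^ 3 / sqrt (1 + r\<^sup>2) ^ 3"
        using eventually_gt_at_top[of 0]
      proof eventually_elim
        fix r :: real assume r: "r > 0"
        have "1 / r\<^sup>2 + 1 = (1 + r\<^sup>2) / r\<^sup>2" using r by (simp add: field_simps)
        then have "sqrt (1 / r\<^sup>2 + 1) = sqrt (1 + r\<^sup>2) / r" using r by (simp add: real_sqrt_divide)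
        then show "4 * pi / sqrt (1 / r\<^sup>2 + 1) ^ 3 = 4 * pi * r ^ 3 / sqrt (1 + r\<^sup>2) ^ 3"
          using r by (simp add: power_divide)
      qed
    qed
  qed auto
  finally show ?thesis by simp
qed

lemma nn_integral_inverse_norm_cball:
  "(\<integral>\<^sup>+x. ennreal (1 / norm (x::R3)) * indicator (cball 0 1) x \<partial>lborel) = ennreal (2 * pi)"
proof -
  have "(\<integral>\<^sup>+x. ennreal (1 / norm (x::R3)) * indicator (cball 0 1) x \<partial>lborel)
      = (\<integral>\<^sup>+x. (\<lambda>r. ennreal (1 / r) * indicator {..1} r) (norm (x::R3)) \<partial>lborel)"
    by (intro nn_integral_cong) (auto simp: indicator_def)
  also have "\<dots> = (\<integral>\<^sup>+r. ennreal (1 / r) * indicator {..1} r * (ennreal (4 * pi * r\<^sup>2) * indicator {0..} r) \<partial>lborel)"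
    by (rule nn_integral_radial) measurable
  also have "\<dots> = (\<integral>\<^sup>+r. ennreal (4 * pi * r) * indicator {0..1} r \<partial>lborel)"
    by (intro nn_integral_cong) (auto simp: indicator_def ennreal_mult[symmetric] power2_eq_square)
  also have "\<dots> = ennreal (2 * pi * 1\<^sup>2 - 2 * pi * 0\<^sup>2)"
    by (rule nn_integral_FTC_Icc) (auto intro!: derivative_eq_intros)
  finally show ?thesis by simp
qed

text \<open>Split at |x - y| = 1: the near part is at most M times the integral 2 pi of 1 / |z| over
  the unit ball, the far part at most M times the volume of the ball carrying b. Neither depends on
  x.\<close>

lemma newton_kernel_bound:
  fixes b :: "R3 \<Rightarrow> real"
  assumes [measurable]: "b \<in> borel_measurable borel" and M: "\<And>x. \<bar>b x\<bar> \<le> M" and r: "\<And>x. norm x > r \<Longrightarrow> b x = 0"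
  shows "\<exists>C. \<forall>x. (\<integral>\<^sup>+y. ennreal \<bar>b y / dist x y\<bar> \<partial>lborel) \<le> ennreal C"
proof -
  define C where "C = M * (2 * pi) + M * (4 / 3 * pi * \<bar>r\<bar> ^ 3)"
  have M0: "M \<ge> 0" using M[of 0] by linarith
  have "(\<integral>\<^sup>+y. ennreal \<bar>b y / dist x y\<bar> \<partial>lborel) \<le> ennreal C" for x
  proof -
    have pt: "ennreal \<bar>b y / dist x y\<bar> \<le> ennreal M * (ennreal (1 / norm (x - y)) * indicator (cball 0 1) (x - y))
        + ennreal M * indicator (cball 0 \<bar>r\<bar>) y" for y
    proof (cases "norm (x - y) \<le> 1")
      case True
      have "\<bar>b y / dist x y\<bar> \<le> M * (1 / norm (x - y))"
        using M[of y] by (simp add: dist_norm divide_right_mono)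
      then have "ennreal \<bar>b y / dist x y\<bar> \<le> ennreal (M * (1 / norm (x - y)))" by (rule ennreal_leI)
      also have "\<dots> = ennreal M * (ennreal (1 / norm (x - y)) * indicator (cball 0 1) (x - y))"
        using True M0 by (subst ennreal_mult) auto
      finally show ?thesis by (simp add: add_increasing2)
    next
      case False
      have "\<bar>b y / dist x y\<bar> \<le> M * indicator (cball 0 \<bar>r\<bar>) y"
      proof (cases "norm y > \<bar>r\<bar>")
        case True then show ?thesis using r[of y] by simp
      next
        case False
        have "\<bar>b y\<bar> / dist x y \<le> M / 1" using \<open>\<not> norm (x - y) \<le> 1\<close> M[of y] M0
          by (intro frac_le) (auto simp: dist_norm)
        then show ?thesis using False by simp
      qed
      then have "ennreal \<bar>b y / dist x y\<bar> \<le> ennreal (M * indicator (cball 0 \<bar>r\<bar>) y)" by (rule ennreal_leI)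
      also have "\<dots> = ennreal M * indicator (cball 0 \<bar>r\<bar>) y" by (auto simp: indicator_def)
      finally show ?thesis by (simp add: add_increasing)
    qed
    have "(\<integral>\<^sup>+y. ennreal \<bar>b y / dist x y\<bar> \<partial>lborel) \<le> (\<integral>\<^sup>+y. ennreal M * (ennreal (1 / norm (x - y)) * indicator (cball 0 1) (x - y))
        + ennreal M * indicator (cball 0 \<bar>r\<bar>) y \<partial>lborel)"
      by (rule nn_integral_mono) (rule pt)
    also have "\<dots> = ennreal M * (\<integral>\<^sup>+y. ennreal (1 / norm (x - y)) * indicator (cball 0 1) (x - y) \<partial>lborel)
        + ennreal M * emeasure lborel (cball (0::R3) \<bar>r\<bar>)"
    proof -
      have [measurable]: "(\<lambda>y. indicator (cball 0 1) (x - y) :: ennreal) \<in> borel_measurable borel"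
        by (rule measurable_compose[of "\<lambda>y. x - y" borel borel]) (auto intro!: borel_measurable_indicator)
      have m: "(\<lambda>y. ennreal (1 / norm (x - y)) * indicator (cball 0 1) (x - y)) \<in> borel_measurable lborel"
        by measurable
      have m2: "(indicator (cball 0 \<bar>r\<bar>) :: R3 \<Rightarrow> ennreal) \<in> borel_measurable lborel"
        by (auto intro!: borel_measurable_indicator)
      show ?thesis
        using m m2 by (simp add: nn_integral_add nn_integral_cmult nn_integral_cmult_indicator)
    qed
    also have "(\<integral>\<^sup>+y. ennreal (1 / norm (x - y)) * indicator (cball 0 1) (x - y) \<partial>lborel) = ennreal (2 * pi)"
    proof -
      have "(\<lambda>y. ennreal (1 / norm (y::R3)) * indicator (cball 0 1) y) \<in> borel_measurable borel"
        by (intro borel_measurable_times_ennreal borel_measurable_indicator) auto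
      from nn_integral_lborel_reflect[OF this, of x] show ?thesis
        using nn_integral_inverse_norm_cball by simp
    qed
    also have "ennreal M * ennreal (2 * pi) + ennreal M * emeasure lborel (cball (0::R3) \<bar>r\<bar>) = ennreal C"
      using M0 by (simp add: emeasure_cball_R3 C_def ennreal_mult[symmetric] ennreal_plus[symmetric] del: ennreal_plus)
    finally show ?thesis .
  qed
  then show ?thesis by blast
qed

lemma integral_lborel_affine:
  fixes f :: "R3 \<Rightarrow> real"
  assumes [measurable]: "f \<in> borel_measurable borel" and c: "c > 0"
  shows "(LBINT x. f x) = (LBINT z. c ^ 3 * f (t + c *\<^sub>R z))"
proof -
  have "(LBINT x. f x) = (\<integral>x. f x \<partial>density (distr lborel borel (\<lambda>x. t + c *\<^sub>R x)) (\<lambda>_. ennreal (c ^ 3)))"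
    using lborel_affine[of c t] c by simp
  also have "\<dots> = (\<integral>x. c ^ 3 * f x \<partial>distr lborel borel (\<lambda>x. t + c *\<^sub>R x))"
    using c by (subst integral_density) auto
  also have "\<dots> = (LBINT z. c ^ 3 * f (t + c *\<^sub>R z))"
    by (subst integral_distr) auto
  finally show ?thesis .
qed

lemma nn_integral_lborel_affine:
  fixes f :: "'a::euclidean_space \<Rightarrow> ennreal"
  assumes [measurable]: "f \<in> borel_measurable borel" and c: "c > 0"
  shows "(\<integral>\<^sup>+x. f x \<partial>lborel) = ennreal (c ^ DIM('a)) * (\<integral>\<^sup>+z. f (t + c *\<^sub>R z) \<partial>lborel)"
proof -
  have "(\<integral>\<^sup>+x. f x \<partial>lborel) = (\<integral>\<^sup>+x. f x \<partial>density (distr lborel borel (\<lambda>x. t + c *\<^sub>R x)) (\<lambda>_. ennreal (c ^ DIM('a))))"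
    using lborel_affine[of c t] c by simp
  also have "\<dots> = (\<integral>\<^sup>+x. ennreal (c ^ DIM('a)) * f x \<partial>distr lborel borel (\<lambda>x. t + c *\<^sub>R x))"
    by (subst nn_integral_density) auto
  also have "\<dots> = (\<integral>\<^sup>+z. ennreal (c ^ DIM('a)) * f (t + c *\<^sub>R z) \<partial>lborel)"
    by (subst nn_integral_distr) auto
  also have "\<dots> = ennreal (c ^ DIM('a)) * (\<integral>\<^sup>+z. f (t + c *\<^sub>R z) \<partial>lborel)"
    by (subst nn_integral_cmult) auto
  finally show ?thesis .
qed

section \<open>Representation of C2 functions by the Newtonian potential\<close>

text \<open>The common ground of test functions and \<open>soft_abs\<close>. Second derivatives need
  only exist and be bounded, and only the pure ones appear, because they enter through the
  Laplacian; \<open>integral_partial_eq_0\<close> then yields their integrability.\<close>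

locale C2_compact =
  fixes W :: "R3 \<Rightarrow> real" and M r :: real
  assumes d1: "\<And>x. W differentiable (at x)"
    and d2: "\<And>i x. partial i W differentiable (at x)"
    and bound: "\<And>i x. \<bar>partial i (partial i W) x\<bar> \<le> M"
    and support: "\<And>x. norm x > r \<Longrightarrow> W x = 0"
begin

lemma W_measurable [measurable]: "W \<in> borel_measurable borel" "partial i W \<in> borel_measurable borel"
  using differentiable_borel_measurable d1 d2 by blast+

lemma partial_support: "norm x > r \<Longrightarrow> partial i W x = 0"
  using partial_zero_outside support by blast

lemma partial2_support: "norm x > r \<Longrightarrow> partial i (partial i W) x = 0"
  using partial_zero_outside partial_support by blast

lemma W_bounded: obtains B where "\<And>x. \<bar>W x\<bar> \<le> B"
  using continuous_bounded_support[OF differentiable_continuous_UNIV[OF d1] support] by metis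

lemma partial_bounded: obtains B where "\<And>x. \<bar>partial i W x\<bar> \<le> B"
  using continuous_bounded_support[OF differentiable_continuous_UNIV[OF d2] partial_support] by metis

lemma partial2_integrable: "integrable lborel (partial i (partial i W))"
  by (rule integral_partial_eq_0(1)[OF d2 bound partial_support])

lemma partial2_measurable [measurable]: "partial i (partial i W) \<in> borel_measurable borel"
  using borel_measurable_integrable[OF partial2_integrable] by simp

definition lap :: "R3 \<Rightarrow> real" where "lap x = (\<Sum>i\<in>UNIV. partial i (partial i W) x)"

lemma lap_measurable [measurable]: "lap \<in> borel_measurable borel"
  unfolding lap_def[abs_def] by measurable

lemma lap_bound: "\<bar>lap x\<bar> \<le> 3 * M"
proof -
  have "\<bar>lap x\<bar> \<le> (\<Sum>i\<in>(UNIV::3 set). M)"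
    unfolding lap_def by (rule order_trans[OF sum_abs sum_mono]) (rule bound)
  then show ?thesis by simp
qed

lemma lap_support: "norm x > r \<Longrightarrow> lap x = 0"
  unfolding lap_def by (simp add: partial2_support)

lemma W_integrable: "integrable lborel W"
proof -
  obtain B where "\<And>x. \<bar>W x\<bar> \<le> B" by (rule W_bounded) blast
  then show ?thesis by (rule integrable_bounded_support[OF W_measurable(1) _ support])
qed

lemma lap_integrable: "integrable lborel lap"
  unfolding lap_def[abs_def] by (intro Bochner_Integration.integrable_sum partial2_integrable)

text \<open>Each W times \<open>partial i W\<close> has compact support, so its i-th partial
  integrates to 0.\<close>

lemma dirichlet:
  "integrable lborel (\<lambda>x. (partial i W x)\<^sup>2)"
  "(LBINT x. (- lap x) * W x) = (\<Sum>i\<in>UNIV. LBINT x. (partial i W x)\<^sup>2)"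
proof -
  obtain B where B: "\<And>x. \<bar>W x\<bar> \<le> B" by (rule W_bounded) blast
  have sq: "integrable lborel (\<lambda>x. (partial i W x)\<^sup>2)" for i
  proof -
    obtain B where B: "\<And>x. \<bar>partial i W x\<bar> \<le> B" by (rule partial_bounded) blast
    have "\<bar>(partial i W x)\<^sup>2\<bar> \<le> B\<^sup>2" for x using B[of x] by (simp add: abs_le_square_iff[symmetric])
    then show ?thesis
      by (rule integrable_bounded_support[of _ "B\<^sup>2" r, rotated]) (auto simp: partial_support)
  qed
  then show "integrable lborel (\<lambda>x. (partial i W x)\<^sup>2)" .
  have i2: "integrable lborel (\<lambda>x. partial i (partial i W) x * W x)" for i
    by (rule integrable_mult_bounded[OF partial2_integrable]) (use B in auto)
  have z: "(LBINT x. partial i (partial i W) x * W x) = - (LBINT x. (partial i W x)\<^sup>2)" for i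
  proof -
    obtain B' where B': "\<And>x. \<bar>partial i W x\<bar> \<le> B'" by (rule partial_bounded) blast
    have p: "partial i (\<lambda>x. W x * partial i W x) x = partial i W x * partial i W x + W x * partial i (partial i W) x" for x
      by (rule partial_mult[OF d1 d2])
    have "(LBINT x. partial i (\<lambda>x. W x * partial i W x) x) = 0"
    proof (rule integral_partial_eq_0(2))
      show "(\<lambda>x. W x * partial i W x) differentiable (at x)" for x
        by (rule differentiable_mult[OF d1 d2])
      show "\<bar>partial i (\<lambda>x. W x * partial i W x) x\<bar> \<le> B' * B' + B * M" for x
        unfolding p
        by (rule order_trans[OF abs_triangle_ineq], unfold abs_mult, intro add_mono mult_mono' B B' bound) auto
      show "W x * partial i W x = 0" if "norm x > r" for x using support[OF that] by simp
    qed
    moreover have "partial i (\<lambda>x. W x * partial i W x) = (\<lambda>x. (partial i W x)\<^sup>2 + partial i (partial i W) x * W x)"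
      using p by (simp add: fun_eq_iff power2_eq_square mult.commute)
    ultimately show ?thesis using sq[of i] i2[of i] by simp
  qed
  have "(LBINT x. (- lap x) * W x) = (LBINT x. (\<Sum>i\<in>UNIV. - (partial i (partial i W) x * W x)))"
    by (intro Bochner_Integration.integral_cong) (auto simp: lap_def sum_distrib_right sum_negf)
  also have "\<dots> = (\<Sum>i\<in>UNIV. LBINT x. (partial i W x)\<^sup>2)"
    using i2 z by (subst Bochner_Integration.integral_sum) auto
  finally show "(LBINT x. (- lap x) * W x) = (\<Sum>i\<in>UNIV. LBINT x. (partial i W x)\<^sup>2)" .
qed

context
  fixes x :: R3 and e :: real
  assumes e: "e > 0"
begin

text \<open>Regularised distance to x. Its reciprocal is smooth, so integration by parts against the
  Newtonian kernel needs no excised ball around x and no boundary terms.\<close>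

definition s where "s y = sqrt (e\<^sup>2 + (norm (y - x))\<^sup>2)"

lemma arg_pos: "0 < e\<^sup>2 + (norm (y - x))\<^sup>2"
  using e by (simp add: add_pos_nonneg)

lemma s_ge: "s y \<ge> e" "s y \<ge> norm (y - x)" "s y > 0"
proof -
  show "s y \<ge> e" unfolding s_def by (rule real_le_rsqrt) simp
  then show "s y > 0" using e by linarith
  show "s y \<ge> norm (y - x)" unfolding s_def by (rule real_le_rsqrt) simp
qed

lemma s_square: "(s y)\<^sup>2 = e\<^sup>2 + (norm (y - x))\<^sup>2"
  unfolding s_def using arg_pos[of y] by simp

lemma s_partial: "s differentiable (at y)" "partial i s y = (y $ i - x $ i) / s y"
proof -
  have n: "((\<lambda>y. e\<^sup>2 + (norm (y - x))\<^sup>2) has_derivative (\<lambda>h. 2 * ((y - x) \<bullet> h))) (at y)"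
  proof -
    have "((\<lambda>y. e\<^sup>2 + (y - x) \<bullet> (y - x)) has_derivative (\<lambda>h. 0 + ((y - x) \<bullet> (h - 0) + (h - 0) \<bullet> (y - x)))) (at y)"
      by (intro has_derivative_add has_derivative_const has_derivative_inner has_derivative_diff has_derivative_ident)
    then show ?thesis by (simp add: power2_norm_eq_inner inner_commute[of _ "y - x"] mult_2[symmetric])
  qed
  have d: "(\<lambda>y. e\<^sup>2 + (norm (y - x))\<^sup>2) differentiable (at y)"
    using n unfolding differentiable_def by blast
  have p: "partial i (\<lambda>y. e\<^sup>2 + (norm (y - x))\<^sup>2) y = 2 * (y $ i - x $ i)"
    using partial_eqI[OF n, of i] by (simp add: inner_axis)
  have h: "(sqrt has_real_derivative 1 / (2 * s y)) (at (e\<^sup>2 + (norm (y - x))\<^sup>2))"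
    by (rule DERIV_cong[OF DERIV_real_sqrt[OF arg_pos]]) (simp add: s_def inverse_eq_divide)
  show "s differentiable (at y)" unfolding s_def[abs_def] by (rule partial_chain(2)[OF d h])
  show "partial i s y = (y $ i - x $ i) / s y"
  proof -
    have eq: "1 / (2 * t) * (2 * a) = a / t" for a t :: real by simp
    show ?thesis
      using partial_chain(1)[OF d h, of i] unfolding p s_def[abs_def] eq .
  qed
qed

lemma kernel_partials:
  "(\<lambda>y. 1 / s y) differentiable (at y)"
  "partial i (\<lambda>y. 1 / s y) y = - (y $ i - x $ i) / s y ^ 3"
  "(\<lambda>y. - (y $ i - x $ i) / s y ^ 3) differentiable (at y)"
  "partial i (\<lambda>y. - (y $ i - x $ i) / s y ^ 3) y = - 1 / s y ^ 3 + 3 * (y $ i - x $ i)\<^sup>2 / s y ^ 5"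
proof -
  have sp: "s y > 0" by (rule s_ge)
  have h1: "((\<lambda>t. 1 / t) has_real_derivative - 1 / (s y)\<^sup>2) (at (s y))"
    using sp by (auto intro!: derivative_eq_intros simp: power2_eq_square)
  show "(\<lambda>y. 1 / s y) differentiable (at y)" by (rule partial_chain(2)[OF s_partial(1) h1])
  show "partial i (\<lambda>y. 1 / s y) y = - (y $ i - x $ i) / s y ^ 3"
  proof -
    have "partial i (\<lambda>y. 1 / s y) y = - ((y $ i - x $ i) / s y ^ 3)"
      using partial_chain(1)[OF s_partial(1) h1, of i] sp by (simp add: s_partial(2) power2_eq_square power3_eq_cube)
    then show ?thesis by (simp only: minus_divide_left)
  qed
  have h3: "((\<lambda>t. 1 / t ^ 3) has_real_derivative - 3 / s y ^ 4) (at (s y))"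
    using sp by (auto intro!: derivative_eq_intros simp: field_simps eval_nat_numeral)
  have d3: "(\<lambda>y. 1 / s y ^ 3) differentiable (at y)" by (rule partial_chain(2)[OF s_partial(1) h3])
  have p3: "partial i (\<lambda>y. 1 / s y ^ 3) y = - 3 * (y $ i - x $ i) / s y ^ 5"
  proof -
    have "- 3 / t ^ 4 * (a / t) = - 3 * a / t ^ 5" for a t :: real by (simp add: eval_nat_numeral)
    then show ?thesis using partial_chain(1)[OF s_partial(1) h3, of i] by (simp only: s_partial(2))
  qed
  have dl: "(\<lambda>y::R3. x $ i - y $ i) differentiable (at y)" by (intro differentiable_diff) auto
  have pl: "partial i (\<lambda>y. x $ i - y $ i) y = - 1" by (simp add: partial_diff)
  have eq: "(\<lambda>y. - (y $ i - x $ i) / s y ^ 3) = (\<lambda>y. (x $ i - y $ i) * (1 / s y ^ 3))" by auto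
  show "(\<lambda>y. - (y $ i - x $ i) / s y ^ 3) differentiable (at y)"
    unfolding eq by (rule differentiable_mult[OF dl d3])
  show "partial i (\<lambda>y. - (y $ i - x $ i) / s y ^ 3) y = - 1 / s y ^ 3 + 3 * (y $ i - x $ i)\<^sup>2 / s y ^ 5"
    unfolding eq partial_mult[OF dl d3] pl p3 by (simp add: power2_eq_square algebra_simps add_divide_distrib[symmetric] diff_divide_distrib[symmetric])
qed

lemma s_measurable [measurable]: "s \<in> borel_measurable borel"
  using differentiable_borel_measurable[OF s_partial(1)] .

text \<open>Green's identity for W and the regularised kernel 1 / s, whose Laplacian is -3 e^2 /
  s^5.\<close>

lemma regularised_representation:
  "(LBINT y. (1 / s y) * (- lap y)) = (LBINT y. 3 * e\<^sup>2 / s y ^ 5 * W y)"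
proof -
  \<comment> \<open>\<open>c i\<close> is the second partial of 1 / s in direction i; since |y_i -
    x_i| \<le> s, it is bounded by (1 + 3) / e^3.\<close>
  define c where "c = (\<lambda>i y. - 1 / s y ^ 3 + 3 * (y $ i - x $ i)\<^sup>2 / s y ^ 5)"
  have [measurable]: "c i \<in> borel_measurable borel" for i unfolding c_def by measurable
  obtain B where B: "\<And>x. \<bar>W x\<bar> \<le> B" by (rule W_bounded) blast
  have cb: "\<bar>c i y\<bar> \<le> 4 / e ^ 3" for i y
  proof -
    have sp: "s y > 0" "s y \<ge> e" by (rule s_ge)+
    have "\<bar>(y - x) $ i\<bar> \<le> s y" using component_le_norm_cart[of "y - x" i] s_ge(2)[of y] by linarith
    then have "(y $ i - x $ i)\<^sup>2 \<le> (s y)\<^sup>2" using sp by (simp add: abs_le_square_iff[symmetric])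
    then have "3 * (y $ i - x $ i)\<^sup>2 / s y ^ 5 \<le> 3 * (s y)\<^sup>2 / s y ^ 5"
      using sp by (intro divide_right_mono) auto
    also have "\<dots> = 3 / s y ^ 3" using sp by (simp add: eval_nat_numeral)
    finally have "3 * (y $ i - x $ i)\<^sup>2 / s y ^ 5 \<le> 3 / s y ^ 3" .
    moreover have "0 \<le> 3 * (y $ i - x $ i)\<^sup>2 / s y ^ 5" "0 \<le> 1 / s y ^ 3" using sp by auto
    moreover have "3 / s y ^ 3 = 3 * (1 / s y ^ 3)" "4 / s y ^ 3 = 4 * (1 / s y ^ 3)"
      "- 1 / s y ^ 3 = - (1 / s y ^ 3)" by simp_all
    ultimately have "\<bar>c i y\<bar> \<le> 4 / s y ^ 3" unfolding c_def by linarith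
    also have "\<dots> \<le> 4 / e ^ 3" using sp e by (intro divide_left_mono power_mono mult_pos_pos) auto
    finally show ?thesis .
  qed
  have qb: "\<bar>1 / s y\<bar> \<le> 1 / e" for y
    using s_ge[of y] e by (simp add: frac_le)
  have i1: "integrable lborel (\<lambda>y. partial i (partial i W) y * (1 / s y))" for i
    by (rule integrable_mult_bounded[OF partial2_integrable _ qb]) measurable
  have i2: "integrable lborel (\<lambda>y. W y * c i y)" for i
    by (rule integrable_mult_bounded[OF W_integrable _ cb]) measurable
  have z: "(LBINT y. partial i (partial i W) y * (1 / s y)) = (LBINT y. W y * c i y)" for i
  proof -
    \<comment> \<open>The i-th component of the Green field: the first-order products cancel in its
      i-th partial, leaving the two terms to be compared.\<close>
    let ?g = "\<lambda>y. (1 / s y) * partial i W y - (- (y $ i - x $ i) / s y ^ 3) * W y"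
    have dA: "(\<lambda>y. (1 / s y) * partial i W y) differentiable (at y)" for y
      by (rule differentiable_mult[OF kernel_partials(1) d2])
    have dB: "(\<lambda>y. (- (y $ i - x $ i) / s y ^ 3) * W y) differentiable (at y)" for y
      by (rule differentiable_mult[OF kernel_partials(3) d1])
    have p: "partial i ?g y = (1 / s y) * partial i (partial i W) y - c i y * W y" for y
      unfolding partial_diff[OF dA dB] partial_mult[OF kernel_partials(1) d2] partial_mult[OF kernel_partials(3) d1]
        kernel_partials(2,4) c_def by simp
    have "(LBINT y. partial i ?g y) = 0"
    proof (rule integral_partial_eq_0(2))
      show "?g differentiable (at y)" for y by (rule differentiable_diff[OF dA dB])
      show "\<bar>partial i ?g y\<bar> \<le> 1 / e * M + 4 / e ^ 3 * B" for y
        unfolding p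
        by (rule order_trans[OF abs_triangle_ineq4], unfold abs_mult, intro add_mono mult_mono' qb cb B bound) auto
      show "?g y = 0" if "norm y > r" for y using support[OF that] partial_support[OF that, of i] by simp
    qed
    moreover have "partial i ?g = (\<lambda>y. partial i (partial i W) y * (1 / s y) - W y * c i y)"
      using p by (simp add: fun_eq_iff mult.commute)
    ultimately show ?thesis using i1[of i] i2[of i] by simp
  qed
  have csum: "(\<Sum>i\<in>UNIV. c i y) = - (3 * e\<^sup>2 / s y ^ 5)" for y
  proof -
    have sp: "s y > 0" by (rule s_ge)
    have "(\<Sum>i\<in>UNIV. c i y) = - 3 / s y ^ 3 + 3 * (\<Sum>i\<in>UNIV. (y $ i - x $ i)\<^sup>2) / s y ^ 5"
      unfolding c_def by (simp add: sum.distrib sum_subtractf sum_distrib_left sum_divide_distrib)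
    also have "(\<Sum>i\<in>UNIV. (y $ i - x $ i)\<^sup>2) = (s y)\<^sup>2 - e\<^sup>2"
      unfolding s_square power2_norm_eq_inner by (simp add: inner_vec_def power2_eq_square)
    also have "- 3 / s y ^ 3 + 3 * ((s y)\<^sup>2 - e\<^sup>2) / s y ^ 5 = - (3 * e\<^sup>2 / s y ^ 5)"
      using sp by (simp add: field_simps eval_nat_numeral)
    finally show ?thesis .
  qed
  have "(LBINT y. (1 / s y) * (- lap y)) = (LBINT y. (\<Sum>i\<in>UNIV. - (partial i (partial i W) y * (1 / s y))))"
    by (intro Bochner_Integration.integral_cong) (auto simp: lap_def sum_negf sum_divide_distrib)
  also have "\<dots> = (\<Sum>i\<in>UNIV. - (LBINT y. W y * c i y))"
    using i1 by (subst Bochner_Integration.integral_sum) (auto simp: z[symmetric] simp del: times_divide_eq_right)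
  also have "\<dots> = (LBINT y. (\<Sum>i\<in>UNIV. - (W y * c i y)))"
    using i2 by (subst Bochner_Integration.integral_sum) auto
  also have "\<dots> = (LBINT y. 3 * e\<^sup>2 / s y ^ 5 * W y)"
    by (intro Bochner_Integration.integral_cong) (simp_all add: sum_negf sum_distrib_left[symmetric] csum)
  finally show ?thesis .
qed

text \<open>Substituting y = x + e z makes all powers of e cancel (3 + 2 - 5 = 0). What remains is
  an average of W near x with a fixed profile of total mass 4 pi.\<close>

lemma regularised_scaled:
  "(LBINT y. 3 * e\<^sup>2 / s y ^ 5 * W y) = (LBINT z. 3 / sqrt (1 + (norm z)\<^sup>2) ^ 5 * W (x + e *\<^sub>R z))"
proof -
  have "(LBINT y. 3 * e\<^sup>2 / s y ^ 5 * W y) = (LBINT z. e ^ 3 * (3 * e\<^sup>2 / s (x + e *\<^sub>R z) ^ 5 * W (x + e *\<^sub>R z)))"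
    by (rule integral_lborel_affine[OF _ e]) measurable
  also have "\<dots> = (LBINT z. 3 / sqrt (1 + (norm z)\<^sup>2) ^ 5 * W (x + e *\<^sub>R z))"
  proof (intro Bochner_Integration.integral_cong refl)
    fix z :: R3
    have "e\<^sup>2 + (norm (e *\<^sub>R z))\<^sup>2 = e\<^sup>2 * (1 + (norm z)\<^sup>2)" by (simp add: power_mult_distrib algebra_simps)
    then have s: "s (x + e *\<^sub>R z) = e * sqrt (1 + (norm z)\<^sup>2)"
      using e by (simp add: s_def real_sqrt_mult)
    have "e ^ 3 * (3 * e\<^sup>2 / (e * k) ^ 5 * w) = 3 / k ^ 5 * w" if "k > 0" for k w :: real
      using e that by (simp add: power_mult_distrib field_simps eval_nat_numeral)
    from this[OF sqrt_1_plus_square_pos(1)] show "e ^ 3 * (3 * e\<^sup>2 / s (x + e *\<^sub>R z) ^ 5 * W (x + e *\<^sub>R z)) = 3 / sqrt (1 + (norm z)\<^sup>2) ^ 5 * W (x + e *\<^sub>R z)"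
      unfolding s .
  qed
  finally show ?thesis .
qed

end

end

lemma AE_lborel_neq: "AE y in lborel. y \<noteq> (x :: 'a::euclidean_space)"
  by (rule AE_I'[of "{x}"]) (auto simp: null_sets_def)

lemma plummer_has_integral:
  "integrable lborel (\<lambda>z::R3. 3 / sqrt (1 + (norm z)\<^sup>2) ^ 5)"
  "(LBINT z. 3 / sqrt (1 + (norm (z::R3))\<^sup>2) ^ 5) = 4 * pi"
proof -
  have nn: "0 \<le> 3 / sqrt (1 + (norm (z::R3))\<^sup>2) ^ 5" for z by simp
  have m: "(\<lambda>z::R3. 3 / sqrt (1 + (norm z)\<^sup>2) ^ 5) \<in> borel_measurable lborel" by measurable
  show i: "integrable lborel (\<lambda>z::R3. 3 / sqrt (1 + (norm z)\<^sup>2) ^ 5)"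
    by (rule integrableI_nonneg[OF m]) (simp_all add: nn_integral_plummer)
  show "(LBINT z. 3 / sqrt (1 + (norm (z::R3))\<^sup>2) ^ 5) = 4 * pi"
    using nn_integral_eq_integral[OF i AE_I2[OF nn]] nn_integral_plummer
    by (simp add: integral_nonneg_AE)
qed

context C2_compact begin

lemma newton_integrable:
  fixes b :: "R3 \<Rightarrow> real"
  assumes [measurable]: "b \<in> borel_measurable borel" and "\<And>x. \<bar>b x\<bar> \<le> K" "\<And>x. norm x > r \<Longrightarrow> b x = (0::real)"
  shows "integrable lborel (\<lambda>y. b y / dist x y)"
proof -
  obtain C where C: "\<And>x. (\<integral>\<^sup>+y. ennreal \<bar>b y / dist x y\<bar> \<partial>lborel) \<le> ennreal C"
    using newton_kernel_bound[OF assms] by blast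
  show ?thesis using C[of x] by (intro integrableI_bounded) (auto intro: le_less_trans)
qed

text \<open>The two sides are limits of one sequence as e tends to 0: the kernels 1 / s tend to 1 /
  |x - y| and stay below it, and by the rescaled form the same integrals tend to 4 pi W x.\<close>

theorem newton_representation:
  "(LBINT y. (- lap y) / dist x y) = 4 * pi * W x"
proof (rule LIMSEQ_unique)
  define e where "e n = 1 / real (Suc n)" for n
  have e0: "e n > 0" for n by (simp add: e_def)
  have el: "e \<longlonglongrightarrow> 0" unfolding e_def[abs_def] by (rule LIMSEQ_Suc[OF lim_1_over_n])
  have sm [measurable]: "s x (e n) \<in> borel_measurable borel" for n by (rule s_measurable[OF e0])
  let ?I = "\<lambda>n. LBINT y. (1 / s x (e n) y) * (- lap y)"
  show "?I \<longlonglongrightarrow> (LBINT y. (- lap y) / dist x y)"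
  proof (rule integral_dominated_convergence)
    show "integrable lborel (\<lambda>y. \<bar>lap y\<bar> / dist x y)"
      using newton_integrable[of "\<lambda>y. \<bar>lap y\<bar>" "3 * M" x] lap_bound lap_support by auto
    show "AE y in lborel. (\<lambda>n. (1 / s x (e n) y) * (- lap y)) \<longlonglongrightarrow> (- lap y) / dist x y"
      using AE_lborel_neq[of x]
    proof eventually_elim
      fix y assume y: "y \<noteq> x"
      have "(\<lambda>n. s x (e n) y) \<longlonglongrightarrow> sqrt (0\<^sup>2 + (norm (y - x))\<^sup>2)"
        unfolding s_def[OF e0] by (intro tendsto_intros el)
      then have "(\<lambda>n. s x (e n) y) \<longlonglongrightarrow> dist x y" by (simp add: dist_norm norm_minus_commute)
      then have "(\<lambda>n. (1 / s x (e n) y) * (- lap y)) \<longlonglongrightarrow> (1 / dist x y) * (- lap y)"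
        using y by (intro tendsto_intros) auto
      then show "(\<lambda>n. (1 / s x (e n) y) * (- lap y)) \<longlonglongrightarrow> (- lap y) / dist x y" by simp
    qed
    show "AE y in lborel. norm ((1 / s x (e n) y) * (- lap y)) \<le> \<bar>lap y\<bar> / dist x y" for n
      using AE_lborel_neq[of x]
    proof eventually_elim
      fix y assume y: "y \<noteq> x"
      have "norm (y - x) \<le> s x (e n) y" "0 < s x (e n) y" by (rule s_ge[OF e0])+
      then have "\<bar>lap y\<bar> / s x (e n) y \<le> \<bar>lap y\<bar> / dist x y"
        using y by (intro divide_left_mono) (auto simp: dist_norm norm_minus_commute)
      then show "norm ((1 / s x (e n) y) * (- lap y)) \<le> \<bar>lap y\<bar> / dist x y"
        using \<open>0 < s x (e n) y\<close> by (simp add: abs_mult)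
    qed
  qed measurable
  obtain B where B: "\<And>x. \<bar>W x\<bar> \<le> B" by (rule W_bounded) blast
  have I: "?I n = (LBINT z. 3 / sqrt (1 + (norm z)\<^sup>2) ^ 5 * W (x + e n *\<^sub>R z))" for n
    using regularised_representation[OF e0] regularised_scaled[OF e0] by simp
  have "(\<lambda>n. LBINT z. 3 / sqrt (1 + (norm z)\<^sup>2) ^ 5 * W (x + e n *\<^sub>R z))
      \<longlonglongrightarrow> (LBINT z. 3 / sqrt (1 + (norm (z::R3))\<^sup>2) ^ 5 * W x)"
  proof (rule integral_dominated_convergence)
    show "integrable lborel (\<lambda>z::R3. 3 / sqrt (1 + (norm z)\<^sup>2) ^ 5 * B)"
      by (intro integrable_mult_left plummer_has_integral(1))
    show "AE z in lborel. (\<lambda>n. 3 / sqrt (1 + (norm z)\<^sup>2) ^ 5 * W (x + e n *\<^sub>R z)) \<longlonglongrightarrow> 3 / sqrt (1 + (norm z)\<^sup>2) ^ 5 * W x"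
    proof (rule AE_I2)
      fix z :: R3
      have "(\<lambda>n. x + e n *\<^sub>R z) \<longlonglongrightarrow> x + 0 *\<^sub>R z" by (intro tendsto_intros el)
      then have "(\<lambda>n. W (x + e n *\<^sub>R z)) \<longlonglongrightarrow> W (x + 0 *\<^sub>R z)"
        using differentiable_imp_continuous_within[OF d1] continuous_within_tendsto_compose'[of _ UNIV W]
        by (metis UNIV_I)
      then show "(\<lambda>n. 3 / sqrt (1 + (norm z)\<^sup>2) ^ 5 * W (x + e n *\<^sub>R z)) \<longlonglongrightarrow> 3 / sqrt (1 + (norm z)\<^sup>2) ^ 5 * W x"
        by (intro tendsto_mult tendsto_const) simp
    qed
    show "AE z in lborel. norm (3 / sqrt (1 + (norm z)\<^sup>2) ^ 5 * W (x + e n *\<^sub>R z)) \<le> 3 / sqrt (1 + (norm z)\<^sup>2) ^ 5 * B" for n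
      unfolding norm_mult using B by (intro AE_I2 mult_mono) auto
  qed measurable
  also have "(LBINT z. 3 / sqrt (1 + (norm (z::R3))\<^sup>2) ^ 5 * W x) = 4 * pi * W x"
    by (subst integral_mult_left_zero) (simp only: plummer_has_integral(2))
  finally show "?I \<longlonglongrightarrow> 4 * pi * W x" unfolding I .
qed

end

text \<open>The exponent 3 compensates the factor t^(-3) from integrating Gaussians of width 1 / t
  over R^3. What is left, exp (-(a t)^2 / 2) with a = |x - y|, integrates over t > 0 to a constant
  divided by a.\<close>

definition gauss_weight :: "real \<Rightarrow> real" where
  "gauss_weight t = (if t > 0 then t ^ 3 else 0)"

lemma gauss_weight_measurable [measurable]: "gauss_weight \<in> borel_measurable borel"
  unfolding gauss_weight_def[abs_def] by measurable

lemma gauss_weight_nonneg: "gauss_weight t \<ge> 0" by (simp add: gauss_weight_def)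

text \<open>Only positivity and finiteness of the constant are used. Finiteness comes from
  comparison with the profile of \<open>nn_integral_plummer\<close>.\<close>

lemma gauss_integral_R3:
  obtains c where "c > 0" "(\<integral>\<^sup>+z. ennreal (exp (- 2 * (norm (z::R3))\<^sup>2)) \<partial>lborel) = ennreal c"
proof -
  let ?I = "\<integral>\<^sup>+z. ennreal (exp (- 2 * (norm (z::R3))\<^sup>2)) \<partial>lborel"
  have "?I \<le> (\<integral>\<^sup>+z. ennreal (27 / 24) * ennreal (3 / sqrt (1 + (norm (z::R3))\<^sup>2) ^ 5) \<partial>lborel)"
  proof (rule nn_integral_mono)
    fix z :: R3
    define q where "q = (norm z)\<^sup>2"
    have q: "q \<ge> 0" by (simp add: q_def)
    \<comment> \<open>Cubing exp (2q/3) \<ge> (2/3) (1 + q) gives exp (2q) \<ge> (8/27) (1 + q)^3,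
      hence at least (8/27) (1 + q)^(5/2). The factor 27/24 is 27/8 divided by the 3 of the
      profile.\<close>
    have "2 / 3 * (1 + q) \<le> 1 + 2 / 3 * q" by simp
    also have "\<dots> \<le> exp (2 / 3 * q)" by (rule exp_ge_add_one_self)
    finally have "(2 / 3 * (1 + q)) ^ 3 \<le> exp (2 / 3 * q) ^ 3" using q by (intro power_mono) auto
    also have "\<dots> = exp (2 * q)" by (simp add: exp_of_nat_mult[symmetric])
    finally have "(2 / 3 * (1 + q)) ^ 3 \<le> exp (2 * q)" .
    moreover have "(2 / 3 * (1 + q)) ^ 3 = 8 / 27 * (1 + q) ^ 3"
      by (simp only: power_mult_distrib) (simp add: power_divide)
    ultimately have "8 / 27 * (1 + q) ^ 3 \<le> exp (2 * q)" by simp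
    moreover have "sqrt (1 + q) ^ 5 \<le> (1 + q) ^ 3"
    proof -
      have "sqrt (1 + q) ^ 5 \<le> sqrt (1 + q) ^ 6" using q by (intro power_increasing) auto
      also have "\<dots> = ((sqrt (1 + q))\<^sup>2) ^ 3" by (simp only: power_mult[symmetric]) simp
      finally show ?thesis using q by simp
    qed
    ultimately have le: "8 / 27 * sqrt (1 + q) ^ 5 \<le> exp (2 * q)" by linarith
    have sp: "sqrt (1 + q) ^ 5 > 0" using q by simp
    have "exp (- 2 * q) = 1 / exp (2 * q)" by (simp add: exp_minus divide_inverse)
    also have "\<dots> \<le> 1 / (8 / 27 * sqrt (1 + q) ^ 5)" using le sp by (intro divide_left_mono) auto
    also have "\<dots> = 27 / 24 * (3 / sqrt (1 + q) ^ 5)" by simp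
    finally show "ennreal (exp (- 2 * (norm z)\<^sup>2)) \<le> ennreal (27 / 24) * ennreal (3 / sqrt (1 + (norm z)\<^sup>2) ^ 5)"
      unfolding q_def by (subst ennreal_mult[symmetric]) (auto intro!: ennreal_leI)
  qed
  also have "\<dots> = ennreal (27 / 24) * ennreal (4 * pi)"
    by (subst nn_integral_cmult) (auto simp: nn_integral_plummer)
  also have "\<dots> < \<infinity>" by (simp add: ennreal_mult[symmetric])
  finally have fin: "?I < \<infinity>" .
  have "?I \<noteq> 0"
  proof
    assume "?I = 0"
    then have "AE z in (lborel :: R3 measure). z \<notin> UNIV" by (subst (asm) nn_integral_0_iff_AE) auto
    then have "UNIV \<in> null_sets (lborel :: R3 measure)" by (subst AE_iff_null_sets) auto
    then show False by (simp add: null_sets_def)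
  qed
  with fin show ?thesis
    by (cases ?I rule: ennreal_cases) (auto intro!: that[of "enn2real ?I"] simp: enn2real_positive_iff)
qed

lemma gauss_integral_half_line:
  obtains c where "c > 0" "(\<integral>\<^sup>+t. ennreal (exp (- (t::real)\<^sup>2 / 2)) * indicator {0<..} t \<partial>lborel) = ennreal c"
proof -
  let ?I = "\<integral>\<^sup>+t. ennreal (exp (- (t::real)\<^sup>2 / 2)) * indicator {0<..} t \<partial>lborel"
  have "?I \<le> (\<integral>\<^sup>+t. ennreal (exp (1 / 2) * exp (- t)) * indicator {0..} t \<partial>lborel)"
  proof (rule nn_integral_mono)
    fix t :: real
    have "- t\<^sup>2 / 2 \<le> 1 / 2 + - t" using zero_le_power2[of "t - 1"] unfolding power2_diff by simp
    then have "exp (- t\<^sup>2 / 2) \<le> exp (1 / 2) * exp (- t)" by (simp add: exp_add[symmetric])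
    then show "ennreal (exp (- t\<^sup>2 / 2)) * indicator {0<..} t \<le> ennreal (exp (1 / 2) * exp (- t)) * indicator {0..} t"
      by (auto simp: indicator_def intro!: ennreal_leI)
  qed
  also have "\<dots> = ennreal (0 - - exp (1 / 2) * exp (- 0))"
  proof (rule nn_integral_FTC_atLeast)
    have "((\<lambda>t::real. - exp (1 / 2) * exp (- t)) \<longlongrightarrow> - exp (1 / 2) * 0) at_top"
      by (intro tendsto_intros filterlim_compose[OF exp_at_bot] filterlim_uminus_at_bot_at_top)
    then show "((\<lambda>t::real. - exp (1 / 2) * exp (- t)) \<longlongrightarrow> 0) at_top" by simp
  qed (auto intro!: derivative_eq_intros)
  also have "\<dots> < \<infinity>" by simp
  finally have fin: "?I < \<infinity>" .
  have "?I \<noteq> 0"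
  proof
    assume "?I = 0"
    then have "AE t in (lborel :: real measure). t \<notin> {0<..}"
      by (subst (asm) nn_integral_0_iff_AE) (auto simp: indicator_def split: if_splits)
    then have "{0<..} \<in> null_sets (lborel :: real measure)" by (simp add: AE_iff_null_sets)
    then have "negligible {0::real<..}" by (simp add: negligible_iff_null_sets null_sets_completionI)
    then show False using open_not_negligible[of "{0::real<..}"] by auto
  qed
  with fin show ?thesis
    by (cases ?I rule: ennreal_cases) (auto intro!: that[of "enn2real ?I"] simp: enn2real_positive_iff)
qed

text \<open>Superposition of rank-one kernels: this is why the Coulomb form is positive definite.\<close>

lemma gaussian_subordination:
  obtains c where "c > 0"
    "\<And>x y :: R3. x \<noteq> y \<Longrightarrow> (\<integral>\<^sup>+q. ennreal (gauss_weight (fst q) * exp (- (fst q)\<^sup>2 * (norm (x - snd q))\<^sup>2)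
        * exp (- (fst q)\<^sup>2 * (norm (y - snd q))\<^sup>2)) \<partial>(lborel \<Otimes>\<^sub>M lborel)) = ennreal (c / dist x y)"
proof -
  obtain c0 where c0: "c0 > 0" "(\<integral>\<^sup>+z. ennreal (exp (- 2 * (norm (z::R3))\<^sup>2)) \<partial>lborel) = ennreal c0"
    by (rule gauss_integral_R3)
  obtain c1 where c1: "c1 > 0" "(\<integral>\<^sup>+t. ennreal (exp (- (t::real)\<^sup>2 / 2)) * indicator {0<..} t \<partial>lborel) = ennreal c1"
    by (rule gauss_integral_half_line)
  show ?thesis
  proof (rule that[of "c0 * c1"])
    show "c0 * c1 > 0" using c0 c1 by simp
    fix x y :: R3 assume xy: "x \<noteq> y"
    define a where "a = dist x y"
    have a: "a > 0" using xy by (simp add: a_def)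
    define m where "m = (1 / 2) *\<^sub>R (x + y)"
    \<comment> \<open>The parallelogram law around the midpoint m separates the centre z from the
      distance a.\<close>
    have par: "(norm (x - z))\<^sup>2 + (norm (y - z))\<^sup>2 = 2 * (norm (z - m))\<^sup>2 + a\<^sup>2 / 2" for z
      unfolding m_def a_def dist_norm power2_norm_eq_inner
      by (simp add: inner_diff_left inner_diff_right inner_add_left inner_add_right inner_commute field_simps)
    have inner: "(\<integral>\<^sup>+z. ennreal (gauss_weight t * exp (- t\<^sup>2 * (norm (x - z))\<^sup>2) * exp (- t\<^sup>2 * (norm (y - z))\<^sup>2)) \<partial>lborel)
        = ennreal (c0 * exp (- (a * t)\<^sup>2 / 2)) * indicator {0<..} t" for t
    proof (cases "t > 0")
      case True
      have eq: "gauss_weight t * exp (- t\<^sup>2 * (norm (x - z))\<^sup>2) * exp (- t\<^sup>2 * (norm (y - z))\<^sup>2)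
          = (t ^ 3 * exp (- (a * t)\<^sup>2 / 2)) * exp (- 2 * (norm (t *\<^sub>R (z - m)))\<^sup>2)" for z
      proof -
        have "- t\<^sup>2 * (norm (x - z))\<^sup>2 + - t\<^sup>2 * (norm (y - z))\<^sup>2 = - (a * t)\<^sup>2 / 2 + - 2 * (norm (t *\<^sub>R (z - m)))\<^sup>2"
          unfolding norm_scaleR power_mult_distrib power2_abs
          using arg_cong[OF par[of z], of "\<lambda>u. - t\<^sup>2 * u"] by (simp add: algebra_simps)
        then have "exp (- t\<^sup>2 * (norm (x - z))\<^sup>2) * exp (- t\<^sup>2 * (norm (y - z))\<^sup>2)
            = exp (- (a * t)\<^sup>2 / 2) * exp (- 2 * (norm (t *\<^sub>R (z - m)))\<^sup>2)"
          by (simp only: exp_add[symmetric])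
        then show ?thesis using True by (simp add: gauss_weight_def mult.assoc)
      qed
      \<comment> \<open>Rescaling by t around m uses up exactly the factor t^3 of
        \<open>gauss_weight\<close>.\<close>
      have "ennreal c0 = ennreal (t ^ DIM(R3)) * (\<integral>\<^sup>+z. ennreal (exp (- 2 * (norm (- (t *\<^sub>R m) + t *\<^sub>R z))\<^sup>2)) \<partial>lborel)"
        unfolding c0(2)[symmetric] by (rule nn_integral_lborel_affine[OF _ True]) measurable
      also have "\<dots> = ennreal (t ^ 3) * (\<integral>\<^sup>+z. ennreal (exp (- 2 * (norm (t *\<^sub>R (z - m)))\<^sup>2)) \<partial>lborel)"
        by (simp add: scaleR_diff_right)
      finally have sc: "ennreal (t ^ 3) * (\<integral>\<^sup>+z. ennreal (exp (- 2 * (norm (t *\<^sub>R (z - m)))\<^sup>2)) \<partial>lborel) = ennreal c0" ..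
      have "(\<integral>\<^sup>+z. ennreal ((t ^ 3 * exp (- (a * t)\<^sup>2 / 2)) * exp (- 2 * (norm (t *\<^sub>R (z - m)))\<^sup>2)) \<partial>lborel)
          = ennreal (t ^ 3 * exp (- (a * t)\<^sup>2 / 2)) * (\<integral>\<^sup>+z. ennreal (exp (- 2 * (norm (t *\<^sub>R (z - m)))\<^sup>2)) \<partial>lborel)"
        using True by (subst nn_integral_cmult[symmetric]) (auto simp: ennreal_mult)
      also have "\<dots> = ennreal (exp (- (a * t)\<^sup>2 / 2)) * (ennreal (t ^ 3) * (\<integral>\<^sup>+z. ennreal (exp (- 2 * (norm (t *\<^sub>R (z - m)))\<^sup>2)) \<partial>lborel))"
        using True by (simp add: ennreal_mult mult_ac)
      also have "\<dots> = ennreal (c0 * exp (- (a * t)\<^sup>2 / 2)) * indicator {0<..} t"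
        unfolding sc using c0(1) True by (simp add: ennreal_mult[symmetric] mult.commute)
      finally show ?thesis unfolding eq .
    next
      case False then show ?thesis by (simp add: gauss_weight_def)
    qed
    have "(\<integral>\<^sup>+q. ennreal (gauss_weight (fst q) * exp (- (fst q)\<^sup>2 * (norm (x - snd q))\<^sup>2)
        * exp (- (fst q)\<^sup>2 * (norm (y - snd q))\<^sup>2)) \<partial>(lborel \<Otimes>\<^sub>M lborel))
      = (\<integral>\<^sup>+t. (\<integral>\<^sup>+z. ennreal (gauss_weight t * exp (- t\<^sup>2 * (norm (x - z))\<^sup>2) * exp (- t\<^sup>2 * (norm (y - z))\<^sup>2)) \<partial>lborel) \<partial>lborel)"
      by (subst lborel.nn_integral_fst[symmetric]) auto
    also have "\<dots> = (\<integral>\<^sup>+t. ennreal c0 * (ennreal (exp (- (a * t)\<^sup>2 / 2)) * indicator {0<..} (a * t)) \<partial>lborel)"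
      unfolding inner using a c0(1) by (intro nn_integral_cong) (auto simp: indicator_def ennreal_mult zero_less_mult_iff)
    also have "\<dots> = ennreal c0 * (\<integral>\<^sup>+t. ennreal (exp (- (a * t)\<^sup>2 / 2)) * indicator {0<..} (a * t) \<partial>lborel)"
      by (subst nn_integral_cmult) auto
    also have "(\<integral>\<^sup>+t. ennreal (exp (- (a * t)\<^sup>2 / 2)) * indicator {0<..} (a * t) \<partial>lborel) = ennreal (c1 / a)"
    proof -
      define J where "J = (\<integral>\<^sup>+t. ennreal (exp (- (a * t)\<^sup>2 / 2)) * indicator {0<..} (a * t) \<partial>lborel)"
      \<comment> \<open>The one-dimensional rescaling by a produces the factor 1 / a, that is, the
        Newtonian kernel.\<close>
      have "ennreal c1 = ennreal (a ^ DIM(real)) * (\<integral>\<^sup>+t. ennreal (exp (- (0 + a *\<^sub>R t)\<^sup>2 / 2)) * indicator {0<..} (0 + a *\<^sub>R t) \<partial>lborel)"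
        unfolding c1(2)[symmetric] by (rule nn_integral_lborel_affine[OF _ a]) measurable
      then have "ennreal c1 = ennreal a * J" by (simp add: J_def)
      then have "ennreal (1 / a) * ennreal c1 = ennreal (1 / a) * ennreal a * J" by (simp add: mult.assoc)
      then have "ennreal (c1 / a) = J" using a c1(1) by (simp add: ennreal_mult[symmetric])
      then show ?thesis unfolding J_def ..
    qed
    also have "ennreal c0 * ennreal (c1 / a) = ennreal (c0 * c1 / dist x y)"
      using c0 c1 a by (simp add: ennreal_mult[symmetric] a_def)
    finally show "(\<integral>\<^sup>+q. ennreal (gauss_weight (fst q) * exp (- (fst q)\<^sup>2 * (norm (x - snd q))\<^sup>2)
        * exp (- (fst q)\<^sup>2 * (norm (y - snd q))\<^sup>2)) \<partial>(lborel \<Otimes>\<^sub>M lborel)) = ennreal (c0 * c1 / dist x y)" .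
  qed
qed

section \<open>The Coulomb energy is positive definite\<close>

abbreviation newton_pairing :: "(R3 \<Rightarrow> real) \<Rightarrow> (R3 \<Rightarrow> real) \<Rightarrow> R3 \<times> R3 \<Rightarrow> real" where
  "newton_pairing f g \<equiv> \<lambda>(x, y). f x * g y / dist x y"

abbreviation P3 :: "(R3 \<times> R3) measure" where "P3 \<equiv> lborel \<Otimes>\<^sub>M lborel"

interpretation gauss_pair: pair_sigma_finite P3 "lborel \<Otimes>\<^sub>M lborel :: (real \<times> R3) measure" ..

text \<open>The Gaussian formula for the kernel holds only off the diagonal; on it, division by zero
  makes the pairing 0. The diagonal is a null set.\<close>

lemma AE_P3_neq: "AE p in P3. fst p \<noteq> snd p"
proof (rule lborel_pair.AE_pair_measure)
  show "{p \<in> space P3. fst p \<noteq> snd p} \<in> sets P3" by measurable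
  show "AE x in lborel. AE y in lborel. fst (x, y) \<noteq> snd (x :: R3, y)"
  proof (rule AE_I2)
    fix x :: R3
    show "AE y in lborel. fst (x, y) \<noteq> snd (x, y)"
      using AE_lborel_neq[of x] by eventually_elim simp
  qed
qed

text \<open>Inserting the Gaussian superposition and exchanging integrals gives, for each parameter
  q, a nonnegative weight times the square of an integral of g against a Gaussian.\<close>

theorem newton_energy_nonneg:
  fixes g :: "R3 \<Rightarrow> real"
  assumes [measurable]: "g \<in> borel_measurable borel" and i: "integrable P3 (newton_pairing g g)"
  shows "0 \<le> (\<integral>p. newton_pairing g g p \<partial>P3)"
proof -
  obtain c where c: "c > 0" "\<And>x y :: R3. x \<noteq> y \<Longrightarrow> (\<integral>\<^sup>+q. ennreal (gauss_weight (fst q) * exp (- (fst q)\<^sup>2 * (norm (x - snd q))\<^sup>2)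
        * exp (- (fst q)\<^sup>2 * (norm (y - snd q))\<^sup>2)) \<partial>(lborel \<Otimes>\<^sub>M lborel)) = ennreal (c / dist x y)"
    by (rule gaussian_subordination) blast
  let ?Q = "lborel \<Otimes>\<^sub>M lborel :: (real \<times> R3) measure"
  define k where "k = (\<lambda>(p :: R3 \<times> R3) (q :: real \<times> R3). gauss_weight (fst q) * exp (- (fst q)\<^sup>2 * (norm (fst p - snd q))\<^sup>2)
        * exp (- (fst q)\<^sup>2 * (norm (snd p - snd q))\<^sup>2))"
  define F where "F = (\<lambda>p q. g (fst p) * g (snd p) * k p q)"
  have km [measurable]: "case_prod k \<in> borel_measurable (P3 \<Otimes>\<^sub>M ?Q)"
    unfolding k_def split_beta' by measurable
  have kpm [measurable]: "k p \<in> borel_measurable ?Q" for p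
    unfolding k_def by measurable
  have Fm [measurable]: "case_prod F \<in> borel_measurable (P3 \<Otimes>\<^sub>M ?Q)"
    unfolding F_def split_beta' using km[unfolded split_beta'] by measurable
  have k0: "k p q \<ge> 0" for p q unfolding k_def by (simp add: gauss_weight_nonneg)
  have kint: "(\<integral>\<^sup>+q. ennreal (k p q) \<partial>?Q) = ennreal (c / dist (fst p) (snd p))" if "fst p \<noteq> snd p" for p
    using c(2)[OF that] by (simp add: k_def)
  have kint': "integrable ?Q (k p)" "(\<integral>q. k p q \<partial>?Q) = c / dist (fst p) (snd p)" if "fst p \<noteq> snd p" for p
  proof -
    show *: "integrable ?Q (k p)"
      by (rule integrableI_nonneg) (use kint[OF that] k0 in auto)
    show "(\<integral>q. k p q \<partial>?Q) = c / dist (fst p) (snd p)"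
      using nn_integral_eq_integral[OF *] kint[OF that] k0 c(1) by (simp add: integral_nonneg_AE)
  qed
  \<comment> \<open>As g may change sign, the exchange rests on absolute integrability: since k is
    nonnegative, integrating |F| over q returns c times the absolute pairing, integrable by
    assumption.\<close>
  have Fi: "integrable (P3 \<Otimes>\<^sub>M ?Q) (case_prod F)"
  proof (rule gauss_pair.Fubini_integrable)
    show "AE p in P3. integrable ?Q (\<lambda>q. case_prod F (p, q))"
      using AE_P3_neq by eventually_elim (auto simp: F_def intro!: integrable_mult_right kint')
    have a1: "integrable P3 (\<lambda>p. c * norm (newton_pairing g g p))"
      using i by (intro integrable_mult_right integrable_norm)
    have a2: "AE p in P3. c * norm (newton_pairing g g p) = (\<integral>q. norm (F p q) \<partial>?Q)"
      using AE_P3_neq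
    proof eventually_elim
      fix p assume p: "fst p \<noteq> snd (p :: R3 \<times> R3)"
      have "(\<integral>q. norm (F p q) \<partial>?Q) = \<bar>g (fst p) * g (snd p)\<bar> * (\<integral>q. k p q \<partial>?Q)"
        by (subst integral_mult_right_zero[symmetric]) (simp add: F_def abs_mult k0)
      then show "c * norm (newton_pairing g g p) = (\<integral>q. norm (F p q) \<partial>?Q)"
        by (simp add: kint'(2)[OF p] split_beta abs_mult)
    qed
    have "(\<lambda>z. norm (case_prod F z)) = (\<lambda>(p, q). norm (F p q))" by (rule ext) (simp add: split_beta)
    then have a4: "(\<lambda>(p, q). norm (F p q)) \<in> borel_measurable (P3 \<Otimes>\<^sub>M ?Q)"
      using measurable_compose[OF Fm borel_measurable_norm] by metis
    have sf: "sigma_finite_measure ?Q"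
      using gauss_pair.pair_sigma_finite_axioms unfolding pair_sigma_finite_def by blast
    have a3: "(\<lambda>p. \<integral>q. norm (F p q) \<partial>?Q) \<in> borel_measurable P3"
      by (rule sigma_finite_measure.borel_measurable_lebesgue_integral[OF sf a4])
    show "integrable P3 (\<lambda>p. \<integral>q. norm (case_prod F (p, q)) \<partial>?Q)"
      using integrable_cong_AE_imp[OF a1 a3 a2] unfolding prod.case .
  qed auto
  have "c * (\<integral>p. newton_pairing g g p \<partial>P3) = (\<integral>p. c * newton_pairing g g p \<partial>P3)" by simp
  also have "\<dots> = (\<integral>p. (\<integral>q. F p q \<partial>?Q) \<partial>P3)"
  proof (rule integral_cong_AE)
    show "AE p in P3. c * newton_pairing g g p = (\<integral>q. F p q \<partial>?Q)"
      using AE_P3_neq by eventually_elim (simp add: F_def kint'(2) split_beta)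
  qed (use i in auto)
  also have "\<dots> = (\<integral>q. (\<integral>p. F p q \<partial>P3) \<partial>?Q)"
    by (rule gauss_pair.Fubini_integral[symmetric]) (use Fi in simp)
  also have "\<dots> \<ge> 0"
  proof (rule integral_nonneg_AE, rule AE_I2)
    fix q
    define a where "a = (\<lambda>x. g x * exp (- (fst q)\<^sup>2 * (norm (x - snd q))\<^sup>2))"
    have eq: "F p q = gauss_weight (fst q) * (a (fst p) * a (snd p))" for p
      by (simp add: F_def k_def a_def mult_ac)
    have "0 \<le> (\<integral>p. a (fst p) * a (snd p) \<partial>P3)"
    \<comment> \<open>A non-integrable product has Bochner integral 0, so that case is harmless;
      otherwise Fubini gives the square of the integral of a.\<close>
    proof (cases "integrable P3 (\<lambda>p. a (fst p) * a (snd p))")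
      case True
      have "(\<integral>p. a (fst p) * a (snd p) \<partial>P3) = (LBINT x. (LBINT y. a x * a y))"
        using lborel_pair.integral_fst'[OF True] by simp
      then show ?thesis by simp
    qed (simp add: not_integrable_integral_eq)
    then show "0 \<le> (\<integral>p. F p q \<partial>P3)" unfolding eq by (simp add: gauss_weight_nonneg)
  qed
  finally show ?thesis using c(1) by (simp add: zero_le_mult_iff)
qed

text \<open>The potential of |b| is bounded uniformly by \<open>newton_kernel_bound\<close>, so one
  integrable factor suffices.\<close>

lemma newton_pairing_integrable:
  assumes a: "integrable lborel a" and [measurable]: "b \<in> borel_measurable borel"
    and "\<And>x. \<bar>b x\<bar> \<le> M" "\<And>x. norm x > r \<Longrightarrow> b x = 0"
  shows "integrable P3 (newton_pairing a b)"
proof -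
  have [measurable]: "a \<in> borel_measurable borel" using a borel_measurable_integrable by auto
  obtain C where C: "\<And>x. (\<integral>\<^sup>+y. ennreal \<bar>b y / dist x y\<bar> \<partial>lborel) \<le> ennreal C"
    using newton_kernel_bound[OF assms(2-)] by blast
  have "(\<integral>\<^sup>+p. ennreal (norm (newton_pairing a b p)) \<partial>P3)
      = (\<integral>\<^sup>+x. (\<integral>\<^sup>+y. ennreal (norm (newton_pairing a b (x, y))) \<partial>lborel) \<partial>lborel)"
    by (rule lborel.nn_integral_fst[symmetric]) measurable
  also have "\<dots> = (\<integral>\<^sup>+x. ennreal \<bar>a x\<bar> * (\<integral>\<^sup>+y. ennreal \<bar>b y / dist x y\<bar> \<partial>lborel) \<partial>lborel)"
    by (intro nn_integral_cong) (subst nn_integral_cmult[symmetric], auto simp: abs_mult ennreal_mult[symmetric])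
  also have "\<dots> \<le> (\<integral>\<^sup>+x. ennreal \<bar>a x\<bar> * ennreal C \<partial>lborel)"
    by (intro nn_integral_mono mult_left_mono C) auto
  also have "\<dots> = (\<integral>\<^sup>+x. ennreal \<bar>a x\<bar> \<partial>lborel) * ennreal C"
    by (rule nn_integral_multc) measurable
  also have "\<dots> < \<infinity>"
    using a by (auto simp: integrable_iff_bounded ennreal_mult_less_top)
  finally show ?thesis by (intro integrableI_bounded) measurable
qed

context C2_compact begin

text \<open>With f = - lap, the representation of W as a potential turns the pairing of \<rho> with
  f into 4 pi times the integral of \<rho> W, and that of f with itself into 4 pi times the
  Dirichlet integral.\<close>

theorem coulomb_duality:
  assumes \<rho>: "integrable lborel \<rho>" and \<rho>\<rho>: "integrable P3 (newton_pairing \<rho> \<rho>)" and t: "t > 0"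
  shows "(LBINT x. \<rho> x * W x) \<le> t * (\<Sum>i\<in>UNIV. LBINT x. (partial i W x)\<^sup>2)
      + (\<integral>p. newton_pairing \<rho> \<rho> p \<partial>P3) / (16 * pi * t)"
proof -
  have [measurable]: "\<rho> \<in> borel_measurable borel" using \<rho> borel_measurable_integrable by auto
  define f where "f = (\<lambda>x. - lap x)"
  have fm [measurable]: "f \<in> borel_measurable borel" unfolding f_def by measurable
  have fb: "\<bar>f x\<bar> \<le> 3 * M" and fs: "norm x > r \<Longrightarrow> f x = 0" for x
    using lap_bound lap_support by (auto simp: f_def)
  have fi: "integrable lborel f" using lap_integrable by (simp add: f_def)
  have \<rho>f: "integrable P3 (newton_pairing \<rho> f)" by (rule newton_pairing_integrable[OF \<rho> fm fb fs])
  have ff: "integrable P3 (newton_pairing f f)" by (rule newton_pairing_integrable[OF fi fm fb fs])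
  have sw: "(\<lambda>(x, y). newton_pairing \<rho> f (y, x)) = newton_pairing f \<rho>"
    by (auto simp: fun_eq_iff dist_commute)
  have f\<rho>: "integrable P3 (newton_pairing f \<rho>)"
    using lborel_pair.integrable_product_swap[OF \<rho>f] unfolding sw .
  have f\<rho>_eq: "(\<integral>p. newton_pairing f \<rho> p \<partial>P3) = (\<integral>p. newton_pairing \<rho> f p \<partial>P3)"
    using lborel_pair.integral_product_swap[OF borel_measurable_integrable[OF \<rho>f]] unfolding sw .
  have rep: "(\<integral>p. newton_pairing a f p \<partial>P3) = 4 * pi * (LBINT x. a x * W x)"
    if "integrable P3 (newton_pairing a f)" for a
  proof -
    have "(\<integral>p. newton_pairing a f p \<partial>P3) = (LBINT x. (LBINT y. a x * (f y / dist x y)))"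
      using lborel_pair.integral_fst'[OF that] by simp
    also have "\<dots> = (LBINT x. a x * (4 * pi * W x))"
      using newton_representation by (simp only: integral_mult_right_zero f_def)
    also have "\<dots> = (LBINT x. 4 * pi * (a x * W x))" by (simp add: mult_ac)
    finally show ?thesis by simp
  qed
  \<comment> \<open>With sc = 2t, nonnegativity of the energy of \<rho> - sc f reads 0 \<le> A - 16
    pi t B + 16 pi t^2 E, and division by 16 pi t gives the claim.\<close>
  define sc where "sc = 2 * t"
  define A B E where "A = (\<integral>p. newton_pairing \<rho> \<rho> p \<partial>P3)" and "B = (LBINT x. \<rho> x * W x)"
    and "E = (\<Sum>i\<in>UNIV. LBINT x. (partial i W x)\<^sup>2)"
  have exp: "newton_pairing (\<lambda>x. \<rho> x - sc * f x) (\<lambda>x. \<rho> x - sc * f x) = (\<lambda>p. newton_pairing \<rho> \<rho> p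
      - sc * newton_pairing \<rho> f p - sc * newton_pairing f \<rho> p + sc\<^sup>2 * newton_pairing f f p)"
    by (auto simp: fun_eq_iff diff_divide_distrib[symmetric] add_divide_distrib[symmetric] power2_eq_square algebra_simps)
  have "0 \<le> (\<integral>p. newton_pairing (\<lambda>x. \<rho> x - sc * f x) (\<lambda>x. \<rho> x - sc * f x) p \<partial>P3)"
    by (rule newton_energy_nonneg) (measurable, unfold exp, use \<rho>\<rho> \<rho>f f\<rho> ff in simp)
  also have "\<dots> = A - sc * (4 * pi * B) - sc * (4 * pi * B) + sc\<^sup>2 * (4 * pi * E)"
  proof -
    have "(LBINT x. f x * W x) = E" using dirichlet(2) by (simp add: f_def E_def)
    then show ?thesis
      unfolding exp using \<rho>\<rho> \<rho>f f\<rho> ff by (simp add: f\<rho>_eq rep[OF \<rho>f] rep[OF ff] A_def B_def)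
  qed
  finally have "16 * pi * t * B \<le> A + 16 * pi * t * (t * E)"
    by (simp add: sc_def power2_eq_square algebra_simps)
  then have "B \<le> t * E + A / (16 * pi * t)" using t by (simp add: field_simps)
  then show ?thesis by (simp add: A_def B_def E_def)
qed

end

section \<open>Hardy-type and cubic inequalities\<close>

lemma test_fun_C2_compact:
  assumes w: "test_fun w"
  obtains M r where "C2_compact w M r"
proof -
  have "\<exists>M. \<forall>j x. \<bar>partial j (partial i w) x\<bar> \<le> M" for i
    by (rule test_fun_partials_bounded[OF test_fun_partial[OF w], of i]) blast
  then obtain M where M: "\<And>i j x. \<bar>partial j (partial i w) x\<bar> \<le> M i" by metis
  obtain r where r: "\<And>x. norm x > r \<Longrightarrow> w x = 0" using test_fun_support[OF w] by blast
  have "\<bar>partial i (partial i w) x\<bar> \<le> Max (range M)" for i x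
    using M[of i i x] by (rule order_trans) auto
  then have "C2_compact w (Max (range M)) r"
    using test_fun_differentiable[OF w] test_fun_differentiable[OF test_fun_partial[OF w]] r
    by unfold_locales
  then show ?thesis by (rule that)
qed

text \<open>Subtracting d makes the function vanish wherever w does, so compact support is kept. It
  is nonnegative, differentiable also at zeros of w, and its partials do not exceed those of w in
  size.\<close>

definition soft_abs :: "real \<Rightarrow> (R3 \<Rightarrow> real) \<Rightarrow> R3 \<Rightarrow> real" where
  "soft_abs d w x = sqrt (d\<^sup>2 + (w x)\<^sup>2) - d"

context
  fixes w :: "R3 \<Rightarrow> real" and d :: real
  assumes w: "test_fun w" and d: "d > 0"
begin

lemma soft_abs_arg_pos: "0 < d\<^sup>2 + (w x)\<^sup>2" using d by (simp add: add_pos_nonneg)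

lemma soft_abs_partial:
  "soft_abs d w differentiable (at x)"
  "partial i (soft_abs d w) x = w x * partial i w x * (1 / sqrt (d\<^sup>2 + (w x)\<^sup>2))"
proof -
  have h: "((\<lambda>t. sqrt (d\<^sup>2 + t\<^sup>2) - d) has_real_derivative w x * (1 / sqrt (d\<^sup>2 + (w x)\<^sup>2))) (at (w x))"
    using soft_abs_arg_pos[of x] by (auto intro!: derivative_eq_intros simp: inverse_eq_divide)
  show "soft_abs d w differentiable (at x)"
    unfolding soft_abs_def[abs_def] by (rule partial_chain(2)[OF test_fun_differentiable[OF w] h])
  show "partial i (soft_abs d w) x = w x * partial i w x * (1 / sqrt (d\<^sup>2 + (w x)\<^sup>2))"
    unfolding soft_abs_def[abs_def] partial_chain(1)[OF test_fun_differentiable[OF w] h] by simp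
qed

lemma soft_abs_nonneg: "soft_abs d w x \<ge> 0"
  unfolding soft_abs_def by (simp add: real_le_rsqrt)

lemma soft_abs_partial_le: "(partial i (soft_abs d w) x)\<^sup>2 \<le> (partial i w x)\<^sup>2"
proof -
  have "\<bar>w x\<bar> \<le> sqrt (d\<^sup>2 + (w x)\<^sup>2)" by (rule real_le_rsqrt) simp
  then have "\<bar>w x\<bar> * (1 / sqrt (d\<^sup>2 + (w x)\<^sup>2)) \<le> 1" using soft_abs_arg_pos[of x] by (simp add: divide_le_eq)
  then have "\<bar>partial i w x\<bar> * (\<bar>w x\<bar> * (1 / sqrt (d\<^sup>2 + (w x)\<^sup>2))) \<le> \<bar>partial i w x\<bar>"
    by (intro mult_right_le_one_le) auto
  then have "\<bar>partial i (soft_abs d w) x\<bar> \<le> \<bar>partial i w x\<bar>"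
    using soft_abs_arg_pos[of x] by (simp add: soft_abs_partial(2) abs_mult mult_ac)
  then show ?thesis by (simp add: abs_le_square_iff)
qed

lemma soft_abs_C2_compact: obtains M r where "C2_compact (soft_abs d w) M r"
proof -
  obtain r where r: "\<And>x. norm x > r \<Longrightarrow> w x = 0" using test_fun_support[OF w] by blast
  let ?q = "\<lambda>x. 1 / sqrt (d\<^sup>2 + (w x)\<^sup>2)"
  note wd = test_fun_differentiable[OF w] and pd = test_fun_differentiable[OF test_fun_partial[OF w]]
  have h: "((\<lambda>t. 1 / sqrt (d\<^sup>2 + t\<^sup>2)) has_real_derivative - w x * (?q x) ^ 3) (at (w x))" for x
  proof -
    define u where "u = sqrt (d\<^sup>2 + (w x)\<^sup>2)"
    have u: "u > 0" using soft_abs_arg_pos[of x] by (simp add: u_def)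
    have "((\<lambda>t. sqrt (d\<^sup>2 + t\<^sup>2)) has_real_derivative w x / u) (at (w x))"
      using soft_abs_arg_pos[of x] by (auto intro!: derivative_eq_intros simp: u_def inverse_eq_divide)
    then have "((\<lambda>t. inverse (sqrt (d\<^sup>2 + t\<^sup>2))) has_real_derivative - (inverse u * (w x / u) * inverse u)) (at (w x))"
      using u unfolding u_def by (intro DERIV_inverse') auto
    then show ?thesis unfolding u_def[symmetric] inverse_eq_divide by (simp add: power3_eq_cube mult_ac)
  qed
  note qd = partial_chain(2)[OF wd h] and qp = partial_chain(1)[OF wd h]
  note wpd = differentiable_mult[OF wd pd]
  have P: "partial i (soft_abs d w) = (\<lambda>x. w x * partial i w x * ?q x)" for i
    using soft_abs_partial(2) by (rule ext)
  have P2: "partial i (\<lambda>x. w x * partial i w x * ?q x) = (\<lambda>x. (partial i w x * partial i w x + w x * partial i (partial i w) x) * ?q x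
      + w x * partial i w x * ((- w x * (?q x) ^ 3) * partial i w x))" for i
    unfolding fun_eq_iff partial_mult[OF wpd qd] partial_mult[OF wd pd] qp by simp
  have cw: "continuous_on UNIV w" "continuous_on UNIV (partial i w)" "continuous_on UNIV (partial i (partial i w))" for i
    by (intro test_fun_continuous test_fun_partial w)+
  have cq: "continuous_on UNIV ?q"
    by (rule differentiable_continuous_UNIV) (rule qd)
  have "\<exists>K. \<forall>x. \<bar>partial i (partial i (soft_abs d w)) x\<bar> \<le> K" for i
  proof -
    have "continuous_on UNIV (partial i (partial i (soft_abs d w)))"
      unfolding P P2 by (intro continuous_intros cw cq)
    moreover have "partial i (partial i (soft_abs d w)) x = 0" if "norm x > r" for x
      unfolding P P2 using r[OF that] partial_zero_outside[OF r that] by simp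
    ultimately show ?thesis using continuous_bounded_support by metis
  qed
  then obtain K where K: "\<And>i x. \<bar>partial i (partial i (soft_abs d w)) x\<bar> \<le> K i" by metis
  have "C2_compact (soft_abs d w) (Max (range K)) r"
  proof
    show "soft_abs d w differentiable (at x)" for x by (rule soft_abs_partial(1))
    show "partial i (soft_abs d w) differentiable (at x)" for i x
      unfolding P by (rule differentiable_mult[OF wpd qd])
    show "\<bar>partial i (partial i (soft_abs d w)) x\<bar> \<le> Max (range K)" for i x
      using K[of i x] by (rule order_trans) auto
    show "soft_abs d w x = 0" if "norm x > r" for x using r[OF that] d by (simp add: soft_abs_def)
  qed
  then show ?thesis by (rule that)
qed

end

text \<open>Fatou's lemma in the form used for the limits in the inequalities for u: a.e.
  convergence of the integrands and convergent upper bounds for their integrals.\<close>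

lemma nn_integral_limit_le:
  fixes f :: "nat \<Rightarrow> 'a \<Rightarrow> real"
  assumes [measurable]: "\<And>n. f n \<in> borel_measurable M"
    and lim: "AE x in M. (\<lambda>n. f n x) \<longlonglongrightarrow> g x"
    and le: "\<And>n. (\<integral>\<^sup>+x. ennreal (f n x) \<partial>M) \<le> ennreal (B n)" and B: "B \<longlonglongrightarrow> b"
  shows "(\<integral>\<^sup>+x. ennreal (g x) \<partial>M) \<le> ennreal b"
proof -
  have "(\<integral>\<^sup>+x. ennreal (g x) \<partial>M) \<le> (\<integral>\<^sup>+x. liminf (\<lambda>n. ennreal (f n x)) \<partial>M)"
  proof (rule nn_integral_mono_AE)
    show "AE x in M. ennreal (g x) \<le> liminf (\<lambda>n. ennreal (f n x))"
      using lim
    proof eventually_elim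
      fix x assume "(\<lambda>n. f n x) \<longlonglongrightarrow> g x"
      then have "(\<lambda>n. ennreal (f n x)) \<longlonglongrightarrow> ennreal (g x)" by (rule tendsto_ennrealI)
      then show "ennreal (g x) \<le> liminf (\<lambda>n. ennreal (f n x))"
        by (simp add: lim_imp_Liminf[OF sequentially_bot])
    qed
  qed
  also have "\<dots> \<le> liminf (\<lambda>n. \<integral>\<^sup>+x. ennreal (f n x) \<partial>M)"
    by (rule nn_integral_liminf) measurable
  also have "\<dots> \<le> liminf (\<lambda>n. ennreal (B n))"
    by (intro Liminf_mono always_eventually allI le)
  also have "\<dots> = ennreal b"
    by (rule lim_imp_Liminf[OF sequentially_bot tendsto_ennrealI[OF B]])
  finally show ?thesis .
qed

lemma test_fun_power_integrable:
  assumes w: "test_fun w" and n: "n > 0"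
  shows "integrable lborel (\<lambda>x. (w x) ^ n)"
proof -
  obtain B where B: "\<And>x. \<bar>w x\<bar> \<le> B" using test_fun_bounded[OF w] by blast
  obtain r where r: "\<And>x. norm x > r \<Longrightarrow> w x = 0" using test_fun_support[OF w] by blast
  have [measurable]: "w \<in> borel_measurable borel" by (rule test_fun_measurable[OF w])
  show ?thesis
    by (rule integrable_bounded_support[of _ "B ^ n" r]) (use B r n in \<open>auto simp: power_abs intro: power_mono\<close>)
qed

section \<open>A Hardy-type inequality for the Newtonian potential of a square\<close>

context C2_compact begin

lemma square_integrable: "integrable lborel (\<lambda>y. (W y)\<^sup>2)"
proof -
  obtain B where B: "\<And>x. \<bar>W x\<bar> \<le> B" by (rule W_bounded) blast
  have "integrable lborel (\<lambda>y. W y * W y)"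
    by (rule integrable_mult_bounded[OF W_integrable _ B]) simp
  then show ?thesis by (simp add: power2_eq_square)
qed

text \<open>The field a = (y - x) / s has |a| \<le> 1 and divergence (3 - |a|^2) / s \<ge> 2 / s.
  The divergence of W^2 a integrates to 0, and its cross term is at least -(W^2 |a|^2 + |grad W|^2)
  by completing a square.\<close>

lemma hardy_regularised:
  assumes e: "e > 0"
  shows "integrable lborel (\<lambda>y. (W y)\<^sup>2 / s x e y)"
    and "2 * (LBINT y. (W y)\<^sup>2 / s x e y)
      \<le> (LBINT y. (W y)\<^sup>2) + (\<Sum>i\<in>UNIV. LBINT y. (partial i W y)\<^sup>2)"
proof -
  define a where "a = (\<lambda>i y. (y $ i - x $ i) / s x e y)"
  \<comment> \<open>\<open>D i\<close> is the i-th partial of W^2 times \<open>a i\<close>, so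
    summing over i gives the divergence of W^2 a.\<close>
  define D where "D = (\<lambda>i y. 2 * W y * partial i W y * a i y + (W y)\<^sup>2 * ((1 - (a i y)\<^sup>2) / s x e y))"
  have [measurable]: "s x e \<in> borel_measurable borel" by (rule s_measurable[OF e])
  note sk = kernel_partials[OF e, where x = x]
  have sp: "0 < s x e y" and se: "e \<le> s x e y" for y by (rule s_ge[OF e])+
  have "\<bar>1 / s x e y\<bar> \<le> 1 / e" for y using sp[of y] se[of y] e by (simp add: frac_le)
  then have "integrable lborel (\<lambda>y. (W y)\<^sup>2 * (1 / s x e y))"
    by (intro integrable_mult_bounded[OF square_integrable]) auto
  then show i: "integrable lborel (\<lambda>y. (W y)\<^sup>2 / s x e y)" by simp
  have ab: "\<bar>a i y\<bar> \<le> 1" for i y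
    using component_le_norm_cart[of "y - x" i] s_ge(2)[OF e, of y x] sp[of y] by (simp add: a_def divide_le_eq)
  have aa: "(\<Sum>i\<in>UNIV. (a i y)\<^sup>2) \<le> 1" for y
  proof -
    have "(\<Sum>i\<in>UNIV. (a i y)\<^sup>2) = (norm (y - x))\<^sup>2 / (s x e y)\<^sup>2"
      unfolding power2_norm_eq_inner by (simp add: a_def power_divide inner_vec_def sum_divide_distrib power2_eq_square)
    also have "\<dots> \<le> 1"
    proof -
      have "(norm (y - x))\<^sup>2 \<le> (s x e y)\<^sup>2" using s_square[OF e, of x y] by simp
      then show ?thesis using sp[of y] by (intro divide_le_eq_1_pos[THEN iffD2]) auto
    qed
    finally show ?thesis .
  qed
  have ad: "a i differentiable (at y)" and ap: "partial i (a i) y = (1 - (a i y)\<^sup>2) / s x e y" for i y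
  proof -
    have d: "(\<lambda>y::R3. y $ i - x $ i) differentiable (at y)" by (intro differentiable_diff) auto
    have p: "partial i (\<lambda>y. y $ i - x $ i) y = 1" by (simp add: partial_diff)
    have eq: "a i = (\<lambda>y. (y $ i - x $ i) * (1 / s x e y))" by (auto simp: a_def)
    show "a i differentiable (at y)" unfolding eq by (rule differentiable_mult[OF d sk(1)])
    have "partial i (a i) y = 1 / s x e y + (y $ i - x $ i) * (- (y $ i - x $ i) / s x e y ^ 3)"
      unfolding eq partial_mult[OF d sk(1)] p sk(2) by simp
    also have "\<dots> = (1 - (a i y)\<^sup>2) / s x e y"
    proof -
      have "1 / t + u * (- u / t ^ 3) = (1 - (u / t)\<^sup>2) / t" if "t > 0" for t u :: real
        using that by (simp add: field_simps power2_eq_square power3_eq_cube)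
      from this[OF sp] show ?thesis unfolding a_def .
    qed
    finally show "partial i (a i) y = (1 - (a i y)\<^sup>2) / s x e y" .
  qed
  obtain B where B: "\<And>x. \<bar>W x\<bar> \<le> B" by (rule W_bounded) blast
  have D0: "integrable lborel (D i)" "(LBINT y. D i y) = 0" for i
  proof -
    obtain B' where B': "\<And>x. \<bar>partial i W x\<bar> \<le> B'" by (rule partial_bounded) blast
    let ?g = "\<lambda>y. W y * W y * a i y"
    have WW: "(\<lambda>y. W y * W y) differentiable (at y)" for y by (rule differentiable_mult[OF d1 d1])
    have p: "partial i ?g = D i"
      unfolding fun_eq_iff partial_mult[OF WW ad] partial_mult[OF d1 d1] ap D_def
      by (simp add: power2_eq_square algebra_simps)
    have gd: "?g differentiable (at y)" for y by (rule differentiable_mult[OF WW ad])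
    have b: "\<bar>partial i ?g y\<bar> \<le> 2 * B * B' * 1 + B\<^sup>2 * (1 / e)" for y
    proof -
      have "0 \<le> 1 - (a i y)\<^sup>2" using ab[of i y] by (simp add: abs_square_le_1)
      then have q: "\<bar>(1 - (a i y)\<^sup>2) / s x e y\<bar> \<le> 1 / e"
        using sp[of y] se[of y] e by (simp add: frac_le)
      have "\<bar>(W y)\<^sup>2\<bar> \<le> B\<^sup>2" using B[of y] by (simp add: abs_le_square_iff[symmetric])
      with q have 2: "\<bar>(W y)\<^sup>2 * ((1 - (a i y)\<^sup>2) / s x e y)\<bar> \<le> B\<^sup>2 * (1 / e)"
        unfolding abs_mult by (intro mult_mono') auto
      have 1: "\<bar>2 * W y * partial i W y * a i y\<bar> \<le> 2 * B * B' * 1"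
        unfolding abs_mult using B[of y] B'[of y] ab[of i y] by (intro mult_mono') auto
      from 1 2 show ?thesis unfolding p D_def by linarith
    qed
    have z: "?g y = 0" if "norm y > r" for y using support[OF that] by simp
    from integral_partial_eq_0[OF gd b z] show "integrable lborel (D i)" "(LBINT y. D i y) = 0"
      unfolding p by auto
  qed
  have pt: "2 * ((W y)\<^sup>2 / s x e y) \<le> (\<Sum>i\<in>UNIV. D i y) + ((W y)\<^sup>2 + (\<Sum>i\<in>UNIV. (partial i W y)\<^sup>2))" for y
  proof -
    have c: "- ((W y)\<^sup>2 * (a i y)\<^sup>2 + (partial i W y)\<^sup>2) \<le> 2 * W y * partial i W y * a i y" for i
      using zero_le_power2[of "W y * a i y + partial i W y"] by (simp add: power2_eq_square algebra_simps)
    have "(\<Sum>i\<in>UNIV. D i y) = (\<Sum>i\<in>UNIV. 2 * W y * partial i W y * a i y)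
        + (W y)\<^sup>2 * ((3 - (\<Sum>i\<in>UNIV. (a i y)\<^sup>2)) / s x e y)"
      unfolding D_def by (simp add: sum.distrib sum_distrib_left[symmetric] sum_divide_distrib[symmetric] sum_subtractf)
    moreover have "(\<Sum>i\<in>UNIV. 2 * W y * partial i W y * a i y) \<ge> (\<Sum>i\<in>UNIV. - ((W y)\<^sup>2 * (a i y)\<^sup>2 + (partial i W y)\<^sup>2))"
      by (rule sum_mono) (rule c)
    moreover have "(\<Sum>i\<in>UNIV. - ((W y)\<^sup>2 * (a i y)\<^sup>2 + (partial i W y)\<^sup>2))
        = - ((W y)\<^sup>2 * (\<Sum>i\<in>UNIV. (a i y)\<^sup>2)) - (\<Sum>i\<in>UNIV. (partial i W y)\<^sup>2)"
      by (simp add: sum_negf sum.distrib sum_distrib_left sum_subtractf)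
    moreover have "(W y)\<^sup>2 * (\<Sum>i\<in>UNIV. (a i y)\<^sup>2) \<le> (W y)\<^sup>2"
      using aa[of y] by (intro mult_right_le_one_le sum_nonneg) auto
    moreover have "2 * ((W y)\<^sup>2 / s x e y) \<le> (W y)\<^sup>2 * ((3 - (\<Sum>i\<in>UNIV. (a i y)\<^sup>2)) / s x e y)"
    proof -
      have "(W y)\<^sup>2 * (2 / s x e y) \<le> (W y)\<^sup>2 * ((3 - (\<Sum>i\<in>UNIV. (a i y)\<^sup>2)) / s x e y)"
        using aa[of y] sp[of y] by (intro mult_left_mono divide_right_mono) auto
      then show ?thesis by simp
    qed
    ultimately show ?thesis by linarith
  qed
  have iD: "integrable lborel (\<lambda>y. \<Sum>i\<in>UNIV. D i y)" "integrable lborel (\<lambda>y. \<Sum>i\<in>UNIV. (partial i W y)\<^sup>2)"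
    using D0(1) dirichlet(1) by auto
  have "(LBINT y. 2 * ((W y)\<^sup>2 / s x e y))
      \<le> (LBINT y. (\<Sum>i\<in>UNIV. D i y) + ((W y)\<^sup>2 + (\<Sum>i\<in>UNIV. (partial i W y)\<^sup>2)))"
  proof (rule integral_mono[OF _ _ pt])
    show "integrable lborel (\<lambda>y. 2 * ((W y)\<^sup>2 / s x e y))"
      by (intro integrable_mult_right i)
    show "integrable lborel (\<lambda>y. (\<Sum>i\<in>UNIV. D i y) + ((W y)\<^sup>2 + (\<Sum>i\<in>UNIV. (partial i W y)\<^sup>2)))"
      using iD square_integrable by (intro Bochner_Integration.integrable_add)
  qed
  also have "\<dots> = (LBINT y. (W y)\<^sup>2) + (\<Sum>i\<in>UNIV. LBINT y. (partial i W y)\<^sup>2)"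
    using iD square_integrable D0 dirichlet(1) by simp
  finally show "2 * (LBINT y. (W y)\<^sup>2 / s x e y)
      \<le> (LBINT y. (W y)\<^sup>2) + (\<Sum>i\<in>UNIV. LBINT y. (partial i W y)\<^sup>2)" 
    unfolding integral_mult_right_zero .
qed

lemma hardy:
  "(\<integral>\<^sup>+y. ennreal ((W y)\<^sup>2 / dist x y) \<partial>lborel)
    \<le> ennreal (((LBINT y. (W y)\<^sup>2) + (\<Sum>i\<in>UNIV. LBINT y. (partial i W y)\<^sup>2)) / 2)"
proof (rule nn_integral_limit_le)
  define e where "e n = 1 / real (Suc n)" for n
  have e0: "e n > 0" for n by (simp add: e_def)
  have el: "e \<longlonglongrightarrow> 0" unfolding e_def[abs_def] by (rule LIMSEQ_Suc[OF lim_1_over_n])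
  have sm [measurable]: "s x (e n) \<in> borel_measurable borel" for n by (rule s_measurable[OF e0])
  show "(\<lambda>y. (W y)\<^sup>2 / s x (e n) y) \<in> borel_measurable lborel" for n by measurable
  show "AE y in lborel. (\<lambda>n. (W y)\<^sup>2 / s x (e n) y) \<longlonglongrightarrow> (W y)\<^sup>2 / dist x y"
    using AE_lborel_neq[of x]
  proof eventually_elim
    fix y assume y: "y \<noteq> x"
    have "(\<lambda>n. s x (e n) y) \<longlonglongrightarrow> sqrt (0\<^sup>2 + (norm (y - x))\<^sup>2)"
      unfolding s_def[OF e0] by (intro tendsto_intros el)
    then have "(\<lambda>n. s x (e n) y) \<longlonglongrightarrow> dist x y" by (simp add: dist_norm norm_minus_commute)
    then show "(\<lambda>n. (W y)\<^sup>2 / s x (e n) y) \<longlonglongrightarrow> (W y)\<^sup>2 / dist x y"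
      using y by (intro tendsto_intros) auto
  qed
  show "(\<integral>\<^sup>+y. ennreal ((W y)\<^sup>2 / s x (e n) y) \<partial>lborel)
     \<le> ennreal (((LBINT y. (W y)\<^sup>2) + (\<Sum>i\<in>UNIV. LBINT y. (partial i W y)\<^sup>2)) / 2)" for n
  proof -
    have nn: "0 \<le> (W y)\<^sup>2 / s x (e n) y" for y
      by (intro divide_nonneg_pos s_ge(3)[OF e0]) simp
    show ?thesis
      using hardy_regularised(2)[OF e0, of x n]
      by (subst nn_integral_eq_integral[OF hardy_regularised(1)[OF e0] AE_I2[OF nn]]) (auto intro!: ennreal_leI)
  qed
qed (rule tendsto_const)

end

section \<open>Hardy, Coulomb and Sobolev bounds for the H^1 function itself\<close>

context sobolev_borel begin

definition G :: real where "G = (\<Sum>i\<in>UNIV. LBINT x. (g i x)\<^sup>2)"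
definition N :: real where "N = (LBINT x. (u x)\<^sup>2)"
text \<open>The Coulomb energy with kernel 1 / |x - y|, without the 1 / (4 pi) of
  \<open>phi\<close>; the D of the overview is A / (4 pi).\<close>

definition A :: real where "A = (\<integral>p. newton_pairing (\<lambda>x. (u x)\<^sup>2) (\<lambda>x. (u x)\<^sup>2) p \<partial>P3)"

lemma G_nonneg: "G \<ge> 0"
  unfolding G_def by (intro sum_nonneg integral_nonneg_AE) auto

lemma hardy: "(\<integral>\<^sup>+y. ennreal ((u y)\<^sup>2 / dist x y) \<partial>lborel) \<le> ennreal ((N + G) / 2)"
proof -
  obtain w a where w: "\<And>n. test_fun (w n)" "AE x in lborel. (\<lambda>n. w n x) \<longlonglongrightarrow> u x"
    "\<And>n. (LBINT x. (w n x)\<^sup>2) \<le> (LBINT x. (u x)\<^sup>2)"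
    "\<And>n. (\<Sum>i\<in>UNIV. LBINT x. (partial i (w n) x)\<^sup>2) \<le> a n"
    "a \<longlonglongrightarrow> (\<Sum>i\<in>UNIV. LBINT x. (g i x)\<^sup>2)"
    by (rule smooth_approximation) blast
  have [measurable]: "w n \<in> borel_measurable borel" for n by (rule test_fun_measurable[OF w(1)])
  show ?thesis
  proof (rule nn_integral_limit_le)
    show "(\<lambda>y. (w n y)\<^sup>2 / dist x y) \<in> borel_measurable lborel" for n by measurable
    show "AE y in lborel. (\<lambda>n. (w n y)\<^sup>2 / dist x y) \<longlonglongrightarrow> (u y)\<^sup>2 / dist x y"
      using w(2) AE_lborel_neq[of x] by eventually_elim (auto intro!: tendsto_intros)
    show "(\<integral>\<^sup>+y. ennreal ((w n y)\<^sup>2 / dist x y) \<partial>lborel) \<le> ennreal ((N + a n) / 2)" for n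
    proof -
      obtain M r where "C2_compact (w n) M r" by (rule test_fun_C2_compact[OF w(1)])
      from C2_compact.hardy[OF this, of x] show ?thesis
        by (rule order_trans) (use w(3)[of n] w(4)[of n] in \<open>auto simp: N_def intro!: ennreal_leI\<close>)
    qed
    show "(\<lambda>n. (N + a n) / 2) \<longlonglongrightarrow> (N + G) / 2"
      using w(5) unfolding G_def by (intro tendsto_intros) auto
  qed
qed

text \<open>The Hardy bound controls the inner integral uniformly in x, so the energy is at most N
  (N + G) / 2. Finiteness makes A the true energy and not the default value of a divergent
  integral.\<close>

lemma coulomb_integrable: "integrable P3 (newton_pairing (\<lambda>x. (u x)\<^sup>2) (\<lambda>x. (u x)\<^sup>2))"
proof -
  have "(\<integral>\<^sup>+p. ennreal (norm (newton_pairing (\<lambda>x. (u x)\<^sup>2) (\<lambda>x. (u x)\<^sup>2) p)) \<partial>P3)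
      = (\<integral>\<^sup>+x. (\<integral>\<^sup>+y. ennreal (norm (newton_pairing (\<lambda>x. (u x)\<^sup>2) (\<lambda>x. (u x)\<^sup>2) (x, y))) \<partial>lborel) \<partial>lborel)"
    by (rule lborel.nn_integral_fst[symmetric]) measurable
  also have "\<dots> = (\<integral>\<^sup>+x. ennreal ((u x)\<^sup>2) * (\<integral>\<^sup>+y. ennreal ((u y)\<^sup>2 / dist x y) \<partial>lborel) \<partial>lborel)"
    by (intro nn_integral_cong) (subst nn_integral_cmult[symmetric], auto simp: ennreal_mult[symmetric])
  also have "\<dots> \<le> (\<integral>\<^sup>+x. ennreal ((u x)\<^sup>2) * ennreal ((N + G) / 2) \<partial>lborel)"
    by (intro nn_integral_mono mult_left_mono hardy) auto
  also have "\<dots> = (\<integral>\<^sup>+x. ennreal ((u x)\<^sup>2) \<partial>lborel) * ennreal ((N + G) / 2)"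
    by (rule nn_integral_multc) measurable
  also have "\<dots> < \<infinity>"
    using u2 by (auto simp: integrable_iff_bounded ennreal_mult_less_top)
  finally show ?thesis by (intro integrableI_bounded) measurable
qed

text \<open>The density u^2 is kept fixed and only the factor |u| is approximated, by
  \<open>soft_abs\<close> of test functions with parameter tending to 0. Hence the energy A on the
  right needs no limit of its own, and Fatou's lemma handles the left side.\<close>

theorem cubic_bound:
  assumes t: "t > 0"
  shows "(\<integral>\<^sup>+x. ennreal (\<bar>u x\<bar> ^ 3) \<partial>lborel) \<le> ennreal (t * G + A / (16 * pi * t))"
proof -
  obtain w a where w: "\<And>n. test_fun (w n)" "AE x in lborel. (\<lambda>n. w n x) \<longlonglongrightarrow> u x"
    "\<And>n. (LBINT x. (w n x)\<^sup>2) \<le> (LBINT x. (u x)\<^sup>2)"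
    "\<And>n. (\<Sum>i\<in>UNIV. LBINT x. (partial i (w n) x)\<^sup>2) \<le> a n"
    "a \<longlonglongrightarrow> (\<Sum>i\<in>UNIV. LBINT x. (g i x)\<^sup>2)"
    by (rule smooth_approximation) blast
  have [measurable]: "w n \<in> borel_measurable borel" for n by (rule test_fun_measurable[OF w(1)])
  define e where "e n = 1 / real (Suc n)" for n
  have e0: "e n > 0" for n by (simp add: e_def)
  have el: "e \<longlonglongrightarrow> 0" unfolding e_def[abs_def] by (rule LIMSEQ_Suc[OF lim_1_over_n])
  define W where "W = (\<lambda>n. soft_abs (e n) (w n))"
  have Wm [measurable]: "W n \<in> borel_measurable borel" for n
    unfolding W_def soft_abs_def[abs_def] by measurable
  have "(\<integral>\<^sup>+x. ennreal ((u x)\<^sup>2 * \<bar>u x\<bar>) \<partial>lborel) \<le> ennreal (t * G + A / (16 * pi * t))"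
  proof (rule nn_integral_limit_le)
    show "(\<lambda>x. (u x)\<^sup>2 * W n x) \<in> borel_measurable lborel" for n by measurable
    show "AE x in lborel. (\<lambda>n. (u x)\<^sup>2 * W n x) \<longlonglongrightarrow> (u x)\<^sup>2 * \<bar>u x\<bar>"
      using w(2)
    proof eventually_elim
      fix x assume "(\<lambda>n. w n x) \<longlonglongrightarrow> u x"
      then have "(\<lambda>n. sqrt ((e n)\<^sup>2 + (w n x)\<^sup>2) - e n) \<longlonglongrightarrow> sqrt (0\<^sup>2 + (u x)\<^sup>2) - 0"
        by (intro tendsto_intros el)
      then have "(\<lambda>n. W n x) \<longlonglongrightarrow> \<bar>u x\<bar>" by (simp add: W_def soft_abs_def)
      then show "(\<lambda>n. (u x)\<^sup>2 * W n x) \<longlonglongrightarrow> (u x)\<^sup>2 * \<bar>u x\<bar>" by (intro tendsto_intros)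
    qed
    show "(\<integral>\<^sup>+x. ennreal ((u x)\<^sup>2 * W n x) \<partial>lborel) \<le> ennreal (t * a n + A / (16 * pi * t))" for n
    proof -
      obtain M r where C: "C2_compact (W n) M r"
        unfolding W_def by (rule soft_abs_C2_compact[OF w(1) e0])
      interpret C2_compact "W n" M r by (rule C)
      obtain B where B: "\<And>x. \<bar>W n x\<bar> \<le> B" by (rule W_bounded) blast
      have i: "integrable lborel (\<lambda>x. (u x)\<^sup>2 * W n x)"
        by (rule integrable_mult_bounded[OF u2 _ B]) simp
      have tfp: "integrable lborel (\<lambda>x. (partial i (w n) x)\<^sup>2)" for i
      proof -
        obtain M' r' where "C2_compact (w n) M' r'" by (rule test_fun_C2_compact[OF w(1)])
        then show ?thesis by (rule C2_compact.dirichlet(1))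
      qed
      have "(LBINT x. (u x)\<^sup>2 * W n x) \<le> t * (\<Sum>i\<in>UNIV. LBINT x. (partial i (W n) x)\<^sup>2) + A / (16 * pi * t)"
        unfolding A_def by (rule coulomb_duality[OF u2 coulomb_integrable t])
      also have "(\<Sum>i\<in>UNIV. LBINT x. (partial i (W n) x)\<^sup>2) \<le> (\<Sum>i\<in>UNIV. LBINT x. (partial i (w n) x)\<^sup>2)"
        by (intro sum_mono integral_mono dirichlet(1) tfp)
           (simp add: W_def soft_abs_partial_le[OF w(1) e0])
      also have "\<dots> \<le> a n" by (rule w(4))
      finally have "(LBINT x. (u x)\<^sup>2 * W n x) \<le> t * a n + A / (16 * pi * t)" using t by simp
      moreover have "0 \<le> (u x)\<^sup>2 * W n x" for x
        unfolding W_def using soft_abs_nonneg[OF w(1) e0] by simp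
      ultimately show ?thesis by (subst nn_integral_eq_integral[OF i]) (auto intro: ennreal_leI)
    qed
    show "(\<lambda>n. t * a n + A / (16 * pi * t)) \<longlonglongrightarrow> t * G + A / (16 * pi * t)"
      using w(5) unfolding G_def by (intro tendsto_intros)
  qed
  moreover have "(u x)\<^sup>2 * \<bar>u x\<bar> = \<bar>u x\<bar> ^ 3" for x
    by (simp add: power3_eq_cube power2_eq_square)
  ultimately show ?thesis by simp
qed

lemma cubic_integrable: "integrable lborel (\<lambda>x. \<bar>u x\<bar> ^ 3)"
  using cubic_bound[of 1] by (intro integrableI_nonneg) (auto intro: le_less_trans)

lemma cubic_integral_le: "t > 0 \<Longrightarrow> (LBINT x. \<bar>u x\<bar> ^ 3) \<le> t * G + A / (16 * pi * t)"
proof -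
  assume t: "t > 0"
  have "A \<ge> 0" unfolding A_def by (intro integral_nonneg_AE AE_I2) (auto simp: split_beta)
  then have "0 \<le> t * G + A / (16 * pi * t)" using t G_nonneg by simp
  then show ?thesis
    using cubic_bound[OF t] nn_integral_eq_integral[OF cubic_integrable] by simp
qed

text \<open>\<open>D12\<close> already asks for an integrable sixth power, which is not known for u.
  Starting from test functions and passing to the limit by Fatou's lemma yields this integrability
  together with the bound.\<close>

lemma sobolev_from_test_functions:
  assumes K: "K > 0" and S: "\<And>w. test_fun w \<Longrightarrow>
      K * (LBINT x. (w x) ^ 6) powr (1 / 3) \<le> (\<Sum>i\<in>UNIV. LBINT x. (partial i w x)\<^sup>2)"
  shows "(\<integral>\<^sup>+x. ennreal ((u x) ^ 6) \<partial>lborel) \<le> ennreal ((G / K) ^ 3)"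
proof -
  obtain w a where w: "\<And>n. test_fun (w n)" "AE x in lborel. (\<lambda>n. w n x) \<longlonglongrightarrow> u x"
    "\<And>n. (LBINT x. (w n x)\<^sup>2) \<le> (LBINT x. (u x)\<^sup>2)"
    "\<And>n. (\<Sum>i\<in>UNIV. LBINT x. (partial i (w n) x)\<^sup>2) \<le> a n"
    "a \<longlonglongrightarrow> (\<Sum>i\<in>UNIV. LBINT x. (g i x)\<^sup>2)"
    by (rule smooth_approximation) blast
  have [measurable]: "w n \<in> borel_measurable borel" for n by (rule test_fun_measurable[OF w(1)])
  show ?thesis
  proof (rule nn_integral_limit_le)
    show "(\<lambda>x. (w n x) ^ 6) \<in> borel_measurable lborel" for n by measurable
    show "AE x in lborel. (\<lambda>n. (w n x) ^ 6) \<longlonglongrightarrow> (u x) ^ 6"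
      using w(2) by eventually_elim (intro tendsto_intros)
    show "(\<integral>\<^sup>+x. ennreal ((w n x) ^ 6) \<partial>lborel) \<le> ennreal ((a n / K) ^ 3)" for n
    proof -
      define I where "I = (LBINT x. (w n x) ^ 6)"
      have i: "integrable lborel (\<lambda>x. (w n x) ^ 6)"
        by (rule test_fun_power_integrable[OF w(1)]) simp
      have I0: "I \<ge> 0" unfolding I_def by (intro integral_nonneg_AE) simp
      have "K * I powr (1 / 3) \<le> a n" unfolding I_def using S[OF w(1)] w(4) order_trans by blast
      then have "I powr (1 / 3) \<le> a n / K" using K by (simp add: field_simps)
      then have "(I powr (1 / 3)) ^ 3 \<le> (a n / K) ^ 3" by (intro power_mono) auto
      moreover have "(I powr (1 / 3)) ^ 3 = I"
        using I0 by (cases "I = 0") (simp_all add: powr_power)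
      ultimately have "I \<le> (a n / K) ^ 3" by simp
      then show ?thesis by (subst nn_integral_eq_integral[OF i]) (auto simp: I_def intro: ennreal_leI)
    qed
    show "(\<lambda>n. (a n / K) ^ 3) \<longlonglongrightarrow> (G / K) ^ 3"
      using w(5) K unfolding G_def by (intro tendsto_intros) auto
  qed
qed

end

section \<open>Borel representatives and the Sobolev constant\<close>

lemma lebesgue_transfer:
  fixes F F' :: "R3 \<Rightarrow> real"
  assumes F: "F \<in> borel_measurable lebesgue" and F': "F' \<in> borel_measurable borel"
    and eq: "AE x in lebesgue. F x = F' x"
  shows lebesgue_transfer_integrable: "integrable lebesgue F \<longleftrightarrow> integrable lborel F'"
    and lebesgue_transfer_integral: "(\<integral>x. F x \<partial>lebesgue) = (LBINT x. F' x)"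
proof -
  have F'b: "F' \<in> borel_measurable lborel" using F' by simp
  then have F'l: "F' \<in> borel_measurable lebesgue" by (rule measurable_completion)
  show "integrable lebesgue F \<longleftrightarrow> integrable lborel F'"
    using integrable_cong_AE[OF F F'l eq] integrable_completion[OF F'b] by blast
  show "(\<integral>x. F x \<partial>lebesgue) = (LBINT x. F' x)"
    using integral_cong_AE[OF F F'l eq] integral_completion[OF F'b] by simp
qed

lemma borel_lebesgue: "f \<in> borel_measurable borel \<Longrightarrow> f \<in> borel_measurable lebesgue" for f :: "R3 \<Rightarrow> 'a::topological_space"
  by (rule measurable_completion) simp

lemma measurable_vec_nth_lebesgue:
  assumes "Du \<in> borel_measurable lebesgue"
  shows "(\<lambda>x. (Du x :: R3) $ i) \<in> borel_measurable lebesgue"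
  by (rule measurable_compose[OF assms borel_measurable_continuous_onI]) (intro continuous_intros)

lemma norm_square_vec: "(norm (v :: R3))\<^sup>2 = (\<Sum>i\<in>UNIV. (v $ i)\<^sup>2)"
  unfolding power2_norm_eq_inner inner_vec_def by (simp add: power2_eq_square)

text \<open>The function and each component of its gradient are changed on null sets; every integral
  in the weak formulation is unaffected.\<close>

lemma borel_representative:
  assumes wg: "weak_gradient u Du" and u2: "integrable lebesgue (\<lambda>x. (u x)\<^sup>2)"
    and Du2: "integrable lebesgue (\<lambda>x. (norm (Du x))\<^sup>2)"
  obtains u' g where "sobolev_borel u' g" "AE x in lebesgue. u x = u' x"
    "AE x in lebesgue. \<forall>i. Du x $ i = g i x"
proof -
  have um: "u \<in> borel_measurable lebesgue" and Dm: "Du \<in> borel_measurable lebesgue"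
    using wg unfolding weak_gradient_def by auto
  have Dim: "(\<lambda>x. Du x $ i) \<in> borel_measurable lebesgue" for i by (rule measurable_vec_nth_lebesgue[OF Dm])
  obtain u' where u': "u' \<in> borel_measurable lborel" "AE x in lborel. u x = u' x"
    using completion_ex_borel_measurable_real[OF um] by (auto simp: eq_commute)
  have "\<exists>g. g \<in> borel_measurable lborel \<and> (AE x in lborel. Du x $ i = g x)" for i
    using completion_ex_borel_measurable_real[OF Dim[of i]] by (auto simp: eq_commute)
  then obtain g where g: "\<And>i. g i \<in> borel_measurable lborel" "\<And>i. AE x in lborel. Du x $ i = g i x" by metis
  have u'm [measurable]: "u' \<in> borel_measurable borel" using u' by simp
  have gm [measurable]: "g i \<in> borel_measurable borel" for i using g(1)[of i] by simp
  have ue: "AE x in lebesgue. u x = u' x" by (rule AE_completion[OF u'(2)])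
  have ge: "AE x in lebesgue. Du x $ i = g i x" for i by (rule AE_completion[OF g(2)])
  have "sobolev_borel u' g"
  proof
    show "u' \<in> borel_measurable borel" "g i \<in> borel_measurable borel" for i by fact+
    have "integrable lebesgue (\<lambda>x. (u x)\<^sup>2) \<longleftrightarrow> integrable lborel (\<lambda>x. (u' x)\<^sup>2)"
      by (rule lebesgue_transfer_integrable) (use um ue in auto)
    then show "integrable lborel (\<lambda>x. (u' x)\<^sup>2)" using u2 by simp
    show "integrable lborel (\<lambda>x. (g i x)\<^sup>2)" for i
    proof -
      have "integrable lebesgue (\<lambda>x. (Du x $ i)\<^sup>2)"
      proof (rule Bochner_Integration.integrable_bound[OF Du2])
        show "AE x in lebesgue. norm ((Du x $ i)\<^sup>2) \<le> norm ((norm (Du x))\<^sup>2)"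
          using component_le_norm_cart by (intro AE_I2) (simp add: abs_le_square_iff[symmetric])
      qed (use Dim in simp)
      moreover have "integrable lebesgue (\<lambda>x. (Du x $ i)\<^sup>2) \<longleftrightarrow> integrable lborel (\<lambda>x. (g i x)\<^sup>2)"
        by (rule lebesgue_transfer_integrable) (use Dim ge[of i] in auto)
      ultimately show ?thesis by simp
    qed
    show "(LBINT x. u' x * partial i \<phi> x) = - (LBINT x. g i x * \<phi> x)" if \<phi>: "test_fun \<phi>" for \<phi> i
    proof -
      have pm: "\<phi> \<in> borel_measurable borel" "partial i \<phi> \<in> borel_measurable borel"
        using test_fun_measurable \<phi> test_fun_partial by blast+
      have "(\<integral>x. u x * partial i \<phi> x \<partial>lebesgue) = (LBINT x. u' x * partial i \<phi> x)"
        by (rule lebesgue_transfer_integral[OF borel_measurable_times[OF um borel_lebesgue[OF pm(2)]]])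
           (use ue pm in auto)
      moreover have "(\<integral>x. Du x $ i * \<phi> x \<partial>lebesgue) = (LBINT x. g i x * \<phi> x)"
        by (rule lebesgue_transfer_integral[OF borel_measurable_times[OF Dim borel_lebesgue[OF pm(1)]]])
           (use ge[of i] pm in auto)
      moreover have "(\<integral>x. u x * partial i \<phi> x \<partial>lebesgue) = - (\<integral>x. Du x $ i * \<phi> x \<partial>lebesgue)"
        using wg \<phi> unfolding weak_gradient_def by blast
      ultimately show ?thesis by linarith
    qed
  qed
  moreover have "AE x in lebesgue. \<forall>i. Du x $ i = g i x" unfolding AE_all_countable using ge by blast
  ultimately show ?thesis using that ue by blast
qed

lemma weak_gradient_test_fun:
  assumes w: "test_fun w"
  shows "weak_gradient w (\<lambda>x. \<chi> i. partial i w x)"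
  unfolding weak_gradient_def
proof (intro conjI allI impI)
  have loc: "loc_integrable f" if f: "test_fun f" for f
    unfolding loc_integrable_def set_integrable_def
  proof (intro allI impI)
    fix K :: "R3 set" assume "compact K"
    then have "K \<in> sets lebesgue" using lmeasurable_compact fmeasurableD by blast
    moreover have "integrable lebesgue f"
      using test_fun_integrable[OF f] integrable_completion[of f lborel] test_fun_measurable[OF f] by simp
    ultimately show "integrable lebesgue (\<lambda>x. indicat_real K x *\<^sub>R f x)" by (rule integrable_mult_indicator)
  qed
  show "w \<in> borel_measurable lebesgue" by (intro borel_lebesgue test_fun_measurable w)
  have "continuous_on UNIV (\<lambda>x. \<chi> i. partial i w x)"
    by (intro continuous_on_vec_lambda test_fun_continuous test_fun_partial w)
  then show "(\<lambda>x. \<chi> i. partial i w x) \<in> borel_measurable lebesgue"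
    by (intro borel_lebesgue borel_measurable_continuous_onI)
  show "loc_integrable w" by (rule loc[OF w])
  show "loc_integrable (\<lambda>x. (\<chi> i. partial i w x) $ i)" for i
    using loc[OF test_fun_partial[OF w]] by simp
  fix \<phi> i assume \<phi>: "test_fun \<phi>"
  have sw: "smooth_fun w" using w by (simp add: test_fun_def)
  have [measurable]: "w \<in> borel_measurable borel" "\<phi> \<in> borel_measurable borel"
    "partial i w \<in> borel_measurable borel" "partial i \<phi> \<in> borel_measurable borel"
    using test_fun_measurable test_fun_partial w \<phi> by blast+
  have t: "test_fun (\<lambda>x. w x * \<phi> x)" by (rule test_fun_smooth_mult[OF sw \<phi>])
  have p: "partial i (\<lambda>x. w x * \<phi> x) = (\<lambda>x. partial i w x * \<phi> x + w x * partial i \<phi> x)"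
    by (intro ext partial_mult test_fun_differentiable w \<phi>)
  have i: "integrable lborel (\<lambda>x. partial i w x * \<phi> x)" "integrable lborel (\<lambda>x. w x * partial i \<phi> x)"
    by (intro test_fun_integrable test_fun_smooth_mult smooth_fun_partial test_fun_partial sw \<phi>)+
  obtain B where B: "\<And>i x. \<bar>partial i (\<lambda>x. w x * \<phi> x) x\<bar> \<le> B" by (rule test_fun_partials_bounded[OF t]) blast
  obtain r where r: "\<And>x. norm x > r \<Longrightarrow> w x * \<phi> x = 0" using test_fun_support[OF t] by blast
  have "(LBINT x. partial i (\<lambda>x. w x * \<phi> x) x) = 0"
    by (rule integral_partial_eq_0(2)[OF test_fun_differentiable[OF t] B r])
  then have "(LBINT x. partial i w x * \<phi> x) + (LBINT x. w x * partial i \<phi> x) = 0"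
    using i by (simp add: p)
  moreover have "(\<integral>x. partial i w x * \<phi> x \<partial>lebesgue) = (LBINT x. partial i w x * \<phi> x)"
    "(\<integral>x. w x * partial i \<phi> x \<partial>lebesgue) = (LBINT x. w x * partial i \<phi> x)"
    by (rule integral_completion, measurable)+
  ultimately show "(\<integral>x. w x * partial i \<phi> x \<partial>lebesgue) = - (\<integral>x. (\<chi> i. partial i w x) $ i * \<phi> x \<partial>lebesgue)"
    by simp
qed

section \<open>The Sobolev constant as a supremum\<close>

definition sobolev_constants :: "real set" where
  "sobolev_constants = {S. \<forall>u Du. u \<in> D12 \<and> weak_gradient u Du \<longrightarrow>
      S * (\<integral>x. (u x) ^ 6 \<partial>lebesgue) powr (1/3) \<le> (\<integral>x. (norm (Du x))\<^sup>2 \<partial>lebesgue)}"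

lemma zero_in_sobolev_constants: "0 \<in> sobolev_constants"
  unfolding sobolev_constants_def by (auto intro!: integral_nonneg_AE)

lemma sobolev_constants_test_fun:
  assumes w: "test_fun w" and S: "S \<in> sobolev_constants"
  shows "S * (LBINT x. (w x) ^ 6) powr (1/3) \<le> (\<Sum>i\<in>UNIV. LBINT x. (partial i w x)\<^sup>2)"
proof -
  let ?D = "\<lambda>x. \<chi> i. partial i w x"
  have [measurable]: "w \<in> borel_measurable borel" "partial i w \<in> borel_measurable borel" for i
    using test_fun_measurable test_fun_partial w by blast+
  have n: "(norm (?D x))\<^sup>2 = (\<Sum>i\<in>UNIV. (partial i w x)\<^sup>2)" for x by (simp add: norm_square_vec)
  have i2: "integrable lborel (\<lambda>x. (partial i w x)\<^sup>2)" for i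
    by (rule test_fun_power_integrable[OF test_fun_partial[OF w]]) simp
  have i6: "integrable lborel (\<lambda>x. (w x) ^ 6)" by (rule test_fun_power_integrable[OF w]) simp
  have "w \<in> D12"
    unfolding D12_def
  proof (intro CollectI exI conjI)
    show "weak_gradient w ?D" by (rule weak_gradient_test_fun[OF w])
    show "integrable lebesgue (\<lambda>x. (w x) ^ 6)" using i6 by (subst integrable_completion) auto
    show "integrable lebesgue (\<lambda>x. (norm (?D x))\<^sup>2)"
      unfolding n using i2 by (subst integrable_completion) auto
  qed
  then have "S * (\<integral>x. (w x) ^ 6 \<partial>lebesgue) powr (1/3) \<le> (\<integral>x. (norm (?D x))\<^sup>2 \<partial>lebesgue)"
    using S weak_gradient_test_fun[OF w] unfolding sobolev_constants_def by blast
  also have "(\<integral>x. (norm (?D x))\<^sup>2 \<partial>lebesgue) = (LBINT x. (\<Sum>i\<in>UNIV. (partial i w x)\<^sup>2))"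
    unfolding n by (rule integral_completion) measurable
  also have "\<dots> = (\<Sum>i\<in>UNIV. LBINT x. (partial i w x)\<^sup>2)"
    using i2 by (rule Bochner_Integration.integral_sum)
  also have "(\<integral>x. (w x) ^ 6 \<partial>lebesgue) = (LBINT x. (w x) ^ 6)"
    by (rule integral_completion) measurable
  finally show ?thesis .
qed

lemma sobolev_S_eq: "sobolev_S = Sup sobolev_constants"
  unfolding sobolev_S_def sobolev_constants_def ..

text \<open>For a fixed w with nonzero sixth-power integral, the Rayleigh quotient bounds every
  admissible constant, hence their supremum.\<close>

lemma sobolev_S_test_fun:
  assumes w: "test_fun w"
  shows "sobolev_S * (LBINT x. (w x) ^ 6) powr (1/3) \<le> (\<Sum>i\<in>UNIV. LBINT x. (partial i w x)\<^sup>2)"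
proof (cases "(LBINT x. (w x) ^ 6) = 0")
  case True
  then show ?thesis by (auto intro!: sum_nonneg integral_nonneg_AE)
next
  case False
  then have p: "(LBINT x. (w x) ^ 6) powr (1/3) > 0" by simp
  have "sobolev_S \<le> (\<Sum>i\<in>UNIV. LBINT x. (partial i w x)\<^sup>2) / (LBINT x. (w x) ^ 6) powr (1/3)"
    unfolding sobolev_S_eq
  proof (rule cSup_least)
    show "sobolev_constants \<noteq> {}" using zero_in_sobolev_constants by blast
    show "S \<le> (\<Sum>i\<in>UNIV. LBINT x. (partial i w x)\<^sup>2) / (LBINT x. (w x) ^ 6) powr (1/3)"
      if "S \<in> sobolev_constants" for S
      using sobolev_constants_test_fun[OF w that] p by (simp add: le_divide_eq)
  qed
  then show ?thesis using p by (simp add: le_divide_eq)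
qed

text \<open>A real supremum is informative only for a bounded set: the quotient of the nonzero test
  function \<open>bump 1\<close> is an upper bound, and 0 belongs to the set.\<close>

lemma sobolev_S_nonneg: "sobolev_S \<ge> 0"
proof -
  have i: "integrable lborel (\<lambda>x. (bump 1 x) ^ 6)" by (rule test_fun_power_integrable[OF test_fun_bump]) simp
  have "(LBINT x. (bump 1 x) ^ 6) \<noteq> 0"
  proof
    assume "(LBINT x. (bump 1 x) ^ 6) = 0"
    then have "AE x in lborel. (bump 1 x) ^ 6 = 0"
      using integral_nonneg_eq_0_iff_AE[OF i] by auto
    then have "AE x in lborel. x \<notin> ball (0::R3) 1"
      by eventually_elim (use bump_pos in \<open>force simp: dist_norm\<close>)
    then have "ball (0::R3) 1 \<in> null_sets lborel" by (simp add: AE_iff_null_sets)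
    then show False using open_not_negligible[of "ball (0::R3) 1"]
      by (auto simp: negligible_iff_null_sets null_sets_completionI)
  qed
  then have p: "(LBINT x. (bump 1 x) ^ 6) powr (1/3) > 0" by simp
  have "bdd_above sobolev_constants"
  proof (rule bdd_aboveI)
    show "S \<le> (\<Sum>i\<in>UNIV. LBINT x. (partial i (bump 1) x)\<^sup>2) / (LBINT x. (bump 1 x) ^ 6) powr (1/3)"
      if "S \<in> sobolev_constants" for S
      using sobolev_constants_test_fun[OF test_fun_bump that] p by (simp add: le_divide_eq)
  qed
  then show ?thesis unfolding sobolev_S_eq by (rule cSup_upper[OF zero_in_sobolev_constants])
qed

text \<open>Convexity of exp between 0 and ln a, with weights 3 - p and p - 2, gives a^(p - 2) \<le>
  (3 - p) + (p - 2) a; multiply by a^2.\<close>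

lemma powr_interpolation:
  fixes a p :: real
  assumes a: "a \<ge> 0" and p: "2 < p" "p \<le> 3"
  shows "a powr p \<le> (3 - p) * a\<^sup>2 + (p - 2) * a ^ 3"
proof (cases "a = 0")
  case False
  with a have a: "a > 0" by simp
  have "exp ((1 - (p - 2)) *\<^sub>R 0 + (p - 2) *\<^sub>R ln a) \<le> (1 - (p - 2)) * exp 0 + (p - 2) * exp (ln a)"
    by (rule convex_onD[OF exp_convex]) (use p in auto)
  then have "a powr (p - 2) \<le> (3 - p) + (p - 2) * a" using a by (simp add: powr_def)
  then have "a\<^sup>2 * a powr (p - 2) \<le> a\<^sup>2 * ((3 - p) + (p - 2) * a)" by (rule mult_left_mono) simp
  moreover have "a\<^sup>2 * a powr (p - 2) = a powr p"
    using a by (simp add: powr_diff powr_numeral field_simps)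
  ultimately show ?thesis by (simp add: algebra_simps power2_eq_square power3_eq_cube)
qed simp

section \<open>Nonexistence\<close>

context sobolev_borel begin

lemma A_nonneg: "A \<ge> 0"
  unfolding A_def by (intro integral_nonneg_AE AE_I2) (auto simp: split_beta)

text \<open>The integrand of A is nonnegative and the kernel positive off the diagonal, so u x * u y
  vanishes for almost every pair.\<close>

lemma zero_energy:
  assumes "A = 0" shows "AE x in lborel. u x = 0"
proof (rule ccontr)
  assume nz: "\<not> (AE x in lborel. u x = 0)"
  have "AE p in P3. newton_pairing (\<lambda>x. (u x)\<^sup>2) (\<lambda>x. (u x)\<^sup>2) p = 0"
    using assms unfolding A_def
    by (subst integral_nonneg_eq_0_iff_AE[OF coulomb_integrable, symmetric]) (auto simp: split_beta)
  then have "AE p in P3. u (fst p) = 0 \<or> u (snd p) = 0"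
    using AE_P3_neq by eventually_elim (auto simp: split_beta)
  then have "AE x in lborel. AE y in lborel. u x = 0 \<or> u y = 0"
    using lborel_pair.AE_pair[of "\<lambda>p. u (fst p) = 0 \<or> u (snd p) = 0"] by simp
  \<comment> \<open>If u x were nonzero for one of these x, the inner statement would make u vanish
    a.e., which \<open>nz\<close> excludes.\<close>
  then have "AE x in lborel. u x = 0"
    by eventually_elim (use nz in auto)
  with nz show False by contradiction
qed

definition \<Phi> :: "R3 \<Rightarrow> real" where "\<Phi> x = (LBINT y. (u y)\<^sup>2 / dist x y) / (4 * pi)"

lemma \<Phi>_energy:
  shows \<Phi>_measurable [measurable]: "\<Phi> \<in> borel_measurable borel"
    and \<Phi>_integrable: "integrable lborel (\<lambda>x. \<Phi> x * (u x)\<^sup>2)"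
    and \<Phi>_integral: "(LBINT x. \<Phi> x * (u x)\<^sup>2) = A / (4 * pi)"
proof -
  have "(\<lambda>x. LBINT y. (u y)\<^sup>2 / dist x y) \<in> borel_measurable lborel"
    by (rule lborel.borel_measurable_lebesgue_integral) measurable
  then show m: "\<Phi> \<in> borel_measurable borel" unfolding \<Phi>_def[abs_def] by simp
  have eq: "(LBINT y. newton_pairing (\<lambda>x. (u x)\<^sup>2) (\<lambda>x. (u x)\<^sup>2) (x, y)) = 4 * pi * (\<Phi> x * (u x)\<^sup>2)" for x
  proof -
    have "(LBINT y. newton_pairing (\<lambda>x. (u x)\<^sup>2) (\<lambda>x. (u x)\<^sup>2) (x, y)) = (LBINT y. (u x)\<^sup>2 * ((u y)\<^sup>2 / dist x y))"
      by simp
    also have "\<dots> = (u x)\<^sup>2 * (LBINT y. (u y)\<^sup>2 / dist x y)" by (rule integral_mult_right_zero)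
    finally show ?thesis by (simp add: \<Phi>_def)
  qed
  have i: "integrable lborel (\<lambda>x. 4 * pi * (\<Phi> x * (u x)\<^sup>2))"
    using lborel_pair.integrable_fst'[OF coulomb_integrable] unfolding eq .
  have "integrable lborel (\<lambda>x. (1 / (4 * pi)) * (4 * pi * (\<Phi> x * (u x)\<^sup>2)))"
    by (intro integrable_mult_right i)
  then show i': "integrable lborel (\<lambda>x. \<Phi> x * (u x)\<^sup>2)" by simp
  have "(LBINT x. 4 * pi * (\<Phi> x * (u x)\<^sup>2)) = A"
    using lborel_pair.integral_fst'[OF coulomb_integrable] unfolding eq A_def .
  then have "4 * pi * (LBINT x. \<Phi> x * (u x)\<^sup>2) = A" by (simp only: integral_mult_right_zero)
  then show "(LBINT x. \<Phi> x * (u x)\<^sup>2) = A / (4 * pi)" by (simp add: field_simps)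
qed

text \<open>\<open>phi\<close> sees U only through integrals, so a change on a null set alters no
  value: the equality holds at every point.\<close>

lemma phi_eq:
  assumes U: "U \<in> borel_measurable lebesgue" and eq: "AE x in lebesgue. U x = u x"
  shows "phi U = \<Phi>"
proof
  fix x :: R3
  have d: "(\<lambda>y. dist x y) \<in> borel_measurable lebesgue" by (intro borel_lebesgue) simp
  have "phi U x = (LBINT y. (u y)\<^sup>2 / (4 * pi * dist x y))"
    unfolding phi_def
  proof (rule lebesgue_transfer_integral)
    show "(\<lambda>y. (U y)\<^sup>2 / (4 * pi * dist x y)) \<in> borel_measurable lebesgue"
      by (intro borel_measurable_divide borel_measurable_times borel_measurable_const borel_measurable_power U d)
    show "AE y in lebesgue. (U y)\<^sup>2 / (4 * pi * dist x y) = (u y)\<^sup>2 / (4 * pi * dist x y)"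
      using eq by eventually_elim simp
  qed measurable
  also have "\<dots> = (LBINT y. (1 / (4 * pi)) * ((u y)\<^sup>2 / dist x y))" by simp
  also have "\<dots> = \<Phi> x" unfolding integral_mult_right_zero \<Phi>_def by simp
  finally show "phi U x = \<Phi> x" .
qed

lemma powr_integrable:
  assumes p: "2 < p" "p \<le> 3"
  shows "integrable lborel (\<lambda>x. \<bar>u x\<bar> powr p)"
    and "(LBINT x. \<bar>u x\<bar> powr p) \<le> (3 - p) * N + (p - 2) * (LBINT x. \<bar>u x\<bar> ^ 3)"
proof -
  have le: "\<bar>u x\<bar> powr p \<le> (3 - p) * (u x)\<^sup>2 + (p - 2) * \<bar>u x\<bar> ^ 3" for x
    using powr_interpolation[of "\<bar>u x\<bar>" p] p by simp
  have i: "integrable lborel (\<lambda>x. (3 - p) * (u x)\<^sup>2 + (p - 2) * \<bar>u x\<bar> ^ 3)"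
    using u2 cubic_integrable by (intro Bochner_Integration.integrable_add integrable_mult_right)
  show i': "integrable lborel (\<lambda>x. \<bar>u x\<bar> powr p)"
  proof (rule Bochner_Integration.integrable_bound[OF i])
    show "AE x in lborel. norm (\<bar>u x\<bar> powr p) \<le> norm ((3 - p) * (u x)\<^sup>2 + (p - 2) * \<bar>u x\<bar> ^ 3)"
    proof (rule AE_I2)
      fix x show "norm (\<bar>u x\<bar> powr p) \<le> norm ((3 - p) * (u x)\<^sup>2 + (p - 2) * \<bar>u x\<bar> ^ 3)"
        using le[of x] by simp
    qed
  qed measurable
  have "(LBINT x. \<bar>u x\<bar> powr p) \<le> (LBINT x. (3 - p) * (u x)\<^sup>2 + (p - 2) * \<bar>u x\<bar> ^ 3)"
    by (rule integral_mono[OF i' i le])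
  also have "\<dots> = (3 - p) * N + (p - 2) * (LBINT x. \<bar>u x\<bar> ^ 3)"
    using u2 cubic_integrable by (simp add: N_def)
  finally show "(LBINT x. \<bar>u x\<bar> powr p) \<le> (3 - p) * N + (p - 2) * (LBINT x. \<bar>u x\<bar> ^ 3)" .
qed

text \<open>Hoelder's inequality with exponents 3/2 and 3, proved through Young's inequality with an
  optimised parameter. Writing the measure as c^3 turns its power 2/3 into c^2.\<close>

lemma square_integral_on_set_le:
  assumes L6: "(\<integral>\<^sup>+x. ennreal ((u x) ^ 6) \<partial>lborel) \<le> ennreal (X ^ 3)" and X: "X \<ge> 0"
    and B: "B \<in> sets borel" "emeasure lborel B < \<infinity>" "measure lborel B = c ^ 3" and c: "c \<ge> 0"
  shows "(LBINT x. indicator B x * (u x)\<^sup>2) \<le> c\<^sup>2 * X"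
proof -
  have i6: "integrable lborel (\<lambda>x. (u x) ^ 6)"
    using L6 by (intro integrableI_nonneg) (auto intro: le_less_trans)
  have I6: "(LBINT x. (u x) ^ 6) \<le> X ^ 3"
    using L6 nn_integral_eq_integral[OF i6] X by simp
  have [measurable]: "B \<in> sets borel" by fact
  have iB: "integrable lborel (\<lambda>x. indicator B x :: real)"
    using B by (intro integrable_real_indicator) auto
  have iu: "integrable lborel (\<lambda>x. indicator B x * (u x)\<^sup>2)"
    using integrable_mult_bounded[OF u2, of "\<lambda>x. indicator B x" 1] by (simp add: mult.commute indicator_def)
  have *: "(LBINT x. indicator B x * (u x)\<^sup>2) \<le> (c + d)\<^sup>2 * (X + d)" if d: "d > 0" for d
  proof -
    \<comment> \<open>The optimal parameter is X / c, which degenerates when X or c is 0; both are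
      therefore enlarged by d > 0, and d tends to 0 at the end.\<close>
    define \<tau> where "\<tau> = (X + d) / (c + d)"
    have t: "\<tau> > 0" using d X c by (simp add: \<tau>_def)
    have young: "v \<le> (1 / (3 * \<tau>\<^sup>2)) * v ^ 3 + 2 / 3 * \<tau>" if "v \<ge> 0" for v
    proof -
      \<comment> \<open>The product expands to v^3 - 3 \<tau>^2 v + 2 \<tau>^3, which is Young's
        inequality with equality at v = \<tau>.\<close>
      have "0 \<le> (v - \<tau>)\<^sup>2 * (v + 2 * \<tau>)" using t that by simp
      then have "3 * \<tau>\<^sup>2 * v \<le> v ^ 3 + 2 * \<tau> ^ 3" by (simp add: power2_eq_square power3_eq_cube algebra_simps)
      then have "v \<le> (v ^ 3 + 2 * \<tau> ^ 3) / (3 * \<tau>\<^sup>2)" using t by (simp add: field_simps)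
      also have "\<dots> = (1 / (3 * \<tau>\<^sup>2)) * v ^ 3 + 2 / 3 * \<tau>"
        using t by (simp add: field_simps power2_eq_square power3_eq_cube)
      finally show ?thesis .
    qed
    have pt: "indicator B x * (u x)\<^sup>2 \<le> (1 / (3 * \<tau>\<^sup>2)) * (u x) ^ 6 + 2 / 3 * \<tau> * indicator B x" for x
    proof (cases "x \<in> B")
      case True
      then show ?thesis using young[of "(u x)\<^sup>2"] by (simp add: power_mult[symmetric])
    next
      case False
      then show ?thesis using t by simp
    qed
    have "(LBINT x. indicator B x * (u x)\<^sup>2) \<le> (LBINT x. (1 / (3 * \<tau>\<^sup>2)) * (u x) ^ 6 + 2 / 3 * \<tau> * indicator B x)"
      by (rule integral_mono[OF iu _ pt]) (intro Bochner_Integration.integrable_add integrable_mult_right i6 iB)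
    also have "\<dots> = (1 / (3 * \<tau>\<^sup>2)) * (LBINT x. (u x) ^ 6) + 2 / 3 * \<tau> * (LBINT x. indicator B x)"
      by (subst Bochner_Integration.integral_add) (auto intro!: integrable_mult_right i6 iB simp del: integral_indicator)
    also have "(LBINT x. indicator B x) = c ^ 3" using B(3) by simp
    also have "(1 / (3 * \<tau>\<^sup>2)) * (LBINT x. (u x) ^ 6) + 2 / 3 * \<tau> * c ^ 3
        \<le> (1 / (3 * \<tau>\<^sup>2)) * (X + d) ^ 3 + 2 / 3 * \<tau> * (c + d) ^ 3"
    proof (intro add_mono mult_left_mono)
      show "(LBINT x. (u x) ^ 6) \<le> (X + d) ^ 3"
        using I6 power_mono[of X "X + d" 3] X d by linarith
      show "c ^ 3 \<le> (c + d) ^ 3" using c d by (intro power_mono) auto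
    qed (use t in auto)
    also have "\<dots> = (c + d)\<^sup>2 * (X + d)"
    proof -
      have "(1 / (3 * (a / b)\<^sup>2)) * a ^ 3 + 2 / 3 * (a / b) * b ^ 3 = b\<^sup>2 * a" if "a > 0" "b > 0" for a b :: real
        using that by (simp add: field_simps power2_eq_square power3_eq_cube)
      from this[of "X + d" "c + d"] show ?thesis unfolding \<tau>_def using X c d by simp
    qed
    finally show ?thesis .
  qed
  have "(\<lambda>n. (c + 1 / real (Suc n))\<^sup>2 * (X + 1 / real (Suc n))) \<longlonglongrightarrow> (c + 0)\<^sup>2 * (X + 0)"
    by (intro tendsto_intros LIMSEQ_Suc[OF lim_1_over_n])
  then have "(\<lambda>n. (c + 1 / real (Suc n))\<^sup>2 * (X + 1 / real (Suc n))) \<longlonglongrightarrow> c\<^sup>2 * X" by simp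
  then show ?thesis by (rule LIMSEQ_le_const) (auto intro!: exI[of _ 0] *)
qed

end

text \<open>The test function is u itself, admissible because u lies in \<open>E_space V\<close>.
  The identity is stated for a Borel representative, where A and the inequalities above are
  available.\<close>

lemma weak_solution_energy_identity:
  assumes V: "continuous_on UNIV V" "\<And>x. V x \<ge> 0" and sol: "weak_solution V lam \<mu> p u" and p: "2 < p" "p \<le> 3"
  obtains u' g where "sobolev_borel u' g" "AE x in lebesgue. u x = u' x"
    "integrable lborel (\<lambda>x. V x * (u' x)\<^sup>2)"
    "sobolev_borel.G g + lam * (LBINT x. V x * (u' x)\<^sup>2) + \<mu> * (sobolev_borel.A u' / (4 * pi))
      = (LBINT x. \<bar>u' x\<bar> powr p)"
proof -
  obtain Du where wg: "weak_gradient u Du" and uE: "u \<in> E_space V"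
    and eqn: "\<And>v Dv. v \<in> E_space V \<Longrightarrow> weak_gradient v Dv \<Longrightarrow>
      (\<integral>x. Du x \<bullet> Dv x + lam * V x * u x * v x + \<mu> * phi u x * u x * v x \<partial>lebesgue)
        = (\<integral>x. \<bar>u x\<bar> powr (p - 2) * u x * v x \<partial>lebesgue)"
    using sol unfolding weak_solution_def by blast
  obtain D' where D': "weak_gradient u D'" "integrable lebesgue (\<lambda>x. (u x)\<^sup>2)"
    "integrable lebesgue (\<lambda>x. (norm (D' x))\<^sup>2)"
    using uE unfolding E_space_def H1_def by blast
  have u_meas: "u \<in> borel_measurable lebesgue" and Dm: "Du \<in> borel_measurable lebesgue"
    using wg unfolding weak_gradient_def by auto
  \<comment> \<open>Replaces the gradient of the equation by the one from \<open>H1\<close>, which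
    is square integrable.\<close>
  have DD: "AE x in lebesgue. Du x = D' x" by (rule weak_gradient_unique[OF wg D'(1)])
  obtain u' g where sb: "sobolev_borel u' g" and ue: "AE x in lebesgue. u x = u' x"
    and ge: "AE x in lebesgue. \<forall>i. D' x $ i = g i x"
    by (rule borel_representative[OF D']) blast
  interpret sobolev_borel u' g by (rule sb)
  have Vm [measurable]: "V \<in> borel_measurable borel" using V(1) by (rule borel_measurable_continuous_onI)
  have Vl: "V \<in> borel_measurable lebesgue" by (rule borel_lebesgue[OF Vm])
  have iV: "integrable lborel (\<lambda>x. V x * (u' x)\<^sup>2)"
  proof -
    have m: "(\<lambda>x. V x * (u x)\<^sup>2) \<in> borel_measurable lebesgue"
      by (intro borel_measurable_times borel_measurable_power u_meas Vl)
    have "integrable lebesgue (\<lambda>x. V x * (u x)\<^sup>2)"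
      using uE V(2) unfolding E_space_def by (intro integrableI_nonneg[OF m]) auto
    moreover have "integrable lebesgue (\<lambda>x. V x * (u x)\<^sup>2) \<longleftrightarrow> integrable lborel (\<lambda>x. V x * (u' x)\<^sup>2)"
      by (rule lebesgue_transfer_integrable[OF m]) (use ue in auto)
    ultimately show ?thesis by blast
  qed
  have phi: "phi u = \<Phi>" by (rule phi_eq[OF u_meas ue])
  have Dint: "(\<lambda>x. Du x \<bullet> Du x) \<in> borel_measurable lebesgue" using Dm by simp
  have "(\<integral>x. Du x \<bullet> Du x + lam * V x * u x * u x + \<mu> * phi u x * u x * u x \<partial>lebesgue)
      = (LBINT x. (\<Sum>i\<in>UNIV. (g i x)\<^sup>2) + lam * (V x * (u' x)\<^sup>2) + \<mu> * (\<Phi> x * (u' x)\<^sup>2))"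
  proof (rule lebesgue_transfer_integral)
    show "(\<lambda>x. Du x \<bullet> Du x + lam * V x * u x * u x + \<mu> * phi u x * u x * u x) \<in> borel_measurable lebesgue"
      unfolding phi by (intro borel_measurable_add borel_measurable_times borel_measurable_const Dint u_meas Vl
          borel_lebesgue[OF \<Phi>_measurable])
    show "AE x in lebesgue. Du x \<bullet> Du x + lam * V x * u x * u x + \<mu> * phi u x * u x * u x
        = (\<Sum>i\<in>UNIV. (g i x)\<^sup>2) + lam * (V x * (u' x)\<^sup>2) + \<mu> * (\<Phi> x * (u' x)\<^sup>2)"
      using DD ue ge
    proof eventually_elim
      fix x assume a: "Du x = D' x" "u x = u' x" "\<forall>i. D' x $ i = g i x"
      have "Du x \<bullet> Du x = (\<Sum>i\<in>UNIV. (g i x)\<^sup>2)"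
        using a norm_square_vec[of "D' x"] by (simp add: power2_norm_eq_inner)
      then show "Du x \<bullet> Du x + lam * V x * u x * u x + \<mu> * phi u x * u x * u x
        = (\<Sum>i\<in>UNIV. (g i x)\<^sup>2) + lam * (V x * (u' x)\<^sup>2) + \<mu> * (\<Phi> x * (u' x)\<^sup>2)"
        using a(2) by (simp add: phi power2_eq_square)
    qed
  qed measurable
  \<comment> \<open>Splitting the integral needs each summand integrable: the potential term by
    membership in \<open>E_space V\<close>, the Coulomb term by the Hardy bound.\<close>
  also have "\<dots> = G + lam * (LBINT x. V x * (u' x)\<^sup>2) + \<mu> * (A / (4 * pi))"
  proof -
    have "integrable lborel (\<lambda>x. \<Sum>i\<in>UNIV. (g i x)\<^sup>2)" using g2 by auto
    moreover have "(LBINT x. (\<Sum>i\<in>UNIV. (g i x)\<^sup>2)) = G"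
      unfolding G_def using g2 by (rule Bochner_Integration.integral_sum)
    ultimately show ?thesis using iV \<Phi>_integrable by (simp add: \<Phi>_integral)
  qed
  finally have L: "(\<integral>x. Du x \<bullet> Du x + lam * V x * u x * u x + \<mu> * phi u x * u x * u x \<partial>lebesgue)
      = G + lam * (LBINT x. V x * (u' x)\<^sup>2) + \<mu> * (A / (4 * pi))" .
  have R: "(\<integral>x. \<bar>u x\<bar> powr (p - 2) * u x * u x \<partial>lebesgue) = (LBINT x. \<bar>u' x\<bar> powr p)"
  proof (rule lebesgue_transfer_integral)
    show "(\<lambda>x. \<bar>u x\<bar> powr (p - 2) * u x * u x) \<in> borel_measurable lebesgue" using u_meas by measurable
    show "AE x in lebesgue. \<bar>u x\<bar> powr (p - 2) * u x * u x = \<bar>u' x\<bar> powr p"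
      using ue
    proof eventually_elim
      fix x assume a: "u x = u' x"
      show "\<bar>u x\<bar> powr (p - 2) * u x * u x = \<bar>u' x\<bar> powr p"
      proof (cases "u' x = 0")
        case False
        have "\<bar>u' x\<bar> powr p = \<bar>u' x\<bar> powr (p - 2) * \<bar>u' x\<bar> powr 2"
          by (subst powr_add[symmetric]) simp
        also have "\<bar>u' x\<bar> powr 2 = u' x * u' x" using False by (simp add: powr_numeral power2_eq_square)
        finally show ?thesis by (simp add: a)
      qed (simp add: a)
    qed
  qed measurable
  from eqn[OF uE wg] L R have "G + lam * (LBINT x. V x * (u' x)\<^sup>2) + \<mu> * (A / (4 * pi)) = (LBINT x. \<bar>u' x\<bar> powr p)"
    by simp
  then show ?thesis using that[OF sb ue iV] by blast
qed

lemma sub_critical_nonexistence: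
  fixes V :: "R3 \<Rightarrow> real"
  assumes V: "continuous_on UNIV V" "\<And>x. V x \<ge> 0" and b: "b > 0" "emeasure lebesgue {x. V x < b} < \<infinity>"
    and p: "2 < p" "p < 3" and small: "measure lebesgue {x. V x < b} < sobolev_S powr (3/2)"
    and lam: "lam \<ge> 1 / b"
    and \<mu>: "\<mu> \<ge> 1 / (4 * (1 - measure lebesgue {x. V x < b} powr (2/3) / sobolev_S))"
    and sol: "weak_solution V lam \<mu> p u"
  shows "AE x in lebesgue. u x = 0"
proof -
  obtain u' g where sb: "sobolev_borel u' g" and ue: "AE x in lebesgue. u x = u' x"
    and iV: "integrable lborel (\<lambda>x. V x * (u' x)\<^sup>2)"
    and id: "sobolev_borel.G g + lam * (LBINT x. V x * (u' x)\<^sup>2) + \<mu> * (sobolev_borel.A u' / (4 * pi))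
      = (LBINT x. \<bar>u' x\<bar> powr p)"
    by (rule weak_solution_energy_identity[OF V sol]) (use p in auto)
  interpret sobolev_borel u' g by (rule sb)
  define B where "B = {x. V x < b}"
  define m where "m = measure lebesgue B"
  define L where "L = (LBINT x. V x * (u' x)\<^sup>2)"
  define D where "D = A / (4 * pi)"
  have Bm: "B \<in> sets borel" unfolding B_def
    by (intro borel_open open_Collect_less V continuous_on_const)
  have Be: "emeasure lebesgue B = emeasure lborel B" using Bm by simp
  have mB: "measure lborel B = m" unfolding m_def measure_def Be ..
  have m0: "m \<ge> 0" by (simp add: m_def)
  \<comment> \<open>If \<open>sobolev_S\<close> were 0, the smallness assumption would read m < 0
    powr (3/2) = 0, contrary to m \<ge> 0.\<close>
  have S0: "sobolev_S > 0"
    using sobolev_S_nonneg small m0 unfolding m_def B_def by (cases "sobolev_S = 0") auto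
  define \<kappa> where "\<kappa> = m powr (2/3) / sobolev_S"
  have \<kappa>0: "\<kappa> \<ge> 0" using S0 by (simp add: \<kappa>_def)
  have \<kappa>1: "\<kappa> < 1"
  proof -
    have "m powr (2/3) < (sobolev_S powr (3/2)) powr (2/3)"
      using small m0 unfolding m_def B_def by (intro powr_less_mono2) auto
    also have "\<dots> = sobolev_S" using S0 by (simp add: powr_powr)
    finally show ?thesis using S0 by (simp add: \<kappa>_def)
  qed
  have \<mu>': "\<mu> \<ge> 1 / (4 * (1 - \<kappa>))" using \<mu> by (simp add: \<kappa>_def m_def B_def)
  moreover have "1 / (4 * (1 - \<kappa>)) > 0" using \<kappa>1 by simp
  ultimately have \<mu>0: "\<mu> > 0" by linarith
  have lam0: "lam > 0" using lam b(1) by (meson divide_pos_pos less_le_trans zero_less_one)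
  have L0: "L \<ge> 0" unfolding L_def using V(2) by (intro integral_nonneg_AE) auto
  have D0: "D \<ge> 0" unfolding D_def using A_nonneg by simp
  have L6: "(\<integral>\<^sup>+x. ennreal ((u' x) ^ 6) \<partial>lborel) \<le> ennreal ((G / sobolev_S) ^ 3)"
    by (rule sobolev_from_test_functions[OF S0 sobolev_S_test_fun])
  \<comment> \<open>Taken with c = m powr (1/3), so that c^3 = m and c^2 is the power of m in
    \<kappa>.\<close>
  have "(LBINT x. indicator B x * (u' x)\<^sup>2) \<le> (m powr (1/3))\<^sup>2 * (G / sobolev_S)"
  proof (rule square_integral_on_set_le[OF L6 _ Bm])
    show "emeasure lborel B < \<infinity>" using b(2) Be by (simp add: B_def)
    show "measure lborel B = (m powr (1/3)) ^ 3"
      using m0 mB by (cases "m = 0") (simp_all add: powr_power)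
  qed (use G_nonneg S0 in auto)
  also have "(m powr (1/3))\<^sup>2 = m powr (2/3)"
    by (cases "m = 0") (simp_all add: powr_power)
  finally have IB: "(LBINT x. indicator B x * (u' x)\<^sup>2) \<le> \<kappa> * G" by (simp add: \<kappa>_def)
  have iB: "integrable lborel (\<lambda>x. indicator B x * (u' x)\<^sup>2)"
    using integrable_mult_bounded[OF u2, of "\<lambda>x. indicator B x" 1] Bm by (simp add: mult.commute indicator_def)
  \<comment> \<open>On B the mass of u' is controlled by the Sobolev inequality, off B by lam * V
    \<ge> lam * b \<ge> 1.\<close>
  have NL: "N \<le> \<kappa> * G + lam * L"
  proof -
    have "N \<le> (LBINT x. indicator B x * (u' x)\<^sup>2 + lam * (V x * (u' x)\<^sup>2))"
      unfolding N_def
    proof (rule integral_mono[OF u2])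
      show "integrable lborel (\<lambda>x. indicator B x * (u' x)\<^sup>2 + lam * (V x * (u' x)\<^sup>2))"
        by (intro Bochner_Integration.integrable_add integrable_mult_right iB iV)
      show "(u' x)\<^sup>2 \<le> indicator B x * (u' x)\<^sup>2 + lam * (V x * (u' x)\<^sup>2)" for x
      proof (cases "x \<in> B")
        case True then show ?thesis using lam0 V(2)[of x] by simp
      next
        case False
        then have "V x \<ge> b" by (simp add: B_def)
        then have "1 / b * b \<le> lam * V x" using lam lam0 b(1) by (intro mult_mono) auto
        then have "1 \<le> lam * V x" using b(1) by simp
        then have "1 * (u' x)\<^sup>2 \<le> (lam * V x) * (u' x)\<^sup>2" by (intro mult_right_mono) auto
        then show ?thesis using False by (simp add: mult.assoc)
      qed
    qed
    also have "\<dots> = (LBINT x. indicator B x * (u' x)\<^sup>2) + lam * L"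
      using iB iV by (simp add: L_def)
    finally show ?thesis using IB by linarith
  qed
  \<comment> \<open>With t = 1 - \<kappa> the energy term is D / (4 (1 - \<kappa>)); the threshold
    on \<mu> is exactly what bounds it by \<mu> D.\<close>
  have C: "(LBINT x. \<bar>u' x\<bar> ^ 3) \<le> (1 - \<kappa>) * G + \<mu> * D"
  proof -
    have "(LBINT x. \<bar>u' x\<bar> ^ 3) \<le> (1 - \<kappa>) * G + A / (16 * pi * (1 - \<kappa>))"
      by (rule cubic_integral_le) (use \<kappa>1 in simp)
    also have "A / (16 * pi * (1 - \<kappa>)) = (1 / (4 * (1 - \<kappa>))) * D" using \<kappa>1 by (simp add: D_def field_simps)
    also have "\<dots> \<le> \<mu> * D" using \<mu>' D0 by (rule mult_right_mono)
    finally show ?thesis by simp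
  qed
  have "G + lam * L + \<mu> * D \<le> (3 - p) * (\<kappa> * G + lam * L) + (p - 2) * ((1 - \<kappa>) * G + \<mu> * D)"
  proof -
    have "G + lam * L + \<mu> * D \<le> (3 - p) * N + (p - 2) * (LBINT x. \<bar>u' x\<bar> ^ 3)"
      using id powr_integrable(2)[of p] p unfolding L_def D_def by simp
    also have "\<dots> \<le> (3 - p) * (\<kappa> * G + lam * L) + (p - 2) * ((1 - \<kappa>) * G + \<mu> * D)"
      using p by (intro add_mono mult_left_mono NL C) auto
    finally show ?thesis .
  qed
  \<comment> \<open>After collecting terms D keeps the factor (3 - p) \<mu>, which is positive even
    when \<mu> equals its threshold, while G and L have nonnegative coefficients.\<close>
  then have "(1 - (3 - p) * \<kappa> - (p - 2) * (1 - \<kappa>)) * G + (p - 2) * (lam * L) + (3 - p) * (\<mu> * D) \<le> 0"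
    by (simp add: algebra_simps)
  \<comment> \<open>The weights 3 - p and p - 2 sum to 1, and both \<kappa> and 1 - \<kappa> are at
    most 1.\<close>
  moreover have "0 \<le> (1 - (3 - p) * \<kappa> - (p - 2) * (1 - \<kappa>)) * G"
  proof (intro mult_nonneg_nonneg G_nonneg)
    have "(3 - p) * \<kappa> \<le> (3 - p) * 1" "(p - 2) * (1 - \<kappa>) \<le> (p - 2) * 1"
      using p \<kappa>0 \<kappa>1 by (intro mult_left_mono; simp)+
    then have "(3 - p) * \<kappa> + (p - 2) * (1 - \<kappa>) \<le> (3 - p) * 1 + (p - 2) * 1" by (rule add_mono)
    then show "0 \<le> 1 - (3 - p) * \<kappa> - (p - 2) * (1 - \<kappa>)"
      by (simp only: diff_diff_eq le_diff_eq add_0) simp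
  qed
  moreover have "0 \<le> (p - 2) * (lam * L)" using p lam0 L0 by simp
  ultimately have "(3 - p) * (\<mu> * D) \<le> 0" by linarith
  then have "D \<le> 0" using p \<mu>0 by (simp add: mult_le_0_iff)
  with D0 have "A = 0" by (simp add: D_def)
  then have "AE x in lebesgue. u' x = 0" by (intro AE_completion zero_energy)
  with ue show ?thesis by eventually_elim simp
qed

text \<open>The choice t = 1 cancels G exactly and leaves (\<mu> - 1/4) D \<le> 0, so the strict
  bound on \<mu> is what forces D = 0.\<close>

lemma cubic_nonexistence:
  fixes V :: "R3 \<Rightarrow> real"
  assumes V: "continuous_on UNIV V" "\<And>x. V x \<ge> 0" and lam: "lam > 0" and \<mu>: "\<mu> > 1 / 4"
    and sol: "weak_solution V lam \<mu> 3 u"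
  shows "AE x in lebesgue. u x = 0"
proof -
  obtain u' g where sb: "sobolev_borel u' g" and ue: "AE x in lebesgue. u x = u' x"
    and iV: "integrable lborel (\<lambda>x. V x * (u' x)\<^sup>2)"
    and id: "sobolev_borel.G g + lam * (LBINT x. V x * (u' x)\<^sup>2) + \<mu> * (sobolev_borel.A u' / (4 * pi))
      = (LBINT x. \<bar>u' x\<bar> powr 3)"
    by (rule weak_solution_energy_identity[OF V sol]) auto
  interpret sobolev_borel u' g by (rule sb)
  define D where "D = A / (4 * pi)"
  have D0: "D \<ge> 0" unfolding D_def using A_nonneg by simp
  have "(LBINT x. V x * (u' x)\<^sup>2) \<ge> 0" using V(2) by (intro integral_nonneg_AE) auto
  then have L: "lam * (LBINT x. V x * (u' x)\<^sup>2) \<ge> 0" using lam by simp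
  have "(LBINT x. \<bar>u' x\<bar> powr 3) \<le> (LBINT x. \<bar>u' x\<bar> ^ 3)"
    using powr_integrable(2)[of 3] by simp
  also have "\<dots> \<le> 1 * G + A / (16 * pi * 1)" by (rule cubic_integral_le) simp
  also have "A / (16 * pi * 1) = D / 4" by (simp add: D_def)
  finally have "\<mu> * D \<le> 1 / 4 * D" using id L unfolding D_def[symmetric] by linarith
  then have "(\<mu> - 1 / 4) * D \<le> 0" by (simp add: left_diff_distrib)
  then have "D \<le> 0" using \<mu> by (simp add: mult_le_0_iff)
  with D0 have "A = 0" by (simp add: D_def)
  then have "AE x in lebesgue. u' x = 0" by (intro AE_completion zero_energy)
  with ue show ?thesis by eventually_elim simp
qed

theorem theorem1p2:
  fixes V :: "real^3 \<Rightarrow> real" and b :: real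
  assumes V1: "continuous_on UNIV V" "\<forall>x. V x \<ge> 0"
    and V2: "b > 0" "{x. V x < b} \<noteq> {}" "emeasure lebesgue {x. V x < b} < \<infinity>"
    and V3: "interior (V -` {0}) \<noteq> {}" "open (interior (V -` {0}))"
            "locally_lipschitz_boundary (interior (V -` {0}))"
            "closure (interior (V -` {0})) = V -` {0}"
  shows
    "(\<forall>p lam \<mu>. 2 < p \<and> p < 3 \<and> measure lebesgue {x. V x < b} < sobolev_S powr (3/2)
        \<and> lam \<ge> 1 / b
        \<and> \<mu> \<ge> 1 / (4 * (1 - measure lebesgue {x. V x < b} powr (2/3) / sobolev_S))
        \<longrightarrow> \<not> (\<exists>u. weak_solution V lam \<mu> p u \<and> nontrivial u))
     \<and> (\<forall>lam \<mu>. lam > 0 \<and> \<mu> > 1/4 \<longrightarrow> \<not> (\<exists>u. weak_solution V lam \<mu> 3 u \<and> nontrivial u))"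
  using sub_critical_nonexistence[OF V1(1) V1(2)[rule_format] V2(1,3)]
    cubic_nonexistence[OF V1(1) V1(2)[rule_format]]
  unfolding nontrivial_def by blast

end
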